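(* Let $(F,v)$ be a Henselian valued field of characteristic $p>0$. Let $D$ be a finite-dimensional division algebra with center $F$ whose degree is a power of $p$, equipped with the valuation extending $v$. Assume that $D$ is semi-ramified, that the residue field extension $\overline D/\overline F$ is separable, and that $D$ is non-degenerate. Then $D$ is indecomposable.
   Context: For a valued division algebra $(D,v)$ with center $F$ (finite-dimensional over $F$), $\overline{D}$ denotes the residue division algebra and $\Gamma_D=v(D^* )$ the value group (a totally ordered abelian group), and similarly for $F$. $(D,v)$ is semi-ramified if $\overline{D}$ is a field and $[\overline{D}:\overline{F}]=|\Gamma_D:\Gamma_F|=\sqrt{[D:F]}$. If $(D,v)$ is semi-ramified with $\overline D/\overline F$ separable, then $\overline D/\overline F$ is abelian Galois and the map $\theta_D:\Gamma_D/\Gamma_F\to\mathrm{Gal}(\overline D/\overline F)$, where $\theta_D(v(x)+\Gamma_F)$ is the automorphism $\overline d\mapsto\overline{xdx^{-1}}$, is an isomorphism. Choose a basis $\sigma_1,\dots,\sigma_r$ of the finite abelian group $G=\mathrm{Gal}(\overline D/\overline F)$ (so $G=\langle\sigma_1\rangle\times\cdots\times\langle\sigma_r\rangle$) and $\pi_i\in D^*$ with $\theta_D(v(\pi_i)+\Gamma_F)=\sigma_i$. For $\overline m=(m_1,\dots,m_r)\in\mathbb N^r$ put $\sigma^{\overline m}=\sigma_1^{m_1}\cdots\sigma_r^{m_r}$, $\pi^{\overline m}=\pi_1^{m_1}\cdots\pi_r^{m_r}$, and let $\bar u_{\overline m,\overline n}\in\overline D^*$ be the residue of $\pi^{\overline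 m}\pi^{\overline n}(\pi^{\overline m})^{-1}(\pi^{\overline n})^{-1}$. $(D,v)$ is degenerate if there are $\sigma^{\overline m},\sigma^{\overline n}\in G$ and $a,b\in\overline D^*$ such that $\langle\sigma^{\overline m},\sigma^{\overline n}\rangle$ is noncyclic and $\bar u_{\overline m,\overline n}=\sigma^{\overline m}(a)a^{-1}\,\sigma^{\overline n}(b)b^{-1}$; otherwise it is non-degenerate. (This does not depend on the choices made.) $D$ is indecomposable if it is not isomorphic to $D_1\otimes_FD_2$ with $D_1,D_2$ central $F$-division algebras both of index greater than $1$. *)

theory Defs
  imports Complex_Main "HOL-Algebra.Algebra"
begin

section \<open>Central division algebras\<close>

locale division_algebra = ring D for D (structure) +
  assumes division: "Units D = carrier D - {\<zero>}"

definition center :: "('a, 'm) ring_scheme \<Rightarrow> 'a set" where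
  "center D = {z \<in> carrier D. \<forall>x \<in> carrier D. z \<otimes>\<^bsub>D\<^esub> x = x \<otimes>\<^bsub>D\<^esub> z}"

text \<open>
  The library locale \<^locale>\<open>algebra\<close> only covers commutative algebras, hence the explicit
  compatibility axioms between scalars and multiplication. The field \<open>F\<close> is identified with its
  image \<open>F \<odot> \<one>\<close>, which has to be the whole center.
\<close>

locale central_division_algebra = F?: field F + D?: division_algebra D + module F D
  for F :: "('f, 'm) ring_scheme" (structure) and D :: "('f, 'd, 'k) module_scheme" (structure) +
  assumes smult_mult_left:
      "\<lbrakk>c \<in> carrier F; x \<in> carrier D; y \<in> carrier D\<rbrakk> \<Longrightarrow>
        c \<odot>\<^bsub>D\<^esub> (x \<otimes>\<^bsub>D\<^esub> y) = (c \<odot>\<^bsub>D\<^esub> x) \<otimes>\<^bsub>D\<^esub> y"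
    and smult_mult_right:
      "\<lbrakk>c \<in> carrier F; x \<in> carrier D; y \<in> carrier D\<rbrakk> \<Longrightarrow>
        c \<odot>\<^bsub>D\<^esub> (x \<otimes>\<^bsub>D\<^esub> y) = x \<otimes>\<^bsub>D\<^esub> (c \<odot>\<^bsub>D\<^esub> y)"
    and center_eq: "center D = (\<lambda>c. c \<odot>\<^bsub>D\<^esub> \<one>\<^bsub>D\<^esub>) ` carrier F"
    and finite_dim: "ring.finite_dimension D (center D) (carrier D)"

text \<open>
  The degree, \<open>sqrt [D:F]\<close>; for a division algebra it is also the index.
\<close>

definition algebra_degree :: "('a, 'm) ring_scheme \<Rightarrow> real" where
  "algebra_degree D = sqrt (real ((ring.dim D over center D) (carrier D)))"

definition has_characteristic :: "('a, 'm) ring_scheme \<Rightarrow> nat \<Rightarrow> bool" where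
  "has_characteristic F p \<longleftrightarrow> (\<forall>n::nat. [n] \<cdot>\<^bsub>F\<^esub> \<one>\<^bsub>F\<^esub> = \<zero>\<^bsub>F\<^esub> \<longleftrightarrow> p dvd n)"


section \<open>Tensor products and indecomposability\<close>

definition basis_vector :: "('r, 'm) ring_scheme \<Rightarrow> 'b \<Rightarrow> 'b \<Rightarrow> 'r" where
  "basis_vector R x = (\<lambda>y. if y = x then \<one>\<^bsub>R\<^esub> else \<zero>\<^bsub>R\<^esub>)"

definition monoid_algebra ::
  "('r, 'm) ring_scheme \<Rightarrow> ('b, 'n) monoid_scheme \<Rightarrow> ('r, 'b \<Rightarrow> 'r) module" where
  "monoid_algebra R M =
    \<lparr>carrier = {f. (\<forall>x \<in> carrier M. f x \<in> carrier R) \<and> (\<forall>x. x \<notin> carrier M \<longrightarrow> f x = \<zero>\<^bsub>R\<^esub>) \<and>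
                   finite {x. f x \<noteq> \<zero>\<^bsub>R\<^esub>}},
     monoid.mult = (\<lambda>f g z. finsum R (\<lambda>(x, y). f x \<otimes>\<^bsub>R\<^esub> g y)
       {(x, y). f x \<noteq> \<zero>\<^bsub>R\<^esub> \<and> g y \<noteq> \<zero>\<^bsub>R\<^esub> \<and> x \<otimes>\<^bsub>M\<^esub> y = z}),
     one = basis_vector R \<one>\<^bsub>M\<^esub>,
     ring.zero = (\<lambda>_. \<zero>\<^bsub>R\<^esub>),
     ring.add = (\<lambda>f g x. f x \<oplus>\<^bsub>R\<^esub> g x),
     smult = (\<lambda>c f x. c \<otimes>\<^bsub>R\<^esub> f x)\<rparr>"

definition tensor_relations ::
  "('f, 'm) ring_scheme \<Rightarrow> ('f, 'b, 'k) module_scheme \<Rightarrow> ('f, 'c, 'l) module_scheme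
    \<Rightarrow> ('b \<times> 'c \<Rightarrow> 'f) set" where
  "tensor_relations F A B =
    (let P = monoid_algebra F (A \<times>\<times> B); e = (\<lambda>a b. basis_vector F (a, b)) in
      {e (a \<oplus>\<^bsub>A\<^esub> a') b \<ominus>\<^bsub>P\<^esub> (e a b \<oplus>\<^bsub>P\<^esub> e a' b) | a a' b.
         a \<in> carrier A \<and> a' \<in> carrier A \<and> b \<in> carrier B} \<union>
      {e a (b \<oplus>\<^bsub>B\<^esub> b') \<ominus>\<^bsub>P\<^esub> (e a b \<oplus>\<^bsub>P\<^esub> e a b') | a b b'.
         a \<in> carrier A \<and> b \<in> carrier B \<and> b' \<in> carrier B} \<union>
      {e (c \<odot>\<^bsub>A\<^esub> a) b \<ominus>\<^bsub>P\<^esub> c \<odot>\<^bsub>P\<^esub> e a b | c a b.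
         c \<in> carrier F \<and> a \<in> carrier A \<and> b \<in> carrier B} \<union>
      {e a (c \<odot>\<^bsub>B\<^esub> b) \<ominus>\<^bsub>P\<^esub> c \<odot>\<^bsub>P\<^esub> e a b | c a b.
         c \<in> carrier F \<and> a \<in> carrier A \<and> b \<in> carrier B})"

text \<open>
  As a module, \<open>A \<otimes>\<^sub>F B\<close> is the free module on \<open>A \<times> B\<close> modulo the submodule spanned by the bilinearity
  relations. The product \<open>(a \<otimes> b)(a' \<otimes> b') = aa' \<otimes> bb'\<close> is induced by the monoid algebra structure
  on the free module. Multiplying a relation by a basis vector gives a relation again, so the
  submodule is already the ideal generated by the relations.
\<close>

definition tensor_algebra ::
  "('f, 'm) ring_scheme \<Rightarrow> ('f, 'b, 'k) module_scheme \<Rightarrow> ('f, 'c, 'l) module_scheme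
    \<Rightarrow> ('f, ('b \<times> 'c \<Rightarrow> 'f) set) module" where
  "tensor_algebra F A B =
    (let P = monoid_algebra F (A \<times>\<times> B); I = Idl\<^bsub>P\<^esub> (tensor_relations F A B) in
      ring.extend (P Quot I)
        \<lparr>smult = (\<lambda>c S. (\<Union>f\<in>S. I +>\<^bsub>P\<^esub> (c \<odot>\<^bsub>P\<^esub> f)))\<rparr>)"

definition algebra_isomorphic ::
  "('f, 'm) ring_scheme \<Rightarrow> ('f, 'a, 'k) module_scheme \<Rightarrow> ('f, 'b, 'l) module_scheme \<Rightarrow> bool" where
  "algebra_isomorphic F A B \<longleftrightarrow>
    (\<exists>h \<in> ring_iso A B. \<forall>c \<in> carrier F. \<forall>x \<in> carrier A. h (c \<odot>\<^bsub>A\<^esub> x) = c \<odot>\<^bsub>B\<^esub> h x)"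

text \<open>
  HOL cannot quantify over the element types of the two factors inside a formula, so they are
  parameters. The intended notion is the one for all types \<open>'b\<close> and \<open>'c\<close>.
\<close>

definition indecomposable ::
  "'b itself \<Rightarrow> 'c itself \<Rightarrow> ('f, 'm) ring_scheme \<Rightarrow> ('f, 'd, 'k) module_scheme \<Rightarrow> bool" where
  "indecomposable _ _ F D \<longleftrightarrow>
    \<not> (\<exists>(A :: ('f, 'b) module) (B :: ('f, 'c) module).
         central_division_algebra F A \<and> central_division_algebra F B \<and>
         algebra_degree A > 1 \<and> algebra_degree B > 1 \<and>
         algebra_isomorphic F D (tensor_algebra F A B))"


section \<open>Valuations and residues\<close>

text \<open>
  Valuations are written additively. The value of \<open>v\<close> at \<open>\<zero>\<close> is irrelevant; it stands for \<open>\<infinity>\<close>.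
\<close>

definition valuation :: "('a, 'm) ring_scheme \<Rightarrow> ('a \<Rightarrow> 'g::linordered_ab_group_add) \<Rightarrow> bool" where
  "valuation D v \<longleftrightarrow>
    (\<forall>x \<in> carrier D - {\<zero>\<^bsub>D\<^esub>}. \<forall>y \<in> carrier D - {\<zero>\<^bsub>D\<^esub>}.
      v (x \<otimes>\<^bsub>D\<^esub> y) = v x + v y \<and>
      (x \<oplus>\<^bsub>D\<^esub> y \<noteq> \<zero>\<^bsub>D\<^esub> \<longrightarrow> min (v x) (v y) \<le> v (x \<oplus>\<^bsub>D\<^esub> y)))"

definition valuation_ring ::
  "('a, 'm) ring_scheme \<Rightarrow> ('a \<Rightarrow> 'g::linordered_ab_group_add) \<Rightarrow> 'a set" where
  "valuation_ring D v = {x \<in> carrier D. x = \<zero>\<^bsub>D\<^esub> \<or> 0 \<le> v x}"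

definition valuation_ideal ::
  "('a, 'm) ring_scheme \<Rightarrow> ('a \<Rightarrow> 'g::linordered_ab_group_add) \<Rightarrow> 'a set" where
  "valuation_ideal D v = {x \<in> carrier D. x = \<zero>\<^bsub>D\<^esub> \<or> 0 < v x}"

definition residue_ring ::
  "('a, 'm) ring_scheme \<Rightarrow> ('a \<Rightarrow> 'g::linordered_ab_group_add) \<Rightarrow> 'a set ring" where
  "residue_ring D v = D\<lparr>carrier := valuation_ring D v\<rparr> Quot valuation_ideal D v"

definition residue ::
  "('a, 'm) ring_scheme \<Rightarrow> ('a \<Rightarrow> 'g::linordered_ab_group_add) \<Rightarrow> 'a \<Rightarrow> 'a set" where
  "residue D v x = valuation_ideal D v +>\<^bsub>D\<lparr>carrier := valuation_ring D v\<rparr>\<^esub> x"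

text \<open>The residue field of the center, as a subfield of the residue ring of \<open>D\<close>.\<close>

definition residue_center ::
  "('a, 'm) ring_scheme \<Rightarrow> ('a \<Rightarrow> 'g::linordered_ab_group_add) \<Rightarrow> 'a set set" where
  "residue_center D v = residue D v ` (center D \<inter> valuation_ring D v)"

definition value_group ::
  "('a, 'm) ring_scheme \<Rightarrow> ('a \<Rightarrow> 'g::linordered_ab_group_add) \<Rightarrow> 'g monoid" where
  "value_group D v = \<lparr>carrier = v ` (carrier D - {\<zero>\<^bsub>D\<^esub>}), monoid.mult = (+), one = 0\<rparr>"

definition value_index :: "('a, 'm) ring_scheme \<Rightarrow> ('a \<Rightarrow> 'g::linordered_ab_group_add) \<Rightarrow> nat" where
  "value_index D v = card (rcosets\<^bsub>value_group D v\<^esub> (v ` (center D - {\<zero>\<^bsub>D\<^esub>})))"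

definition semi_ramified :: "('a, 'm) ring_scheme \<Rightarrow> ('a \<Rightarrow> 'g::linordered_ab_group_add) \<Rightarrow> bool" where
  "semi_ramified D v \<longleftrightarrow>
    field (residue_ring D v) \<and>
    ring.finite_dimension (residue_ring D v) (residue_center D v) (carrier (residue_ring D v)) \<and>
    real ((ring.dim (residue_ring D v) over residue_center D v) (carrier (residue_ring D v)))
      = algebra_degree D \<and>
    real (value_index D v) = algebra_degree D"


section \<open>Henselian fields and separable extensions\<close>

text \<open>Library polynomials are coefficient lists with the leading coefficient first.\<close>

fun deriv_coeffs :: "('a, 'm) ring_scheme \<Rightarrow> 'a list \<Rightarrow> 'a list" where
  "deriv_coeffs R [] = []"
| "deriv_coeffs R [a] = []"
| "deriv_coeffs R (a # b # f) = ([length (b # f)] \<cdot>\<^bsub>R\<^esub> a) # deriv_coeffs R (b # f)"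

definition poly_deriv :: "('a, 'm) ring_scheme \<Rightarrow> 'a list \<Rightarrow> 'a list" where
  "poly_deriv R f = ring.normalize R (deriv_coeffs R f)"

text \<open>
  Hensel's lemma: a simple root, in the residue field, of a monic polynomial over the valuation
  ring lifts to a root in the valuation ring. The residue root is given by a representative \<open>a\<close>.
\<close>

definition henselian :: "('a, 'm) ring_scheme \<Rightarrow> ('a \<Rightarrow> 'g::linordered_ab_group_add) \<Rightarrow> bool" where
  "henselian F v \<longleftrightarrow>
    (\<forall>f \<in> carrier (univ_poly F (valuation_ring F v)). \<forall>a \<in> valuation_ring F v.
      f \<noteq> [] \<and> lead_coeff f = \<one>\<^bsub>F\<^esub> \<and>
      ring.eval F f a \<in> valuation_ideal F v \<and>
      ring.eval F (poly_deriv F f) a \<notin> valuation_ideal F v \<longrightarrow>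
      (\<exists>b \<in> valuation_ring F v. ring.eval F f b = \<zero>\<^bsub>F\<^esub> \<and> b \<ominus>\<^bsub>F\<^esub> a \<in> valuation_ideal F v))"

definition separable_poly :: "('a, 'm) ring_scheme \<Rightarrow> 'a set \<Rightarrow> 'a list \<Rightarrow> bool" where
  "separable_poly L K f \<longleftrightarrow>
    (\<forall>q \<in> carrier (univ_poly L K).
      q divides\<^bsub>univ_poly L K\<^esub> f \<and> q divides\<^bsub>univ_poly L K\<^esub> poly_deriv L f \<longrightarrow>
      q \<in> Units (univ_poly L K))"

definition separable_extension :: "('a, 'm) ring_scheme \<Rightarrow> 'a set \<Rightarrow> bool" where
  "separable_extension L K \<longleftrightarrow>
    (\<forall>x \<in> carrier L. (ring.algebraic L over K) x \<and> separable_poly L K (ring.Irr L K x))"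


section \<open>Degenerate valued division algebras\<close>

definition galois_group :: "('a, 'm) ring_scheme \<Rightarrow> 'a set \<Rightarrow> ('a \<Rightarrow> 'a) monoid" where
  "galois_group L K =
    (BijGroup (carrier L))
      \<lparr>carrier := {s \<in> Bij (carrier L) \<inter> ring_hom L L. \<forall>x \<in> K. s x = x}\<rparr>"

abbreviation residue_galois_group ::
  "('a, 'm) ring_scheme \<Rightarrow> ('a \<Rightarrow> 'g::linordered_ab_group_add) \<Rightarrow> ('a set \<Rightarrow> 'a set) monoid" where
  "residue_galois_group D v \<equiv> galois_group (residue_ring D v) (residue_center D v)"

text \<open>The ordered product \<open>x\<^sub>0^m\<^sub>0 \<cdots> x\<^sub>r\<^sub>-\<^sub>1^m\<^sub>r\<^sub>-\<^sub>1\<close>; families are indexed from \<open>0\<close>.\<close>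

primrec ordered_power ::
  "('a, 'm) monoid_scheme \<Rightarrow> (nat \<Rightarrow> 'a) \<Rightarrow> (nat \<Rightarrow> nat) \<Rightarrow> nat \<Rightarrow> 'a" where
  "ordered_power G x m 0 = \<one>\<^bsub>G\<^esub>"
| "ordered_power G x m (Suc r) = ordered_power G x m r \<otimes>\<^bsub>G\<^esub> x r [^]\<^bsub>G\<^esub> m r"

definition group_basis :: "('a, 'm) monoid_scheme \<Rightarrow> nat \<Rightarrow> (nat \<Rightarrow> 'a) \<Rightarrow> bool" where
  "group_basis G r s \<longleftrightarrow>
    (\<forall>i<r. s i \<in> carrier G) \<and>
    (\<lambda>g. finprod G g {..<r}) \<in> iso (product_group {..<r} (\<lambda>i. subgroup_generated G {s i})) G"

text \<open>
  The last clause says that \<open>\<theta>\<^sub>D\<close> maps the class of \<open>v (\<pi> i)\<close> to \<open>\<sigma> i\<close>, that is, \<open>\<sigma> i\<close> is the automorphism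
  of the residue field induced by conjugation with \<open>\<pi> i\<close>.
\<close>

definition galois_lift ::
  "('a, 'm) ring_scheme \<Rightarrow> ('a \<Rightarrow> 'g::linordered_ab_group_add) \<Rightarrow> nat
    \<Rightarrow> (nat \<Rightarrow> 'a set \<Rightarrow> 'a set) \<Rightarrow> (nat \<Rightarrow> 'a) \<Rightarrow> bool" where
  "galois_lift D v r \<sigma> \<pi> \<longleftrightarrow>
    group_basis (residue_galois_group D v) r \<sigma> \<and>
    (\<forall>i<r. \<pi> i \<in> carrier D - {\<zero>\<^bsub>D\<^esub>} \<and>
      (\<forall>d \<in> valuation_ring D v.
        \<sigma> i (residue D v d) = residue D v (\<pi> i \<otimes>\<^bsub>D\<^esub> d \<otimes>\<^bsub>D\<^esub> inv\<^bsub>D\<^esub> \<pi> i)))"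

definition degenerate ::
  "('a, 'm) ring_scheme \<Rightarrow> ('a \<Rightarrow> 'g::linordered_ab_group_add) \<Rightarrow> nat
    \<Rightarrow> (nat \<Rightarrow> 'a set \<Rightarrow> 'a set) \<Rightarrow> (nat \<Rightarrow> 'a) \<Rightarrow> bool" where
  "degenerate D v r \<sigma> \<pi> \<longleftrightarrow>
    (let L = residue_ring D v; G = residue_galois_group D v;
         sig = (\<lambda>m. ordered_power G \<sigma> m r); pow = (\<lambda>m. ordered_power D \<pi> m r) in
      \<exists>m n. \<exists>a \<in> carrier L - {\<zero>\<^bsub>L\<^esub>}. \<exists>b \<in> carrier L - {\<zero>\<^bsub>L\<^esub>}.
        \<not> cyclic_group (subgroup_generated G {sig m, sig n}) \<and>
        residue D v (pow m \<otimes>\<^bsub>D\<^esub> pow n \<otimes>\<^bsub>D\<^esub> inv\<^bsub>D\<^esub> pow m \<otimes>\<^bsub>D\<^esub> inv\<^bsub>D\<^esub> pow n)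
          = sig m a \<otimes>\<^bsub>L\<^esub> inv\<^bsub>L\<^esub> a \<otimes>\<^bsub>L\<^esub> (sig n b \<otimes>\<^bsub>L\<^esub> inv\<^bsub>L\<^esub> b))"

end

theory Submission
  imports Defs
begin

text \<open>
  Let \<open>A\<close> and \<open>B\<close> be the images in \<open>D\<close> of the two factors of a decomposition. Elements of \<open>A\<close> and \<open>B\<close>
  commute, so by non-degeneracy the classes of their values in the \<open>p\<close>-group \<open>\<Gamma>\<^sub>D/\<Gamma>\<^sub>F\<close>, which \<open>\<theta>\<^sub>D\<close>
  identifies with the Galois group, generate a cyclic subgroup: one class is a multiple of the other.
  Consequently, for one of the factors, say \<open>A\<close>, the classes of the values form a cyclic group, and they
  are all attained on \<open>B\<close>. Since \<open>B\<close> centralizes \<open>A\<close>, conjugation by elements of \<open>A\<close> is then trivial on the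
  residue field of \<open>A\<close>. By Wedderburn's factorization of minimal polynomials this residue field is
  purely inseparable over, hence equal to, that of \<open>F\<close>. As \<open>D\<close> has an orthogonal basis over \<open>F\<close>, this
  forces \<open>A\<close> to be spanned by the powers of one element, so \<open>A\<close> is commutative and equal to \<open>F\<close>.
\<close>

section \<open>Valued division rings\<close>

text \<open>From the tensor product the proof keeps two embeddings into \<open>D\<close> with
  commuting images whose centers are \<open>F\<close>. The obstacle is that nothing is known about
  how the two factors sit in the valuation: neither is known to be semi-ramified. All counting is
  therefore done in \<open>D\<close>, where \<open>[D:F]\<close> is the product of the residue
  degree and the index of the value groups. This equality makes the products of a lifted residue
  basis with representatives of the value classes a full orthogonal basis. Bijectivity of
  \<open>\<theta>\<^sub>D\<close> is derived: injectivity by comparing Artin's bound with the index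
  of the value groups, surjectivity from the lifts \<open>\<pi>\<close> of a basis of the Galois
  group. The prime power degree enters because the subgroups of a cyclic \<open>p\<close>-group form
  a chain. This yields a dichotomy: either a class attained on one factor is missed by the other,
  and then all classes of the other are multiples of it, or both factors attain the same classes. In
  each case one factor has pairwise comparable classes that are all attained on the other.\<close>

context division_algebra
begin

abbreviation nonzero :: "'a set" where "nonzero \<equiv> carrier D - {\<zero>}"

lemma nonzero_Units [simp]: "x \<in> carrier D \<Longrightarrow> x \<noteq> \<zero> \<Longrightarrow> x \<in> Units D"
  using division by blast

lemma one_neq_zero [simp]: "\<one> \<noteq> \<zero>"
  using division Units_one_closed by blast

lemma inv_nonzero [simp]:
  assumes "x \<in> carrier D" "x \<noteq> \<zero>"
  shows "inv x \<in> carrier D" "inv x \<noteq> \<zero>" "x \<otimes> inv x = \<one>" "inv x \<otimes> x = \<one>" "inv (inv x) = x"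
proof -
  have "x \<in> Units D" using assms by simp
  then show "inv x \<in> carrier D" "x \<otimes> inv x = \<one>" "inv x \<otimes> x = \<one>" "inv (inv x) = x" by auto
  show "inv x \<noteq> \<zero>" using Units_inv_Units[OF \<open>x \<in> Units D\<close>] division by blast
qed

lemma mult_nonzero [simp]:
  assumes "x \<in> carrier D" "x \<noteq> \<zero>" "y \<in> carrier D" "y \<noteq> \<zero>"
  shows "x \<otimes> y \<noteq> \<zero>"
  using Units_m_closed[of x y] assms division by auto

lemma mult_eq_zero_iff: 
  assumes "x \<in> carrier D" "y \<in> carrier D"
  shows "x \<otimes> y = \<zero> \<longleftrightarrow> x = \<zero> \<or> y = \<zero>"
  using mult_nonzero[OF assms(1) _ assms(2)] assms by (cases "x = \<zero>"; cases "y = \<zero>") simp_all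

lemma pow_nonzero [simp]: "x \<in> carrier D \<Longrightarrow> x \<noteq> \<zero> \<Longrightarrow> x [^] (n::nat) \<noteq> \<zero>"
  by (induction n) auto

lemma inv_mult_cancel [simp]:
  assumes "x \<in> carrier D" "x \<noteq> \<zero>" "y \<in> carrier D"
  shows "inv x \<otimes> (x \<otimes> y) = y" "x \<otimes> (inv x \<otimes> y) = y"
  using assms by (simp_all flip: m_assoc)

lemma inv_mult_cancel_right [simp]:
  assumes "x \<in> carrier D" "x \<noteq> \<zero>" "y \<in> carrier D"
  shows "y \<otimes> inv x \<otimes> x = y" "y \<otimes> x \<otimes> inv x = y"
  using assms by (simp_all add: m_assoc)

lemma inv_mult:
  assumes "x \<in> carrier D" "x \<noteq> \<zero>" "y \<in> carrier D" "y \<noteq> \<zero>"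
  shows "inv (x \<otimes> y) = inv y \<otimes> inv x"
  using assms by (intro inv_unique'[symmetric]) (simp_all add: m_assoc)

lemma center_carrier: "z \<in> center D \<Longrightarrow> z \<in> carrier D"
  by (simp add: center_def)

lemma center_comm: "z \<in> center D \<Longrightarrow> x \<in> carrier D \<Longrightarrow> z \<otimes> x = x \<otimes> z"
  by (simp add: center_def)

lemma center_mult_lcomm: 
  "z \<in> center D \<Longrightarrow> x \<in> carrier D \<Longrightarrow> y \<in> carrier D \<Longrightarrow> x \<otimes> (z \<otimes> y) = z \<otimes> (x \<otimes> y)"
  using center_comm[of z x] center_carrier[of z] by (simp flip: m_assoc)

lemma inv_commute:
  assumes "x \<in> carrier D" "z \<in> carrier D" "z \<noteq> \<zero>" "z \<otimes> x = x \<otimes> z"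
  shows "inv z \<otimes> x = x \<otimes> inv z"
proof -
  have iz: "inv z \<in> carrier D" using assms(2,3) by (rule inv_nonzero)
  have "inv z \<otimes> x = inv z \<otimes> (x \<otimes> z \<otimes> inv z)"
    using inv_mult_cancel_right(2)[OF assms(2,3,1)] by simp
  also have "\<dots> = inv z \<otimes> (z \<otimes> x \<otimes> inv z)"
    unfolding assms(4) ..
  also have "\<dots> = inv z \<otimes> (z \<otimes> (x \<otimes> inv z))"
    using m_assoc[OF assms(2,1) iz] by (rule arg_cong)
  also have "\<dots> = x \<otimes> inv z"
    by (rule inv_mult_cancel(1)[OF assms(2,3) m_closed[OF assms(1) iz]])
  finally show ?thesis .
qed

lemma center_inv_mem:
  assumes "z \<in> center D" "z \<noteq> \<zero>"
  shows "inv z \<in> center D"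
  using inv_commute[OF _ center_carrier[OF assms(1)] assms(2) center_comm[OF assms(1)]]
    inv_nonzero(1)[OF center_carrier[OF assms(1)] assms(2)]
  unfolding center_def[of D] by (intro CollectI conjI ballI)

text \<open>Spans, independence and dimensions over \<open>F\<close> are all taken over
  \<open>center D\<close> inside the noncommutative ring \<open>D\<close>, which requires the center
  to be a subfield.\<close>

lemma center_subfield: "subfield (center D) D"
proof -
  have "subring (center D) D"
  proof (rule subringI)
    show "h1 \<otimes> h2 \<in> center D" if h: "h1 \<in> center D" "h2 \<in> center D" for h1 h2
    proof -
      have "h1 \<otimes> h2 \<otimes> x = x \<otimes> (h1 \<otimes> h2)" if x: "x \<in> carrier D" for x
      proof -
        have c: "h1 \<in> carrier D" "h2 \<in> carrier D" using h center_carrier by blast+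
        have "h1 \<otimes> h2 \<otimes> x = h1 \<otimes> (x \<otimes> h2)"
          using m_assoc[OF c x] center_comm[OF h(2) x] by (rule trans[OF _ arg_cong])
        also have "\<dots> = h1 \<otimes> x \<otimes> h2"
          by (rule m_assoc[OF c(1) x c(2), symmetric])
        also have "\<dots> = x \<otimes> h1 \<otimes> h2"
          unfolding center_comm[OF h(1) x] ..
        also have "\<dots> = x \<otimes> (h1 \<otimes> h2)"
          by (rule m_assoc[OF x c])
        finally show ?thesis .
      qed
      then show ?thesis using m_closed[OF center_carrier[OF h(1)] center_carrier[OF h(2)]]
        unfolding center_def[of D] by (intro CollectI conjI ballI)
    qed
    show "h1 \<oplus> h2 \<in> center D" if "h1 \<in> center D" "h2 \<in> center D" for h1 h2
      using that by (simp add: center_def l_distr r_distr)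
    show "\<ominus> h \<in> center D" if "h \<in> center D" for h
      using that by (simp add: center_def l_minus r_minus)
  qed (auto simp: center_def)
  then have "subcring (center D) D"
    by (rule subcringI) (simp add: center_comm center_carrier)
  then show ?thesis
  proof (rule subfieldI)
    show "Units (D\<lparr>carrier := center D\<rparr>) = center D - {\<zero>}"
    proof
      show "Units (D\<lparr>carrier := center D\<rparr>) \<subseteq> center D - {\<zero>}"
        using center_carrier one_neq_zero one_neq_zero[symmetric] l_null unfolding Units_def by auto
      show "center D - {\<zero>} \<subseteq> Units (D\<lparr>carrier := center D\<rparr>)"
      proof
        fix z assume "z \<in> center D - {\<zero>}"
        then show "z \<in> Units (D\<lparr>carrier := center D\<rparr>)"
          using center_inv_mem[of z] center_carrier[of z] inv_nonzero[of z]
          unfolding Units_def by (auto intro!: bexI[of _ "inv z"])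
      qed
    qed
  qed
qed

lemma center_zero_one [simp]: "\<zero> \<in> center D" "\<one> \<in> center D"
  by (auto simp: center_def)

end

section \<open>The valuation ring, its maximal ideal and the residue ring\<close>

locale valued_division_algebra = division_algebra D for D (structure) +
  fixes w :: "'a \<Rightarrow> 'g::linordered_ab_group_add"
  assumes valuation: "valuation D w"
begin

abbreviation V where "V \<equiv> valuation_ring D w"
abbreviation M where "M \<equiv> valuation_ideal D w"
abbreviation L where "L \<equiv> residue_ring D w"
abbreviation K where "K \<equiv> residue_center D w"
abbreviation res where "res \<equiv> residue D w"
abbreviation VR where "VR \<equiv> D\<lparr>carrier := V\<rparr>"

lemma val_mult [simp]:
  "\<lbrakk>x \<in> carrier D; x \<noteq> \<zero>; y \<in> carrier D; y \<noteq> \<zero>\<rbrakk> \<Longrightarrow> w (x \<otimes> y) = w x + w y"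
  using valuation by (auto simp: valuation_def)

lemma val_add:
  "\<lbrakk>x \<in> carrier D; x \<noteq> \<zero>; y \<in> carrier D; y \<noteq> \<zero>; x \<oplus> y \<noteq> \<zero>\<rbrakk> \<Longrightarrow> min (w x) (w y) \<le> w (x \<oplus> y)"
  using valuation by (auto simp: valuation_def)

lemma val_one [simp]: "w \<one> = 0"
  using val_mult[of \<one> \<one>] by simp

lemma val_inv [simp]:
  assumes "x \<in> carrier D" "x \<noteq> \<zero>" shows "w (inv x) = - w x"
  using val_mult[of x "inv x"] assms by (simp add: eq_neg_iff_add_eq_0 add.commute)

text \<open>The square of \<open>\<ominus> \<one>\<close> is \<open>\<one>\<close>, so twice its
  value is \<open>0\<close>, and an ordered group has no torsion.\<close>

lemma val_minus [simp]:
  assumes "x \<in> carrier D" shows "w (\<ominus> x) = w x"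
proof (cases "x = \<zero>")
  case False
  have m1: "\<ominus> \<one> \<noteq> \<zero>" using add.inv_eq_1_iff[of \<one>] by simp
  have "\<ominus> \<one> \<otimes> \<ominus> \<one> = \<one>" by (simp add: l_minus r_minus)
  then have "w (\<ominus> \<one>) + w (\<ominus> \<one>) = 0" using val_mult[of "\<ominus> \<one>" "\<ominus> \<one>"] m1 by simp
  then have "w (\<ominus> \<one>) = 0" by simp
  then show ?thesis using val_mult[of "\<ominus> \<one>" x] m1 assms False by (simp add: l_minus)
qed simp

lemma V_carrier: "x \<in> V \<Longrightarrow> x \<in> carrier D"
  and M_V: "x \<in> M \<Longrightarrow> x \<in> V"
  by (auto simp: valuation_ring_def valuation_ideal_def)

lemma V_zero_one [simp]: "\<zero> \<in> V" "\<one> \<in> V"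
  and M_zero [simp]: "\<zero> \<in> M" and one_notin_M [simp]: "\<one> \<notin> M"
  by (auto simp: valuation_ring_def valuation_ideal_def)

lemma V_add:
  assumes "x \<in> V" "y \<in> V" shows "x \<oplus> y \<in> V"
proof (cases "x = \<zero> \<or> y = \<zero> \<or> x \<oplus> y = \<zero>")
  case False
  then show ?thesis using assms val_add[of x y] by (auto simp: valuation_ring_def min_le_iff_disj)
qed (use assms in \<open>auto simp: valuation_ring_def\<close>)

lemma M_add:
  assumes "x \<in> M" "y \<in> M" shows "x \<oplus> y \<in> M"
proof (cases "x = \<zero> \<or> y = \<zero> \<or> x \<oplus> y = \<zero>")
  case False
  then show ?thesis using assms val_add[of x y] by (auto simp: valuation_ideal_def min_le_iff_disj)
qed (use assms in \<open>auto simp: valuation_ideal_def\<close>)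

lemma V_mult:
  assumes "x \<in> V" "y \<in> V" shows "x \<otimes> y \<in> V"
  using assms by (cases "x = \<zero> \<or> y = \<zero>") (auto simp: valuation_ring_def)

lemma M_mult:
  shows "x \<in> M \<Longrightarrow> y \<in> V \<Longrightarrow> x \<otimes> y \<in> M" and "x \<in> V \<Longrightarrow> y \<in> M \<Longrightarrow> x \<otimes> y \<in> M"
  by (cases "x = \<zero> \<or> y = \<zero>";
      auto simp: valuation_ring_def valuation_ideal_def add_pos_nonneg add_nonneg_pos)+

lemma V_minus: "x \<in> V \<Longrightarrow> \<ominus> x \<in> V" and M_minus: "x \<in> M \<Longrightarrow> \<ominus> x \<in> M"
  by (auto simp: valuation_ring_def valuation_ideal_def)

lemma V_diff: "x \<in> V \<Longrightarrow> y \<in> V \<Longrightarrow> x \<ominus> y \<in> V"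
  by (simp add: a_minus_def V_add V_minus)

lemma V_subring: "subring V D"
  by (rule subringI) (auto simp: V_add V_mult V_minus V_carrier)

lemma V_ring: "ring VR"
  by (rule subring_is_ring[OF V_subring])

lemma V_a_inv: "x \<in> V \<Longrightarrow> \<ominus>\<^bsub>VR\<^esub> x = \<ominus> x"
proof -
  interpret VR: ring VR by (rule V_ring)
  assume x: "x \<in> V"
  show ?thesis
    by (rule VR.minus_equality) (use x V_minus V_carrier in \<open>auto simp: l_neg\<close>)
qed

lemma M_ideal: "ideal M VR"
proof -
  interpret VR: ring VR by (rule V_ring)
  have "subgroup M (add_monoid VR)"
  proof
    fix x assume "x \<in> M"
    then have "inv\<^bsub>add_monoid VR\<^esub> x = \<ominus> x"
      using V_a_inv M_V by (simp add: a_inv_def)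
    then show "inv\<^bsub>add_monoid VR\<^esub> x \<in> M" using M_minus \<open>x \<in> M\<close> by simp
  qed (simp_all add: subsetI M_V M_add)
  then show ?thesis
    by (rule idealI[OF V_ring]) (simp_all add: M_mult)
qed

lemma residue_hom: "ring_hom_ring VR L res"
proof -
  have "res = (+>\<^bsub>VR\<^esub>) M" by (auto simp: residue_def)
  then show ?thesis using ideal.rcos_ring_hom_ring[OF M_ideal] by (simp add: residue_ring_def)
qed

lemma L_ring: "ring L"
  using residue_hom by (simp add: ring_hom_ring_def)

lemma L_carrier: "carrier L = res ` V"
  by (auto simp: residue_ring_def FactRing_def A_RCOSETS_def' residue_def)

lemma res_closed: "x \<in> V \<Longrightarrow> res x \<in> carrier L"
  by (auto simp: L_carrier)

lemma res_mult: "x \<in> V \<Longrightarrow> y \<in> V \<Longrightarrow> res (x \<otimes> y) = res x \<otimes>\<^bsub>L\<^esub> res y"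
  and res_add: "x \<in> V \<Longrightarrow> y \<in> V \<Longrightarrow> res (x \<oplus> y) = res x \<oplus>\<^bsub>L\<^esub> res y"
  and res_one: "res \<one> = \<one>\<^bsub>L\<^esub>"
  and res_zero: "res \<zero> = \<zero>\<^bsub>L\<^esub>"
  and res_minus: "x \<in> V \<Longrightarrow> res (\<ominus> x) = \<ominus>\<^bsub>L\<^esub> res x"
proof -
  interpret h: ring_hom_ring VR L res by (rule residue_hom)
  show "x \<in> V \<Longrightarrow> y \<in> V \<Longrightarrow> res (x \<otimes> y) = res x \<otimes>\<^bsub>L\<^esub> res y"
    and "x \<in> V \<Longrightarrow> y \<in> V \<Longrightarrow> res (x \<oplus> y) = res x \<oplus>\<^bsub>L\<^esub> res y"
    and "res \<one> = \<one>\<^bsub>L\<^esub>"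
    and "res \<zero> = \<zero>\<^bsub>L\<^esub>"
    using h.hom_mult[of x y] h.hom_add[of x y] h.hom_one h.hom_zero by auto
  show "x \<in> V \<Longrightarrow> res (\<ominus> x) = \<ominus>\<^bsub>L\<^esub> res x"
    using h.hom_a_inv[of x] V_a_inv[of x] by simp
qed

lemma res_diff: "x \<in> V \<Longrightarrow> y \<in> V \<Longrightarrow> res (x \<ominus> y) = res x \<ominus>\<^bsub>L\<^esub> res y"
  by (simp add: a_minus_def res_add res_minus V_minus)

lemma res_eq_zero_iff:
  assumes "x \<in> V" shows "res x = \<zero>\<^bsub>L\<^esub> \<longleftrightarrow> x \<in> M"
proof -
  interpret I: ideal M VR by (rule M_ideal)
  have "res x = \<zero>\<^bsub>L\<^esub> \<longleftrightarrow> M +>\<^bsub>VR\<^esub> x = M"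
    by (simp add: residue_def residue_ring_def FactRing_def)
  then show ?thesis using assms I.a_rcos_self[of x] I.a_rcos_const[of x] by auto
qed

lemma res_eq_iff:
  assumes "x \<in> V" "y \<in> V" shows "res x = res y \<longleftrightarrow> x \<ominus> y \<in> M"
proof -
  interpret L: ring L by (rule L_ring)
  have "x \<ominus> y \<in> V" using assms by (simp add: a_minus_def V_add V_minus)
  then show ?thesis using assms res_eq_zero_iff[of "x \<ominus> y"] by (auto simp: res_diff res_closed)
qed

lemma res_nonzero_iff:
  assumes "x \<in> V" shows "res x \<noteq> \<zero>\<^bsub>L\<^esub> \<longleftrightarrow> x \<noteq> \<zero> \<and> w x = 0"
  using assms by (auto simp: res_eq_zero_iff valuation_ring_def valuation_ideal_def)

lemma unit_V: "x \<in> carrier D \<Longrightarrow> x \<noteq> \<zero> \<Longrightarrow> w x = 0 \<Longrightarrow> x \<in> V"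
  by (simp add: valuation_ring_def)

text \<open>Values lie in a commutative group, so conjugation preserves them. This is why every
  nonzero element acts on the residue ring.\<close>

lemma conj_V: 
  "\<lbrakk>x \<in> carrier D; x \<noteq> \<zero>; d \<in> V\<rbrakk> \<Longrightarrow> x \<otimes> d \<otimes> inv x \<in> V"
  by (cases "d = \<zero>") (auto simp: valuation_ring_def)

lemma conj_M: 
  "\<lbrakk>x \<in> carrier D; x \<noteq> \<zero>; d \<in> M\<rbrakk> \<Longrightarrow> x \<otimes> d \<otimes> inv x \<in> M"
  by (cases "d = \<zero>") (auto simp: valuation_ideal_def)

end

section \<open>Separable roots of powers of linear polynomials\<close>

context field
begin

section \<open>Formal derivatives of coefficient lists\<close>

lemma set_deriv_coeffs: "set p \<subseteq> carrier R \<Longrightarrow> set (deriv_coeffs R p) \<subseteq> carrier R"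
  by (induction p rule: induct_list012) auto

lemma length_deriv_coeffs: "length (deriv_coeffs R p) = length p - 1"
  by (induction p rule: induct_list012) auto

lemma eval_deriv_Cons:
  assumes "c \<in> carrier R" "set p \<subseteq> carrier R" "a \<in> carrier R"
  shows "eval (deriv_coeffs R (c # p)) a = add_pow R (length p) c \<otimes> a [^] (length p - 1) \<oplus> eval (deriv_coeffs R p) a"
  using assms by (cases p) (simp_all add: length_deriv_coeffs)

text \<open>Appending a coefficient turns \<open>p\<close> into \<open>pX + c\<close>, so this is
  the Leibniz rule for the product of \<open>p\<close> with \<open>X\<close>.\<close>

lemma eval_deriv_snoc:
  assumes "set p \<subseteq> carrier R" "c \<in> carrier R" "a \<in> carrier R"
  shows "eval (deriv_coeffs R (p @ [c])) a = eval (deriv_coeffs R p) a \<otimes> a \<oplus> eval p a"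
  using assms(1)
proof (induction p)
  case (Cons b p)
  have E: "eval (deriv_coeffs R p) a \<in> carrier R" "eval p a \<in> carrier R"
    using Cons.prems assms set_deriv_coeffs by (auto intro!: eval_in_carrier)
  have b: "b \<in> carrier R" using Cons.prems by simp
  have "eval (deriv_coeffs R ((b # p) @ [c])) a =
      add_pow R (Suc (length p)) b \<otimes> a [^] length p \<oplus> (eval (deriv_coeffs R p) a \<otimes> a \<oplus> eval p a)"
    using eval_deriv_Cons[of b "p @ [c]" a] Cons assms by simp
  also have "add_pow R (Suc (length p)) b \<otimes> a [^] length p
      = add_pow R (length p) b \<otimes> a [^] (length p - 1) \<otimes> a \<oplus> b \<otimes> a [^] length p"
    using b assms by (cases p) (simp_all add: add.nat_pow_Suc l_distr m_assoc)
  finally show ?case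
    using E b assms Cons.prems eval_deriv_Cons[of b p a] by (simp add: l_distr a_ac)
qed (use assms in simp)

lemma eval_deriv_normalize:
  assumes "set p \<subseteq> carrier R" "a \<in> carrier R"
  shows "eval (deriv_coeffs R (normalize p)) a = eval (deriv_coeffs R p) a"
  using assms(1)
proof (induction p)
  case (Cons b p)
  then show ?case
    using eval_deriv_Cons[of b p a] assms(2) set_deriv_coeffs[of p]
    by (auto simp: eval_in_carrier)
qed simp

lemma eval_deriv_replicate:
  assumes "set p \<subseteq> carrier R" "a \<in> carrier R"
  shows "eval (deriv_coeffs R (replicate k \<zero> @ p)) a = eval (deriv_coeffs R p) a"
proof (induction k)
  case (Suc k)
  have s: "set (replicate k \<zero> @ p) \<subseteq> carrier R" using assms by auto
  show ?case
    using Suc eval_deriv_Cons[OF zero_closed s assms(2)] assms set_deriv_coeffs[of p]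
    by (simp add: eval_in_carrier)
qed simp

lemma set_map2_add:
  "set p \<subseteq> carrier R \<Longrightarrow> set q \<subseteq> carrier R \<Longrightarrow> set (map2 (\<oplus>) p q) \<subseteq> carrier R"
  by (induction p q rule: list_induct2') auto

lemma eval_deriv_map2:
  assumes "length p = length q" "set p \<subseteq> carrier R" "set q \<subseteq> carrier R" "a \<in> carrier R"
  shows "eval (deriv_coeffs R (map2 (\<oplus>) p q)) a = eval (deriv_coeffs R p) a \<oplus> eval (deriv_coeffs R q) a"
  using assms(1-3)
proof (induction p q rule: list_induct2)
  case (Cons b p c q)
  have s: "set (map2 (\<oplus>) p q) \<subseteq> carrier R"
    using Cons.prems by (intro set_map2_add) auto
  have l: "length (map2 (\<oplus>) p q) = length q" "length p = length q" using Cons.hyps by auto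
  have E: "eval (deriv_coeffs R p) a \<in> carrier R" "eval (deriv_coeffs R q) a \<in> carrier R"
    using Cons.prems assms set_deriv_coeffs by (auto intro!: eval_in_carrier)
  show ?case
    using eval_deriv_Cons[of "b \<oplus> c" "map2 (\<oplus>) p q" a] eval_deriv_Cons[of b p a] eval_deriv_Cons[of c q a]
      Cons s E assms(4) unfolding l
    by (simp add: add.nat_pow_distrib l_distr a_ac add_pow_ldistr)
qed simp

lemma eval_deriv_poly_add:
  assumes "set p \<subseteq> carrier R" "set q \<subseteq> carrier R" "a \<in> carrier R"
  shows "eval (deriv_coeffs R (poly_add p q)) a = eval (deriv_coeffs R p) a \<oplus> eval (deriv_coeffs R q) a"
proof -
  have aux: "eval (deriv_coeffs R (poly_add p q)) a = eval (deriv_coeffs R p) a \<oplus> eval (deriv_coeffs R q) a"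
    if "set p \<subseteq> carrier R" "set q \<subseteq> carrier R" "length q \<le> length p" for p q
  proof -
    let ?q = "replicate (length p - length q) \<zero> @ q"
    have s: "set ?q \<subseteq> carrier R" using that by auto
    have s2: "set (map2 (\<oplus>) p ?q) \<subseteq> carrier R"
      using s that by (intro set_map2_add)
    have "eval (deriv_coeffs R (poly_add p q)) a = eval (deriv_coeffs R (map2 (\<oplus>) p ?q)) a"
      using eval_deriv_normalize[OF s2 assms(3)] that by simp
    also have "\<dots> = eval (deriv_coeffs R p) a \<oplus> eval (deriv_coeffs R ?q) a"
      using s that assms(3) by (intro eval_deriv_map2) auto
    finally show ?thesis using eval_deriv_replicate[OF that(2) assms(3)] by simp
  qed
  have E: "eval (deriv_coeffs R p) a \<in> carrier R" "eval (deriv_coeffs R q) a \<in> carrier R"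
    using assms set_deriv_coeffs by (auto intro!: eval_in_carrier)
  show ?thesis
    using aux[of p q] aux[of q p] assms poly_add_comm[OF assms(1,2)] E a_comm by (metis nat_le_linear)
qed

lemma eval_deriv_map_mult:
  assumes "c \<in> carrier R" "set p \<subseteq> carrier R" "a \<in> carrier R"
  shows "eval (deriv_coeffs R (map ((\<otimes>) c) p)) a = c \<otimes> eval (deriv_coeffs R p) a"
  using assms(2)
proof (induction p)
  case (Cons b p)
  have s: "set (map ((\<otimes>) c) p) \<subseteq> carrier R" using Cons.prems assms by auto
  have "eval (deriv_coeffs R p) a \<in> carrier R"
    using Cons.prems assms set_deriv_coeffs by (auto intro!: eval_in_carrier)
  then show ?case
    using eval_deriv_Cons[of "c \<otimes> b" "map ((\<otimes>) c) p" a] eval_deriv_Cons[of b p a] Cons s assms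
    by (simp add: r_distr add_pow_rdistr flip: m_assoc)
qed (use assms in simp)

text \<open>The list \<open>h @ [\<zero>]\<close> is \<open>X h\<close>. The inner addition of
  \<open>[]\<close> only normalizes; it is kept in the form in which unfolding
  \<open>poly_mult\<close> produces it.\<close>

lemma linear_poly_mult:
  assumes "a \<in> carrier R" "set h \<subseteq> carrier R"
  shows "poly_mult [\<one>, \<ominus> a] h = poly_add (h @ [\<zero>]) (poly_add (map ((\<otimes>) (\<ominus> a)) h) [])"
proof -
  have "map ((\<otimes>) \<one>) h = h" using assms(2) by (intro map_idI) auto
  then show ?thesis by simp
qed

text \<open>The derivative of \<open>(X - a) h\<close> is \<open>h + (X - a) h'\<close>, and the
  second summand vanishes at \<open>a\<close>. Hence \<open>a\<close> is a multiple root of the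
  product only if it is a root of the cofactor.\<close>

lemma eval_deriv_linear_mult:
  assumes "a \<in> carrier R" "set h \<subseteq> carrier R"
  shows "eval (poly_deriv R (poly_mult [\<one>, \<ominus> a] h)) a = eval h a"
proof -
  have E: "eval (deriv_coeffs R h) a \<in> carrier R" "eval h a \<in> carrier R"
    using assms set_deriv_coeffs by (auto intro!: eval_in_carrier)
  have s: "set (map ((\<otimes>) (\<ominus> a)) h) \<subseteq> carrier R" using assms by auto
  have s': "set (poly_add (map ((\<otimes>) (\<ominus> a)) h) []) \<subseteq> carrier R"
    by (rule poly_add_in_carrier[OF s]) simp
  have "eval (poly_deriv R (poly_mult [\<one>, \<ominus> a] h)) a = eval (deriv_coeffs R (poly_mult [\<one>, \<ominus> a] h)) a"
    unfolding poly_deriv_def using assms set_deriv_coeffs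
    by (intro eval_normalize set_deriv_coeffs poly_mult_in_carrier) auto
  also have "\<dots> = eval (deriv_coeffs R (h @ [\<zero>])) a \<oplus> eval (deriv_coeffs R (poly_add (map ((\<otimes>) (\<ominus> a)) h) [])) a"
    unfolding linear_poly_mult[OF assms] using assms s' by (intro eval_deriv_poly_add) auto
  also have "eval (deriv_coeffs R (poly_add (map ((\<otimes>) (\<ominus> a)) h) [])) a = \<ominus> a \<otimes> eval (deriv_coeffs R h) a"
    using eval_deriv_poly_add[OF s _ assms(1), of "[]"] eval_deriv_map_mult[of "\<ominus> a" h a] assms E by simp
  also have "eval (deriv_coeffs R (h @ [\<zero>])) a = eval (deriv_coeffs R h) a \<otimes> a \<oplus> eval h a"
    using assms by (intro eval_deriv_snoc) auto
  finally have "eval (poly_deriv R (poly_mult [\<one>, \<ominus> a] h)) a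
      = eval (deriv_coeffs R h) a \<otimes> a \<oplus> eval h a \<oplus> \<ominus> a \<otimes> eval (deriv_coeffs R h) a" .
  also have "\<dots> = eval h a \<oplus> (a \<otimes> eval (deriv_coeffs R h) a \<oplus> \<ominus> (a \<otimes> eval (deriv_coeffs R h) a))"
    using E assms by (simp add: l_minus m_comm a_ac)
  finally show ?thesis using E assms r_neg[of "a \<otimes> eval (deriv_coeffs R h) a"] by simp
qed

section \<open>Coefficients of powers of a linear polynomial\<close>

lemma linear_poly_mult_coeff:
  assumes "a \<in> carrier R" "set h \<subseteq> carrier R"
  shows "coeff (poly_mult [\<one>, \<ominus> a] h) i = (if i = 0 then \<zero> else coeff h (i - 1)) \<ominus> a \<otimes> coeff h i"
proof -
  have s: "set (map ((\<otimes>) (\<ominus> a)) h) \<subseteq> carrier R" using assms by auto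
  have s': "set (poly_add (map ((\<otimes>) (\<ominus> a)) h) []) \<subseteq> carrier R"
    by (rule poly_add_in_carrier[OF s]) simp
  have c: "coeff h j \<in> carrier R" for j using assms by simp
  have "coeff (poly_mult [\<one>, \<ominus> a] h) i = coeff (h @ [\<zero>]) i \<oplus> coeff (poly_add (map ((\<otimes>) (\<ominus> a)) h) []) i"
    unfolding linear_poly_mult[OF assms] using assms s' by (subst poly_add_coeff) auto
  also have "coeff (poly_add (map ((\<otimes>) (\<ominus> a)) h) []) i = \<ominus> a \<otimes> coeff h i"
    using poly_add_coeff[OF s, of "[]"] scalar_coeff[of "\<ominus> a" h] assms c by simp
  finally show ?thesis using c assms by (simp add: append_coeff a_minus_def l_minus)
qed

lemma linear_poly_closed: "a \<in> carrier R \<Longrightarrow> [\<one>, \<ominus> a] \<in> carrier (poly_ring R)"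
  by (simp add: univ_poly_def polynomial_def)

text \<open>The factors constructed in Wedderburn's factorization obey a recursion that reduces to
  this one, which identifies their residues with the coefficients of
  \<open>(X - a)^n\<close>.\<close>

lemma linear_pow_coeff:
  assumes a: "a \<in> carrier R"
  shows "coeff ([\<one>, \<ominus> a] [^]\<^bsub>poly_ring R\<^esub> (0::nat)) i = (if i = 0 then \<one> else \<zero>)"
    and "coeff ([\<one>, \<ominus> a] [^]\<^bsub>poly_ring R\<^esub> Suc n) i =
      (if i = 0 then \<zero> else coeff ([\<one>, \<ominus> a] [^]\<^bsub>poly_ring R\<^esub> n) (i - 1))
        \<ominus> a \<otimes> coeff ([\<one>, \<ominus> a] [^]\<^bsub>poly_ring R\<^esub> n) i"
proof -
  let ?x = "[\<one>, \<ominus> a]" and ?L = "poly_ring R"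
  interpret L: domain ?L by (rule univ_poly_is_domain[OF carrier_is_subring])
  show "coeff (?x [^]\<^bsub>?L\<^esub> (0::nat)) i = (if i = 0 then \<one> else \<zero>)"
    by (simp add: univ_poly_one)
  have x: "?x \<in> carrier ?L" using a by (rule linear_poly_closed)
  then have xn: "?x [^]\<^bsub>?L\<^esub> n \<in> carrier ?L" by simp
  then have "set (?x [^]\<^bsub>?L\<^esub> n) \<subseteq> carrier R"
    unfolding univ_poly_carrier[symmetric] by (rule polynomial_incl)
  moreover have "?x [^]\<^bsub>?L\<^esub> Suc n = poly_mult ?x (?x [^]\<^bsub>?L\<^esub> n)"
    using L.m_comm[OF xn x] by (simp add: univ_poly_mult del: poly_mult.simps)
  ultimately show "coeff (?x [^]\<^bsub>?L\<^esub> Suc n) i =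
      (if i = 0 then \<zero> else coeff (?x [^]\<^bsub>?L\<^esub> n) (i - 1)) \<ominus> a \<otimes> coeff (?x [^]\<^bsub>?L\<^esub> n) i"
    using linear_poly_mult_coeff[OF a] by metis
qed

lemma poly_mem_subfieldI:
  assumes "p \<in> carrier (poly_ring R)" "\<And>i. coeff p i \<in> K"
  shows "p \<in> carrier (K[X])"
proof -
  have "set p \<subseteq> K" unfolding coeff_img(1)[of p, symmetric] using assms(2) by blast
  then show ?thesis using assms(1) by (auto simp: univ_poly_def polynomial_def)
qed

text \<open>A simple root of a factor of a power of \<open>X - a\<close> forces this factor to be linear.\<close>

lemma separable_root_mem:
  assumes K: "subfield K R" and a: "a \<in> carrier R" and N: "N > 0"
    and P: "[\<one>, \<ominus> a] [^]\<^bsub>poly_ring R\<^esub> (N::nat) \<in> carrier (K[X])"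
    and sep: "(algebraic over K) a" "separable_poly R K (Irr K a)"
  shows "a \<in> K"
proof -
  let ?L = "poly_ring R" and ?f = "Irr K a" and ?x = "[\<one>, \<ominus> a]"
  interpret L: domain ?L by (rule univ_poly_is_domain[OF carrier_is_subring])
  have sK: "subring K R" using K subfieldE(1) by blast
  have f: "?f \<in> carrier (K[X])" "pirreducible K ?f" "eval ?f a = \<zero>"
    using IrrE[OF K a sep(1)] by auto
  have fL: "?f \<in> carrier ?L" using carrier_polynomial_shell[OF sK f(1)] .
  have f0: "?f \<noteq> []" using pirreducibleE(1)[OF sK f(1,2)] .
  have x: "?x \<in> carrier ?L" using a by (simp add: univ_poly_def polynomial_def)
  have "is_root ?f a" using f f0 a by (simp add: is_root_def)
  then have "?x pdivides ?f" by (rule is_root_imp_pdivides[OF fL])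
  then obtain h where h: "h \<in> carrier ?L" "?f = ?x \<otimes>\<^bsub>?L\<^esub> h"
    unfolding pdivides_def by (auto elim: dividesE)
  have hc: "set h \<subseteq> carrier R" using h(1) by (auto simp: univ_poly_def polynomial_def)
  have fc: "set ?f \<subseteq> K" using f(1) by (auto simp: univ_poly_def polynomial_def)
  have dK: "poly_deriv R ?f \<in> carrier (K[X])"
  proof -
    have add: "add_pow R (n::nat) c \<in> K" if "c \<in> K" for n c
      by (induction n) (use that subringE[OF sK] in \<open>auto simp: add.nat_pow_Suc\<close>)
    have "set (deriv_coeffs R q) \<subseteq> K" if "set q \<subseteq> K" for q
      using that by (induction q rule: induct_list012) (auto simp: add subringE(7)[OF sK])
    then show ?thesis using fc normalize_gives_polynomial unfolding poly_deriv_def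
      by (simp add: univ_poly_def)
  qed
  \<comment> \<open>If \<open>a\<close> were a multiple root, the minimal polynomial
    \<open>?f\<close> would divide its own derivative; separability would then make it a
    unit.\<close>
  have "eval h a \<noteq> \<zero>"
  proof
    assume "eval h a = \<zero>"
    then have "eval (poly_deriv R ?f) a = \<zero>"
      using eval_deriv_linear_mult[OF a hc] h(2) by (simp add: univ_poly_def)
    then have "?f divides\<^bsub>K[X]\<^esub> poly_deriv R ?f"
      using Irr_minimal[OF K a sep(1) dK] pdivides_iff_shell[OF K f(1) dK] by blast
    moreover have "?f divides\<^bsub>K[X]\<^esub> ?f"
      using f(1) ring.ring_simprules(6)[OF univ_poly_is_ring[OF sK]]
      by (intro dividesI[of "\<one>\<^bsub>K[X]\<^esub>"]) (auto simp: ring.is_monoid[OF univ_poly_is_ring[OF sK]] monoid.r_one)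
    ultimately have "?f \<in> Units (K[X])" using sep(2) f(1) unfolding separable_poly_def by blast
    then show False using pirreducibleE(2)[OF sK f(1,2)] by blast
  qed
  then have nd: "\<not> ?x pdivides h"
    using pdivides_imp_root_sharing[OF x _ a, of h] a by (auto simp: r_neg)
  have "eval (?x [^]\<^bsub>?L\<^esub> N) a = \<zero>"
  proof -
    have "?x pdivides (?x [^]\<^bsub>?L\<^esub> N)"
      using polynomial_pow_division[OF x, of 1 N] N x by simp
    then show ?thesis using pdivides_imp_root_sharing[OF x _ a] a by (auto simp: r_neg)
  qed
  then have "?f pdivides (?x [^]\<^bsub>?L\<^esub> N)" by (rule Irr_minimal[OF K a sep(1) P])
  then obtain k where k: "k \<in> carrier ?L" "?x [^]\<^bsub>?L\<^esub> N = ?f \<otimes>\<^bsub>?L\<^esub> k"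
    unfolding pdivides_def by (auto elim: dividesE)
  have xk: "?x \<otimes>\<^bsub>?L\<^esub> k \<in> carrier ?L" using x k by simp
  \<comment> \<open>The irreducible \<open>X - a\<close> does not divide \<open>h\<close>, so its
    whole \<open>N\<close>-th power divides the other factor. Comparing degrees leaves degree
    \<open>0\<close> for \<open>h\<close>.\<close>
  have eq: "?x [^]\<^bsub>?L\<^esub> N = h \<otimes>\<^bsub>?L\<^esub> (?x \<otimes>\<^bsub>?L\<^esub> k)"
    using k h x by (simp add: L.m_ac)
  have ir: "pirreducible (carrier R) ?x"
    using degree_one_imp_pirreducible[OF carrier_is_subfield x] by simp
  have "(?x [^]\<^bsub>?L\<^esub> N) pdivides (h \<otimes>\<^bsub>?L\<^esub> (?x \<otimes>\<^bsub>?L\<^esub> k))"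
    unfolding eq[symmetric] using polynomial_pow_division[OF x, of N N] by simp
  then have dv: "(?x [^]\<^bsub>?L\<^esub> N) pdivides (?x \<otimes>\<^bsub>?L\<^esub> k)"
    using pirreducible_pow_pdivides_iff[OF carrier_is_subfield x h(1) xk ir nd] by blast
  have n0: "?x [^]\<^bsub>?L\<^esub> N \<noteq> []" using polynomial_pow_not_zero[OF x] by simp
  have xk0: "?x \<otimes>\<^bsub>?L\<^esub> k \<noteq> []" and h0: "h \<noteq> []"
    using n0 eq h(1) xk L.l_null L.r_null by (auto simp: univ_poly_zero)
  have "degree (?x [^]\<^bsub>?L\<^esub> N) \<le> degree (?x \<otimes>\<^bsub>?L\<^esub> k)"
    using pdivides_imp_degree_le[OF carrier_is_subring _ xk xk0 dv] x by simp
  moreover have "degree (?x [^]\<^bsub>?L\<^esub> N) = degree h + degree (?x \<otimes>\<^bsub>?L\<^esub> k)"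
    unfolding eq using poly_mult_degree_eq[OF carrier_is_subring] h(1) xk h0 xk0
    by (simp add: univ_poly_def del: poly_mult.simps poly_add.simps)
  ultimately have "degree h = 0" by simp
  then have "degree ?f = 1"
    unfolding h(2) using poly_mult_degree_eq[OF carrier_is_subring] h(1) x h0
    by (simp add: univ_poly_def del: poly_mult.simps poly_add.simps)
  then obtain b c where bc: "b \<in> K" "b \<noteq> \<zero>" "c \<in> K" "?f = [b, c]"
    using degree_oneE[OF f(1)] by metis
  then have car: "b \<in> carrier R" "c \<in> carrier R" using subfieldE(3)[OF K] by auto
  have "b \<otimes> a \<oplus> c = \<zero>" using f(3) bc car a by simp
  then have "b \<otimes> a = \<ominus> c" using car a by (simp add: minus_equality)
  then have "a = inv b \<otimes> (\<ominus> c)"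
    using car a bc(2) field_Units by (metis Diff_iff Units_inv_closed Units_l_inv empty_iff insert_iff l_one m_assoc)
  then show ?thesis
    using subfield_m_inv(1)[OF K, of b] bc subringE[OF sK] by auto
qed

end

section \<open>Wedderburn's factorization\<close>

text \<open>
  The left polynomial \<open>\<Sum> c\<^sub>i X\<^sup>i\<close> of degree less than \<open>n\<close> acts on \<open>x\<close> by \<open>\<Sum> c\<^sub>i x d\<^sup>i\<close>, that is, by its value at
  the conjugate \<open>x d x\<^sup>-\<^sup>1\<close>, multiplied by \<open>x\<close>.
\<close>

primrec (in ring) twisted_eval :: "'a \<Rightarrow> (nat \<Rightarrow> 'a) \<Rightarrow> nat \<Rightarrow> 'a \<Rightarrow> 'a" where
  "twisted_eval d c 0 x = \<zero>"
| "twisted_eval d c (Suc n) x = twisted_eval d c n x \<oplus> c n \<otimes> (x \<otimes> d [^] n)"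

section \<open>Rules for the twisted evaluation, and annihilating polynomials\<close>

context division_algebra
begin

lemma twisted_eval_closed [simp]:
  assumes "d \<in> carrier D" "\<And>i. c i \<in> carrier D" "x \<in> carrier D"
  shows "twisted_eval d c n x \<in> carrier D"
  using assms by (induction n) auto

lemma twisted_eval_diff:
  assumes "d \<in> carrier D" "\<And>i. c i \<in> carrier D" "\<And>i. c' i \<in> carrier D" "x \<in> carrier D"
  shows "twisted_eval d (\<lambda>i. c i \<ominus> c' i) n x = twisted_eval d c n x \<ominus> twisted_eval d c' n x"
  using assms
  by (induction n) (simp_all add: a_minus_def l_distr l_minus minus_add a_ac)

lemma twisted_eval_smult:
  assumes "d \<in> carrier D" "\<And>i. c i \<in> carrier D" "a \<in> carrier D" "x \<in> carrier D"
  shows "twisted_eval d (\<lambda>i. a \<otimes> c i) n x = a \<otimes> twisted_eval d c n x"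
  using assms by (induction n) (simp_all add: r_distr m_assoc)

text \<open>Shifting the coefficients is multiplication by the central variable \<open>X\<close>,
  which appears as right multiplication of the value by \<open>d\<close>.\<close>

lemma twisted_eval_shift:
  assumes "d \<in> carrier D" "\<And>i. c i \<in> carrier D" "x \<in> carrier D"
  shows "twisted_eval d (\<lambda>i. if i = 0 then \<zero> else c (i - 1)) (Suc n) x = twisted_eval d c n x \<otimes> d"
  using assms by (induction n) (simp_all add: l_distr m_assoc)

text \<open>Hence a polynomial that annihilates a division subring still does so after its
  coefficients are conjugated by an element of that subring. This is what makes the minimal
  annihilator central.\<close>

lemma twisted_eval_conj:
  assumes "d \<in> carrier D" "\<And>i. c i \<in> carrier D" "y \<in> carrier D" "y \<noteq> \<zero>" "x \<in> carrier D"
  shows "twisted_eval d (\<lambda>i. inv y \<otimes> c i \<otimes> y) n x = inv y \<otimes> twisted_eval d c n (y \<otimes> x)"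
  using assms by (induction n) (simp_all add: r_distr m_assoc)

lemma twisted_eval_cong:
  "(\<And>i. i < n \<Longrightarrow> c i = c' i) \<Longrightarrow> twisted_eval d c n x = twisted_eval d c' n x"
  by (induction n) auto

text \<open>With central coefficients, annihilating \<open>\<one>\<close> is the same as
  annihilating everything.\<close>

lemma twisted_eval_central:
  assumes "d \<in> carrier D" "\<And>i. c i \<in> center D" "x \<in> carrier D"
  shows "twisted_eval d c n x = x \<otimes> twisted_eval d c n \<one>"
  using assms(1,3) center_carrier[OF assms(2)] center_mult_lcomm[OF assms(2)]
  by (induction n) (simp_all add: r_distr)

text \<open>The powers are listed in decreasing order because spans and independent lists grow at
  the head, where the next higher power is added.\<close>

lemma Span_powers:
  assumes d: "d \<in> carrier D" and u: "u \<in> Span (center D) (map (\<lambda>i. d [^] i) (rev [0..<k]))"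
  shows "\<exists>c. (\<forall>i. c i \<in> center D) \<and> u = twisted_eval d c k \<one>"
  using u
proof (induction k arbitrary: u)
  case 0
  then show ?case by (auto intro!: exI[of _ "\<lambda>_. \<zero>"])
next
  case (Suc k)
  then obtain z v where zv: "z \<in> center D" "v \<in> Span (center D) (map (\<lambda>i. d [^] i) (rev [0..<k]))"
    "u = z \<otimes> d [^] k \<oplus> v" by (auto simp: line_extension_mem_iff)
  from Suc.IH[OF zv(2)] obtain c where c: "\<And>i. c i \<in> center D" "v = twisted_eval d c k \<one>" by auto
  have "twisted_eval d (c(k := z)) k \<one> = v"
    unfolding c(2) by (rule twisted_eval_cong) simp
  moreover have "v \<in> carrier D" unfolding c(2) using d c(1) center_carrier by simp
  ultimately have "u = twisted_eval d (c(k := z)) (Suc k) \<one>"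
    using zv d center_carrier by (simp add: a_comm)
  moreover have "\<forall>i. (c(k := z)) i \<in> center D" using c zv by simp
  ultimately show ?case by blast
qed

text \<open>The powers of \<open>d\<close> are dependent in a finite-dimensional algebra. The first
  power that depends on the lower ones gives a monic relation, the minimal polynomial of
  \<open>d\<close> over the center.\<close>

lemma exists_central_annihilator:
  assumes d: "d \<in> carrier D" and fd: "finite_dimension (center D) (carrier D)"
  shows "\<exists>c k. (\<forall>i. c i \<in> center D) \<and> c k = \<one> \<and> twisted_eval d c (Suc k) \<one> = \<zero>"
proof -
  define Us where "Us k = map (\<lambda>i. d [^] i) (rev [0..<k])" for k :: nat
  have Us: "Us (Suc k) = d [^] k # Us k" "set (Us k) \<subseteq> carrier D" "length (Us k) = k" for k
    using d by (auto simp: Us_def)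
  from fd obtain n where n: "dimension n (center D) (carrier D)" by blast
  have "\<not> independent (center D) (Us (Suc n))"
    using independent_length_le_dimension[OF center_subfield n _ Us(2), of "Suc n"] Us(3)[of "Suc n"] by auto
  then obtain k where k: "\<not> independent (center D) (Us (Suc k))" "\<forall>i<k. independent (center D) (Us (Suc i))"
    using exists_least_iff[of "\<lambda>k. \<not> independent (center D) (Us (Suc k))"] by blast
  have "independent (center D) (Us k)"
    using k(2) by (cases k) (auto simp: Us_def)
  then have "d [^] k \<in> Span (center D) (Us k)"
    using k(1) li_Cons[of "d [^] k" "center D" "Us k"] d Us(1)[of k] by auto
  from Span_powers[OF d this[unfolded Us_def]] obtain c where
    c: "\<And>i. c i \<in> center D" "d [^] k = twisted_eval d c k \<one>" by auto
  define c' where "c' i = (if i = k then \<one> else \<ominus> (c i))" for i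
  have ck: "c' k = \<one>" by (simp add: c'_def)
  have m: "\<ominus> z \<in> center D" if "z \<in> center D" for z
    using that subringE(5)[OF subfieldE(1)[OF center_subfield]] by blast
  have cc: "c i \<in> carrier D" for i using c center_carrier by blast
  have "twisted_eval d c' k \<one> = twisted_eval d (\<lambda>i. \<zero> \<ominus> c i) k \<one>"
    using cc by (intro twisted_eval_cong) (simp add: c'_def a_minus_def)
  also have "\<dots> = twisted_eval d (\<lambda>_. \<zero>) k \<one> \<ominus> d [^] k"
    unfolding c(2) using cc d by (intro twisted_eval_diff) auto
  also have "twisted_eval d (\<lambda>_. \<zero>) k \<one> = \<zero>" using d by (induction k) auto
  finally have "twisted_eval d c' (Suc k) \<one> = \<zero>"
    using d ck by (simp add: a_minus_def l_neg)
  moreover have "\<forall>i. c' i \<in> center D" using c m by (auto simp: c'_def)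
  moreover note ck
  ultimately show ?thesis by blast
qed

end

text \<open>A division subring whose center is that of \<open>D\<close>. The images of the tensor
  factors are of this kind, and so is \<open>D\<close> itself; Wedderburn's argument is applied to
  both.\<close>

locale central_division_subring = division_algebra D for D (structure) +
  fixes B :: "'a set"
  assumes B_subring: "subring B D"
    and B_inv: "\<lbrakk>x \<in> B; x \<noteq> \<zero>\<rbrakk> \<Longrightarrow> inv x \<in> B"
    and center_subset: "center D \<subseteq> B"
    and B_central: "\<lbrakk>c \<in> B; \<And>x. x \<in> B \<Longrightarrow> c \<otimes> x = x \<otimes> c\<rbrakk> \<Longrightarrow> c \<in> center D"
begin

lemma B_carrier: "x \<in> B \<Longrightarrow> x \<in> carrier D"
  using subringE(1)[OF B_subring] by blast

lemma B_zero [simp]: "\<zero> \<in> B" and B_one [simp]: "\<one> \<in> B"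
  and B_add: "x \<in> B \<Longrightarrow> y \<in> B \<Longrightarrow> x \<oplus> y \<in> B"
  and B_mult: "x \<in> B \<Longrightarrow> y \<in> B \<Longrightarrow> x \<otimes> y \<in> B"
  and B_diff: "x \<in> B \<Longrightarrow> y \<in> B \<Longrightarrow> x \<ominus> y \<in> B"
  using subringE[OF B_subring] by (auto simp: a_minus_def)

lemma B_pow: "x \<in> B \<Longrightarrow> x [^] (n::nat) \<in> B"
  by (induction n) (auto simp: B_mult)

lemma B_twisted_eval: "d \<in> B \<Longrightarrow> (\<And>i. c i \<in> B) \<Longrightarrow> x \<in> B \<Longrightarrow> twisted_eval d c n x \<in> B"
  by (induction n) (auto simp: B_add B_mult B_pow)

text \<open>Take a monic annihilator of least degree \<open>N\<close> with coefficients in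
  \<open>B\<close>. Conjugating it by an element of \<open>B\<close> and subtracting cancels the
  leading term, so by minimality nothing remains: all coefficients commute with \<open>B\<close> and
  are therefore central.\<close>

lemma exists_minimal_annihilator:
  assumes d: "d \<in> B" and fd: "finite_dimension (center D) (carrier D)"
  shows "\<exists>N g. (\<forall>i. g i \<in> center D) \<and> g N = \<one> \<and> (\<forall>x\<in>B. twisted_eval d g (Suc N) x = \<zero>) \<and>
    (\<forall>c n. (\<forall>i. c i \<in> B) \<longrightarrow> n \<le> N \<longrightarrow> (\<forall>x\<in>B. twisted_eval d c n x = \<zero>) \<longrightarrow> (\<forall>i<n. c i = \<zero>))"
proof -
  have dc: "d \<in> carrier D" using d B_carrier by blast
  define P where "P N g \<longleftrightarrow> (\<forall>i. g i \<in> B) \<and> g N = \<one> \<and> (\<forall>x\<in>B. twisted_eval d g (Suc N) x = \<zero>)" for N g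
  from exists_central_annihilator[OF dc fd] obtain c k where
    c: "\<And>i. c i \<in> center D" "c k = \<one>" "twisted_eval d c (Suc k) \<one> = \<zero>" by blast
  have "twisted_eval d c (Suc k) x = \<zero>" if "x \<in> B" for x
    using twisted_eval_central[where c = c, OF dc c(1), of x "Suc k"] c(3) B_carrier[OF that]
    by (simp del: twisted_eval.simps)
  then have "P k c" unfolding P_def using c center_subset by blast
  then obtain N where N: "\<exists>g. P N g" "\<And>i. i < N \<Longrightarrow> \<not> (\<exists>g. P i g)"
    using exists_least_iff[of "\<lambda>N. \<exists>g. P N g"] by blast
  then obtain g where "P N g" by blast
  then have g: "\<And>i. g i \<in> B" "g N = \<one>" "\<And>x. x \<in> B \<Longrightarrow> twisted_eval d g (Suc N) x = \<zero>"
    by (auto simp: P_def)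
  have gc: "g i \<in> carrier D" for i using g B_carrier by blast
  \<comment> \<open>Dividing a nonzero annihilator by its leading coefficient, the one with index
    \<open>m\<close>, would give a monic annihilator of degree \<open>m < N\<close>.\<close>
  have uniq: "c i = \<zero>"
    if c: "\<And>i. c i \<in> B" and n: "n \<le> N" and ev: "\<And>x. x \<in> B \<Longrightarrow> twisted_eval d c n x = \<zero>" and i: "i < n" for c n i
  proof (rule ccontr)
    assume "c i \<noteq> \<zero>"
    define m where "m = Max {j. j < n \<and> c j \<noteq> \<zero>}"
    have fin: "finite {j. j < n \<and> c j \<noteq> \<zero>}" by simp
    have "m \<in> {j. j < n \<and> c j \<noteq> \<zero>}"
      unfolding m_def using \<open>c i \<noteq> \<zero>\<close> i by (intro Max_in[OF fin]) blast
    then have m: "m < n" "c m \<noteq> \<zero>" by auto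
    have above: "c j = \<zero>" if "m < j" "j < n" for j
      using Max_ge[OF fin, of j] that unfolding m_def[symmetric] by auto
    have cc: "c j \<in> carrier D" for j using c B_carrier by blast
    have trunc: "twisted_eval d c k x = twisted_eval d c (Suc m) x" if "Suc m \<le> k" "k \<le> n" "x \<in> B" for k x
      using that
    proof (induction k rule: dec_induct)
      case (step k)
      then show ?case using above[of k] dc B_carrier[OF step.prems(2)] cc by simp
    qed simp
    let ?c = "\<lambda>i. inv (c m) \<otimes> c i"
    have "twisted_eval d ?c (Suc m) x = \<zero>" if "x \<in> B" for x
    proof -
      have "twisted_eval d ?c (Suc m) x = inv (c m) \<otimes> twisted_eval d c (Suc m) x"
        using cc dc B_carrier[OF that] m by (intro twisted_eval_smult) auto
      also have "twisted_eval d c (Suc m) x = \<zero>"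
        using trunc[of n x] m ev[OF that] that by simp
      finally show ?thesis using cc m by simp
    qed
    then have "P m ?c" unfolding P_def using c B_mult B_inv m cc by simp
    then show False using N(2)[of m] m n by auto
  qed
  have gZ: "g i \<in> center D" if "i \<le> N" for i
    proof (rule B_central[OF g(1)])
      fix y assume y: "y \<in> B"
      show "g i \<otimes> y = y \<otimes> g i"
      proof (cases "y = \<zero> \<or> i = N")
        case False
        have yc: "y \<in> carrier D" using y B_carrier by blast
        let ?c = "\<lambda>i. inv y \<otimes> g i \<otimes> y \<ominus> g i"
        have cX: "?c i \<in> B" for i using g y False by (intro B_diff B_mult B_inv) auto
        have "twisted_eval d ?c N x = \<zero>" if x: "x \<in> B" for x
        proof -
          have "?c N = \<zero>" using yc False g(2) by simp
          then have "twisted_eval d ?c N x = twisted_eval d ?c (Suc N) x"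
            using cX B_carrier x dc by simp
          also have "\<dots> = twisted_eval d (\<lambda>i. inv y \<otimes> g i \<otimes> y) (Suc N) x \<ominus> twisted_eval d g (Suc N) x"
            using gc dc yc False B_carrier[OF x] by (intro twisted_eval_diff) auto
          also have "twisted_eval d (\<lambda>i. inv y \<otimes> g i \<otimes> y) (Suc N) x = inv y \<otimes> twisted_eval d g (Suc N) (y \<otimes> x)"
            using gc dc yc False B_carrier[OF x] by (intro twisted_eval_conj) auto
          finally show ?thesis using g(3)[OF x] g(3)[OF B_mult[OF y x]] yc False
            by (simp del: twisted_eval.simps)
        qed
        from uniq[OF cX order_refl this, of i] False that have "inv y \<otimes> g i \<otimes> y \<ominus> g i = \<zero>" by simp
        then have "inv y \<otimes> g i \<otimes> y = g i"
          using yc gc False by simp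
        then have "y \<otimes> (inv y \<otimes> (g i \<otimes> y)) = y \<otimes> g i"
          using yc gc[of i] False by (simp add: m_assoc)
        then show ?thesis using yc gc[of i] False by simp
      qed (use B_carrier[OF y] gc[of i] g(2) in auto)
    qed
  \<comment> \<open>Nothing is known about the coefficients beyond \<open>N\<close>, which the
    evaluation ignores. Setting them to \<open>\<zero>\<close> makes every coefficient
    central.\<close>
  define g' where "g' i = (if i \<le> N then g i else \<zero>)" for i
  have "twisted_eval d g' (Suc N) x = twisted_eval d g (Suc N) x" for x
    by (rule twisted_eval_cong) (simp add: g'_def)
  moreover have "g' i \<in> center D" for i using gZ by (simp add: g'_def)
  moreover have "g' N = \<one>" using g(2) by (simp add: g'_def)
  moreover have "\<forall>c n. (\<forall>i. c i \<in> B) \<longrightarrow> n \<le> N \<longrightarrow> (\<forall>x\<in>B. twisted_eval d c n x = \<zero>)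
      \<longrightarrow> (\<forall>i<n. c i = \<zero>)"
    using uniq by blast
  ultimately show ?thesis using g(3)
    by (intro exI[of _ N] exI[of _ g']) (simp del: twisted_eval.simps)
qed

end

text \<open>
  Wedderburn's factorization of the minimal polynomial of \<open>d\<close> into linear factors \<open>X - e\<close> with \<open>e\<close>
  conjugate to \<open>d\<close>, built from the right. If conjugation acts trivially on the residue \<open>a\<close> of \<open>d\<close>,
  its reduction is a power of \<open>X - a\<close> with coefficients in the residue field of the center.
\<close>

locale valued_central_division_subring =
  valued_division_algebra D w + central_division_subring D B
  for D (structure) and w :: "'a \<Rightarrow> 'g::linordered_ab_group_add" and B
begin

lemma residue_linear_power:
  assumes L: "field L" and d: "d \<in> B" "d \<in> V"
    and fd: "finite_dimension (center D) (carrier D)"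
    and conj: "\<And>x. \<lbrakk>x \<in> B; x \<noteq> \<zero>\<rbrakk> \<Longrightarrow> res (x \<otimes> d \<otimes> inv x) = res d"
  obtains N :: nat where "N > 0"
    "\<And>i. ring.coeff L ([\<one>\<^bsub>L\<^esub>, \<ominus>\<^bsub>L\<^esub> res d] [^]\<^bsub>poly_ring L\<^esub> N) i \<in> K"
proof -
  interpret L: field L by (rule L)
  define cf where "cf j i = L.coeff ([\<one>\<^bsub>L\<^esub>, \<ominus>\<^bsub>L\<^esub> res d] [^]\<^bsub>poly_ring L\<^esub> (j::nat)) i" for j i
  have a: "res d \<in> carrier L" using d res_closed by blast
  note cf0 = L.linear_pow_coeff(1)[OF a, folded cf_def]
  note cfS = L.linear_pow_coeff(2)[OF a, folded cf_def]
  have dc: "d \<in> carrier D" using d B_carrier by blast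
  from exists_minimal_annihilator[OF d(1) fd] obtain N g where
    g: "\<forall>i. g i \<in> center D" "g N = \<one>" "\<forall>x\<in>B. twisted_eval d g (Suc N) x = \<zero>"
    and min: "\<forall>c n. (\<forall>i. c i \<in> B) \<longrightarrow> n \<le> N \<longrightarrow> (\<forall>x\<in>B. twisted_eval d c n x = \<zero>)
      \<longrightarrow> (\<forall>i<n. c i = \<zero>)"
    by blast
  \<comment> \<open>The invariant of the construction: \<open>q\<close> is monic of degree
    \<open>j\<close>, reduces to \<open>(X - a)^j\<close> for the residue \<open>a\<close> of
    \<open>d\<close>, and vanishes on \<open>S\<close>, while no nonzero polynomial of degree below
    \<open>j\<close> with coefficients in \<open>B\<close> vanishes on \<open>S\<close>.\<close>
  have step: "\<exists>q S. (\<forall>i. q i \<in> B \<and> q i \<in> V \<and> res (q i) = cf j i) \<and> q j = \<one> \<and> (\<forall>i>j. q i = \<zero>) \<and> S \<subseteq> B \<and>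
      (\<forall>s\<in>S. twisted_eval d q (Suc j) s = \<zero>) \<and>
      (\<forall>c. (\<forall>i. c i \<in> B) \<and> (\<forall>s\<in>S. twisted_eval d c j s = \<zero>) \<longrightarrow> (\<forall>i<j. c i = \<zero>))" if "j \<le> N" for j
    using that
  proof (induction j)
    case 0
    show ?case
      by (rule exI[of _ "\<lambda>i. if i = 0 then \<one> else \<zero>"], rule exI[of _ "{}"])
        (simp add: cf0 res_one res_zero)
  next
    case (Suc j)
    from Suc.IH[OF Suc_leD[OF Suc.prems]] obtain q S where q0: "\<forall>i. q i \<in> B \<and> q i \<in> V \<and> res (q i) = cf j i" "q j = \<one>"
        "\<forall>i>j. q i = \<zero>"
      and S0: "S \<subseteq> B" "\<forall>s\<in>S. twisted_eval d q (Suc j) s = \<zero>"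
        "\<forall>c. (\<forall>i. c i \<in> B) \<and> (\<forall>s\<in>S. twisted_eval d c j s = \<zero>) \<longrightarrow> (\<forall>i<j. c i = \<zero>)"
      by blast
    have q: "\<And>i. q i \<in> B" "\<And>i. q i \<in> V" "\<And>i. res (q i) = cf j i" "q j = \<one>"
        "\<And>i. i > j \<Longrightarrow> q i = \<zero>"
      using q0 by blast+
    have S: "S \<subseteq> B" "\<And>s. s \<in> S \<Longrightarrow> twisted_eval d q (Suc j) s = \<zero>"
        "\<And>c. (\<And>i. c i \<in> B) \<Longrightarrow> (\<And>s. s \<in> S \<Longrightarrow> twisted_eval d c j s = \<zero>) \<Longrightarrow> (\<forall>i<j. c i = \<zero>)"
      using S0 by blast+
    have qc: "q i \<in> carrier D" for i using q B_carrier by blast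
    have Sc: "s \<in> carrier D" if "s \<in> S" for s using that S(1) B_carrier by blast
    \<comment> \<open>The degree \<open>j\<close> of \<open>q\<close> is still below that of the
      minimal annihilator, so \<open>q\<close> does not vanish on all of \<open>B\<close>.\<close>
    obtain y where y: "y \<in> B" "twisted_eval d q (Suc j) y \<noteq> \<zero>"
      using min[rule_format, where c = q and n = "Suc j" and i = j] q(1,4) Suc.prems
      by (metis Suc_leD le_refl lessI one_neq_zero)
    define b where "b = twisted_eval d q (Suc j) y"
    have b: "b \<in> B" "b \<noteq> \<zero>" using y q d B_twisted_eval unfolding b_def by blast+
    have bc: "b \<in> carrier D" and yc: "y \<in> carrier D" using b y B_carrier by blast+
    \<comment> \<open>The next root of Wedderburn's factorization: the value of
      \<open>(X - e) q\<close> at \<open>y\<close> is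
      \<open>b \<otimes> d \<ominus> e \<otimes> b\<close>, which vanishes. By the hypothesis on
      conjugation \<open>e\<close> still has the residue of \<open>d\<close>.\<close>
    define e where "e = b \<otimes> d \<otimes> inv b"
    have e: "e \<in> B" "e \<in> V" "res e = res d"
      unfolding e_def using b d B_inv B_mult conj_V[OF bc b(2) d(2)] conj[OF b] by auto
    have ec: "e \<in> carrier D" using e B_carrier by blast
    have eb: "e \<otimes> b = b \<otimes> d" unfolding e_def using bc b dc by (simp add: m_assoc)
    define sh where "sh i = (if i = 0 then \<zero> else q (i - 1))" for i
    define q' where "q' i = sh i \<ominus> e \<otimes> q i" for i
    have sh: "sh i \<in> B" "sh i \<in> V" "res (sh i) = (if i = 0 then \<zero>\<^bsub>L\<^esub> else cf j (i - 1))" for i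
      using q by (auto simp: sh_def res_zero)
    have shc: "sh i \<in> carrier D" for i using sh B_carrier by blast
    have q': "q' i \<in> B" "q' i \<in> V" "res (q' i) = cf (Suc j) i" for i
    proof -
      show "q' i \<in> B" unfolding q'_def by (intro B_diff B_mult sh q e)
      show "q' i \<in> V" unfolding q'_def by (intro V_diff V_mult sh q e)
      have "res (q' i) = res (sh i) \<ominus>\<^bsub>L\<^esub> res e \<otimes>\<^bsub>L\<^esub> res (q i)"
        unfolding q'_def using res_diff[OF sh(2) V_mult[OF e(2) q(2)]] res_mult[OF e(2) q(2)] by simp
      then show "res (q' i) = cf (Suc j) i" by (simp only: sh(3) e(3) q(3) cfS)
    qed
    have q's: "q' (Suc j) = \<one>" "\<And>i. i > Suc j \<Longrightarrow> q' i = \<zero>"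
      using q(4,5) ec by (auto simp: q'_def sh_def a_minus_def)
    have ev: "twisted_eval d q' (Suc (Suc j)) s
        = twisted_eval d q (Suc j) s \<otimes> d \<ominus> e \<otimes> twisted_eval d q (Suc j) s" if s: "s \<in> carrier D" for s
    proof -
      have "twisted_eval d q' (Suc (Suc j)) s
          = twisted_eval d sh (Suc (Suc j)) s \<ominus> twisted_eval d (\<lambda>i. e \<otimes> q i) (Suc (Suc j)) s"
        unfolding q'_def using shc qc ec dc s by (intro twisted_eval_diff) auto
      also have "twisted_eval d sh (Suc (Suc j)) s = twisted_eval d q (Suc j) s \<otimes> d"
        unfolding sh_def using qc dc s by (intro twisted_eval_shift) auto
      also have "twisted_eval d (\<lambda>i. e \<otimes> q i) (Suc (Suc j)) s = e \<otimes> twisted_eval d q (Suc (Suc j)) s"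
        using qc dc ec s by (intro twisted_eval_smult) auto
      also have "twisted_eval d q (Suc (Suc j)) s = twisted_eval d q (Suc j) s"
        using q(5)[of "Suc j"] qc dc s by simp
      finally show ?thesis .
    qed
    have kill: "twisted_eval d q' (Suc (Suc j)) s = \<zero>" if "s \<in> insert y S" for s
    proof (cases "s = y")
      case True
      then show ?thesis using ev[OF yc] eb bc dc by (simp del: twisted_eval.simps add: b_def[symmetric])
    next
      case False
      then show ?thesis using that ev[OF Sc] S(2) dc ec by (simp del: twisted_eval.simps)
    qed
    have uniq: "c i = \<zero>"
      if c: "\<And>i. c i \<in> B" and z: "\<And>s. s \<in> insert y S \<Longrightarrow> twisted_eval d c (Suc j) s = \<zero>" and i: "i < Suc j" for c i
    proof -
      have cc: "c i \<in> carrier D" for i using c B_carrier by blast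
      \<comment> \<open>Subtracting \<open>c j\<close> times \<open>q\<close> lowers the degree, so
        the invariant for \<open>S\<close> makes the difference vanish. Evaluating at the new point
        \<open>y\<close> then gives \<open>c j \<otimes> b = \<zero>\<close>.\<close>
      let ?c = "\<lambda>i. c i \<ominus> c j \<otimes> q i"
      have evc: "twisted_eval d ?c (Suc j) s = twisted_eval d c (Suc j) s \<ominus> c j \<otimes> twisted_eval d q (Suc j) s"
        if "s \<in> carrier D" for s
        using that cc qc dc twisted_eval_smult[of d q "c j" s "Suc j"]
        by (subst twisted_eval_diff) (auto simp del: twisted_eval.simps)
      have cX: "?c i \<in> B" for i using c q by (intro B_diff B_mult) auto
      have cj: "?c j = \<zero>" using q(4) cc by simp
      have "twisted_eval d ?c j s = \<zero>" if s: "s \<in> S" for s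
      proof -
        have "twisted_eval d ?c j s = twisted_eval d ?c (Suc j) s"
          using cj Sc[OF s] dc B_carrier[OF cX] by simp
        also have "\<dots> = \<zero>" using evc[OF Sc[OF s]] z[of s] S(2)[OF s] s cc by (simp del: twisted_eval.simps)
        finally show ?thesis .
      qed
      from S(3)[OF cX this] have z0: "?c i = \<zero>" if "i < Suc j" for i
        using that cj less_Suc_eq by auto
      have "twisted_eval d ?c (Suc j) y = twisted_eval d (\<lambda>_. \<zero>) (Suc j) y"
        by (rule twisted_eval_cong) (rule z0)
      also have "\<dots> = \<zero>" using dc yc by (induction j) auto
      finally have "c j \<otimes> b = \<zero>"
        using evc[OF yc] z[of y] cc bc by (simp del: twisted_eval.simps add: b_def[symmetric])
      then have "c j = \<zero>" using mult_eq_zero_iff[OF cc[of j] bc] b(2) by blast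
      then show ?thesis using z0[OF i] cc qc by (simp add: a_minus_def)
    qed
    have "\<forall>c. (\<forall>i. c i \<in> B) \<and> (\<forall>s\<in>insert y S. twisted_eval d c (Suc j) s = \<zero>) \<longrightarrow> (\<forall>i<Suc j. c i = \<zero>)"
      using uniq by blast
    moreover have "\<forall>i. q' i \<in> B \<and> q' i \<in> V \<and> res (q' i) = cf (Suc j) i" using q' by blast
    moreover have "\<forall>i>Suc j. q' i = \<zero>" using q's(2) by blast
    moreover have "\<forall>s\<in>insert y S. twisted_eval d q' (Suc (Suc j)) s = \<zero>" using kill by blast
    moreover have "insert y S \<subseteq> B" using S(1) y(1) by blast
    ultimately show ?case using q's(1) by blast
  qed
  from step[OF order_refl] obtain q S where q0: "\<forall>i. q i \<in> B \<and> q i \<in> V \<and> res (q i) = cf N i" "q N = \<one>"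
      "\<forall>i>N. q i = \<zero>"
    and S0: "S \<subseteq> B" "\<forall>s\<in>S. twisted_eval d q (Suc N) s = \<zero>"
      "\<forall>c. (\<forall>i. c i \<in> B) \<and> (\<forall>s\<in>S. twisted_eval d c N s = \<zero>) \<longrightarrow> (\<forall>i<N. c i = \<zero>)"
    by blast
  have q: "\<And>i. q i \<in> B" "\<And>i. q i \<in> V" "\<And>i. res (q i) = cf N i" "q N = \<one>"
      "\<And>i. i > N \<Longrightarrow> q i = \<zero>"
    using q0 by blast+
  have S: "S \<subseteq> B" "\<And>s. s \<in> S \<Longrightarrow> twisted_eval d q (Suc N) s = \<zero>"
      "\<And>c. (\<And>i. c i \<in> B) \<Longrightarrow> (\<And>s. s \<in> S \<Longrightarrow> twisted_eval d c N s = \<zero>) \<Longrightarrow> (\<forall>i<N. c i = \<zero>)"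
    using S0 by blast+
  have qc: "q i \<in> carrier D" and gc: "g i \<in> carrier D" and gX: "g i \<in> B" for i
    using q g B_carrier center_subset by blast+
  \<comment> \<open>Both polynomials are monic of degree \<open>N\<close>, so the difference has
    lower degree and vanishes on \<open>S\<close>. The invariant thus identifies the product of
    linear factors with the central polynomial \<open>g\<close>.\<close>
  let ?c = "\<lambda>i. q i \<ominus> g i"
  have cX: "?c i \<in> B" for i using q(1) gX by (intro B_diff)
  have "twisted_eval d ?c N s = \<zero>" if s: "s \<in> S" for s
  proof -
    have sc: "s \<in> carrier D" and sX: "s \<in> B" using s S(1) B_carrier by blast+
    have "?c N = \<zero>" using q(4) g(2) by simp
    then have "twisted_eval d ?c N s = twisted_eval d ?c (Suc N) s"
      using sc dc B_carrier[OF cX] by simp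
    also have "\<dots> = twisted_eval d q (Suc N) s \<ominus> twisted_eval d g (Suc N) s"
      using qc gc dc sc by (intro twisted_eval_diff)
    finally show ?thesis using S(2)[OF s] bspec[OF g(3) sX] by (simp del: twisted_eval.simps)
  qed
  from S(3)[OF cX this] have eq: "q i = g i" if "i < N" for i
    using that qc gc by simp
  have "cf N i \<in> K" for i
  proof -
    have "q i \<in> center D" using eq[of i] g q(4,5) by (metis center_zero_one(1) nat_neq_iff)
    then show ?thesis using q(2,3) unfolding residue_center_def by (metis IntI image_eqI)
  qed
  \<comment> \<open>For \<open>N = 0\<close> the annihilator would be the constant
    \<open>\<one>\<close>, which does not annihilate \<open>\<one>\<close>.\<close>
  moreover have "N > 0"
    using g(2) bspec[OF g(3) B_one] by (cases N) auto
  ultimately show ?thesis using that[of N] unfolding cf_def by blast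
qed

end

section \<open>Orthogonal bases\<close>

context valued_division_algebra
begin

abbreviation Z where "Z \<equiv> center D"

section \<open>The residue field of the center\<close>

lemma K_subfield:
  assumes "field L" shows "subfield K L"
proof -
  interpret L: field L by (rule assms)
  have Z: "subring Z D" using center_subfield subfieldE(1) by blast
  show ?thesis
  proof (rule L.subfieldI')
    show "subring K L"
    proof (rule L.subringI)
      show "K \<subseteq> carrier L" using res_closed by (auto simp: residue_center_def)
      show "\<one>\<^bsub>L\<^esub> \<in> K" unfolding residue_center_def using res_one
        by (metis IntI V_zero_one(2) center_zero_one(2) image_eqI)
      show "\<ominus>\<^bsub>L\<^esub> h \<in> K" if h: "h \<in> K" for h
      proof -
        obtain z where z: "z \<in> Z" "z \<in> V" "h = res z" using h by (auto simp: residue_center_def)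
        then have "\<ominus>\<^bsub>L\<^esub> h = res (\<ominus> z)" by (simp add: res_minus)
        then show ?thesis using z V_minus subringE(5)[OF Z] by (auto simp: residue_center_def)
      qed
      show "h1 \<otimes>\<^bsub>L\<^esub> h2 \<in> K" "h1 \<oplus>\<^bsub>L\<^esub> h2 \<in> K" if h: "h1 \<in> K" "h2 \<in> K" for h1 h2
      proof -
        obtain z1 z2 where z: "z1 \<in> Z" "z1 \<in> V" "h1 = res z1" "z2 \<in> Z" "z2 \<in> V" "h2 = res z2"
          using h by (auto simp: residue_center_def)
        then have "h1 \<otimes>\<^bsub>L\<^esub> h2 = res (z1 \<otimes> z2)" "h1 \<oplus>\<^bsub>L\<^esub> h2 = res (z1 \<oplus> z2)"
          by (simp_all add: res_mult res_add)
        then show "h1 \<otimes>\<^bsub>L\<^esub> h2 \<in> K" "h1 \<oplus>\<^bsub>L\<^esub> h2 \<in> K"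
          using z V_mult V_add subringE(6,7)[OF Z] by (auto simp: residue_center_def)
      qed
    qed
    show "inv\<^bsub>L\<^esub> k \<in> K" if k: "k \<in> K - {\<zero>\<^bsub>L\<^esub>}" for k
    proof -
      obtain z where z: "z \<in> Z" "z \<in> V" "k = res z" using k by (auto simp: residue_center_def)
      have z0: "z \<noteq> \<zero>" "w z = 0" using k z res_nonzero_iff by auto
      have zc: "z \<in> carrier D" using z V_carrier by blast
      have iz: "inv z \<in> V" using z0 zc by (intro unit_V) auto
      have "res z \<otimes>\<^bsub>L\<^esub> res (inv z) = \<one>\<^bsub>L\<^esub>"
        using res_mult[OF z(2) iz] zc z0 res_one by simp
      then have "inv\<^bsub>L\<^esub> k = res (inv z)"
        using z iz res_closed by (intro L.comm_inv_char) auto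
      then show ?thesis using iz center_inv_mem[OF z(1) z0(1)] by (auto simp: residue_center_def)
    qed
  qed
qed

text \<open>Writing \<open>x\<close> as \<open>(x \<oplus> y) \<oplus> (\<ominus> y)\<close> bounds
  the value of the sum from above; the other bound is the ultrametric inequality.\<close>

lemma val_add_less:
  assumes "x \<in> carrier D" "x \<noteq> \<zero>" "y \<in> carrier D" "y \<noteq> \<zero>" "w x < w y"
  shows "x \<oplus> y \<noteq> \<zero>" "w (x \<oplus> y) = w x"
proof -
  show n: "x \<oplus> y \<noteq> \<zero>"
  proof
    assume "x \<oplus> y = \<zero>"
    then have "x = \<ominus> y" using assms by (metis minus_equality)
    then show False using val_minus[of y] assms by simp
  qed
  have "w x \<le> w (x \<oplus> y)" using val_add[of x y] assms n by simp
  moreover have "x = (x \<oplus> y) \<oplus> \<ominus> y" using assms by (simp add: a_assoc r_neg)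
  then have "min (w (x \<oplus> y)) (w y) \<le> w x"
    using val_add[of "x \<oplus> y" "\<ominus> y"] n assms
    by (metis a_closed a_inv_closed add.inv_eq_1_iff val_minus)
  ultimately show "w (x \<oplus> y) = w x" using assms(5) by (auto simp: min_def split: if_splits)
qed

section \<open>Classes of values modulo the values of the center, expressed through elements\<close>

definition val_equiv :: "'a \<Rightarrow> 'a \<Rightarrow> bool" (infix \<open>\<asymp>\<close> 50) where
  "x \<asymp> y \<longleftrightarrow> (\<exists>z \<in> Z - {\<zero>}. w x = w z + w y)"

lemma Z_mult: "x \<in> Z \<Longrightarrow> y \<in> Z \<Longrightarrow> x \<otimes> y \<in> Z"
  and Z_minus: "x \<in> Z \<Longrightarrow> \<ominus> x \<in> Z"
  using subringE(5,6)[OF subfieldE(1)[OF center_subfield]] by auto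

lemma val_equiv_refl [simp]: "x \<asymp> x"
  unfolding val_equiv_def by (rule bexI[of _ \<one>]) auto

lemma val_equivI: "z \<in> Z \<Longrightarrow> z \<noteq> \<zero> \<Longrightarrow> w x = w z + w y \<Longrightarrow> x \<asymp> y"
  unfolding val_equiv_def by blast

lemma val_equiv_sym:
  assumes "x \<asymp> y" shows "y \<asymp> x"
proof -
  obtain z where z: "z \<in> Z" "z \<noteq> \<zero>" "w x = w z + w y" using assms by (auto simp: val_equiv_def)
  have "w y = w (inv z) + w x" using z center_carrier by simp
  then show ?thesis using z center_carrier center_inv_mem by (intro val_equivI[of "inv z"]) auto
qed

lemma val_equiv_trans:
  assumes "x \<asymp> y" "y \<asymp> u" shows "x \<asymp> u"
proof -
  obtain z z' where z: "z \<in> Z" "z \<noteq> \<zero>" "w x = w z + w y" "z' \<in> Z" "z' \<noteq> \<zero>" "w y = w z' + w u"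
    using assms unfolding val_equiv_def by blast
  have "w x = w (z \<otimes> z') + w u" using z center_carrier by (simp add: add.assoc)
  then show ?thesis using z center_carrier Z_mult by (intro val_equivI[of "z \<otimes> z'"]) auto
qed

lemma val_equiv_mult:
  assumes "x \<asymp> y" "x' \<asymp> y'"
    and c: "x \<in> nonzero" "y \<in> nonzero" "x' \<in> nonzero" "y' \<in> nonzero"
  shows "x \<otimes> x' \<asymp> y \<otimes> y'"
proof -
  obtain z z' where z: "z \<in> Z" "z \<noteq> \<zero>" "w x = w z + w y" "z' \<in> Z" "z' \<noteq> \<zero>" "w x' = w z' + w y'"
    using assms unfolding val_equiv_def by blast
  have "w (x \<otimes> x') = w (z \<otimes> z') + w (y \<otimes> y')" using z c center_carrier by (simp add: add_ac)
  then show ?thesis using z center_carrier Z_mult by (intro val_equivI[of "z \<otimes> z'"]) auto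
qed

lemma val_equiv_pow:
  assumes "x \<asymp> y" "x \<in> nonzero" "y \<in> nonzero"
  shows "x [^] (n::nat) \<asymp> y [^] n"
  using assms by (induction n) (auto intro!: val_equiv_mult)

text \<open>Equal classes differ by a central factor and a unit of the valuation ring. Neither
  changes the automorphism induced on the residue field.\<close>

lemma val_equiv_unit_factor:
  assumes "x \<asymp> y" "x \<in> nonzero" "y \<in> nonzero"
  obtains z u where "z \<in> Z" "z \<noteq> \<zero>" "u \<in> nonzero" "w u = 0" "x = z \<otimes> u \<otimes> y"
proof -
  obtain z where z: "z \<in> Z" "z \<noteq> \<zero>" "w x = w z + w y" using assms by (auto simp: val_equiv_def)
  have zc: "z \<in> carrier D" using z center_carrier by blast
  define u where "u = inv z \<otimes> x \<otimes> inv y"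
  have "u \<in> nonzero" "w u = 0" using zc z assms by (auto simp: u_def)
  moreover have "x = z \<otimes> u \<otimes> y" using zc z assms by (simp add: u_def m_assoc)
  ultimately show ?thesis using that z by blast
qed

text \<open>Central factors conjugate trivially in \<open>D\<close>, and units conjugate trivially
  on the residue ring because that ring is commutative. So the induced map depends on the value
  class only.\<close>

lemma res_conj_cong:
  assumes L: "field L" and "x \<asymp> y" "x \<in> nonzero" "y \<in> nonzero" "d \<in> V"
  shows "res (x \<otimes> d \<otimes> inv x) = res (y \<otimes> d \<otimes> inv y)"
proof -
  interpret L: field L by (rule L)
  obtain z u where zu: "z \<in> Z" "z \<noteq> \<zero>" "u \<in> nonzero" "w u = 0" "x = z \<otimes> u \<otimes> y"
    using val_equiv_unit_factor assms by blast
  have c: "z \<in> carrier D" "u \<in> carrier D" "u \<noteq> \<zero>" "y \<in> carrier D" "y \<noteq> \<zero>" "d \<in> carrier D"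
    using zu assms center_carrier V_carrier by auto
  define e where "e = y \<otimes> d \<otimes> inv y"
  have e: "e \<in> V" "e \<in> carrier D" unfolding e_def using conj_V c assms(5) V_carrier by auto
  have uV: "u \<in> V" "inv u \<in> V" using c zu by (auto intro: unit_V)
  have "x \<otimes> d \<otimes> inv x = z \<otimes> (u \<otimes> e \<otimes> inv u) \<otimes> inv z"
    unfolding zu(5) e_def using c zu(2) by (simp add: inv_mult m_assoc)
  also have "\<dots> = u \<otimes> e \<otimes> inv u"
    using center_comm[OF zu(1), of "u \<otimes> e \<otimes> inv u"] c e zu(2) by simp
  finally have "res (x \<otimes> d \<otimes> inv x) = res u \<otimes>\<^bsub>L\<^esub> res e \<otimes>\<^bsub>L\<^esub> res (inv u)"
    using uV e by (simp add: res_mult V_mult)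
  also have "\<dots> = res e \<otimes>\<^bsub>L\<^esub> (res u \<otimes>\<^bsub>L\<^esub> res (inv u))"
    using uV e res_closed by (simp add: L.m_ac)
  also have "res u \<otimes>\<^bsub>L\<^esub> res (inv u) = \<one>\<^bsub>L\<^esub>"
    using res_mult[OF uV] c res_one by simp
  finally show ?thesis using e res_closed by (simp add: e_def)
qed

section \<open>Orthogonality of lifted residue bases multiplied by class representatives\<close>

lemma V_combine:
  "set Ks \<subseteq> V \<Longrightarrow> set us \<subseteq> V \<Longrightarrow> combine Ks us \<in> V"
  by (induction Ks us rule: list_induct2') (auto simp: V_add V_mult)

lemma res_combine:
  "set Ks \<subseteq> V \<Longrightarrow> set us \<subseteq> V \<Longrightarrow> res (combine Ks us) = ring.combine L (map res Ks) (map res us)"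
  using ring.combine.simps[OF L_ring]
  by (induction Ks us rule: list_induct2') (auto simp: res_add res_mult V_combine V_mult res_zero)

text \<open>Divide by a coefficient \<open>z\<close> of least value. The new coefficients are
  integral and one of them is \<open>\<one>\<close>, so the residue is a nontrivial combination of
  independent elements, hence nonzero, and the divided sum has value \<open>0\<close>.\<close>

lemma combine_value:
  assumes L: "field L" and Ks: "set Ks \<subseteq> Z" "length Ks = length us" "\<not> set Ks \<subseteq> {\<zero>}"
    and us: "set us \<subseteq> V" "ring.independent L K (map res us)"
  shows "combine Ks us \<noteq> \<zero> \<and> (\<exists>z \<in> Z - {\<zero>}. w (combine Ks us) = w z \<and> (\<forall>k \<in> set Ks. k \<noteq> \<zero> \<longrightarrow> w z \<le> w k))"
proof -
  interpret L: field L by (rule L)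
  have usc: "set us \<subseteq> carrier D" using us V_carrier by blast
  have Kc: "set Ks \<subseteq> carrier D" using Ks center_carrier by blast
  have "finite (w ` (set Ks - {\<zero>}))" "w ` (set Ks - {\<zero>}) \<noteq> {}" using Ks by auto
  then have "Min (w ` (set Ks - {\<zero>})) \<in> w ` (set Ks - {\<zero>})" by (rule Min_in)
  then obtain z where z: "z \<in> set Ks" "z \<noteq> \<zero>" "Min (w ` (set Ks - {\<zero>})) = w z" by auto
  have min: "w z \<le> w k" if "k \<in> set Ks" "k \<noteq> \<zero>" for k
    using that z(3) Min_le[of "w ` (set Ks - {\<zero>})" "w k"] by auto
  have zZ: "z \<in> Z" and zc: "z \<in> carrier D" using z Ks Kc by auto
  define Ks' where "Ks' = map ((\<otimes>) (inv z)) Ks"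
  have K': "set Ks' \<subseteq> Z \<inter> V"
  proof
    fix k' assume "k' \<in> set Ks'"
    then obtain k where k: "k \<in> set Ks" "k' = inv z \<otimes> k" by (auto simp: Ks'_def)
    have kc: "k \<in> carrier D" using k Kc by blast
    have "k' \<in> Z" using k Ks center_inv_mem[OF zZ z(2)] Z_mult by blast
    moreover have "k' \<in> V"
      unfolding k(2) valuation_ring_def using kc zc z(2) min[OF k(1)] by (cases "k = \<zero>") auto
    ultimately show "k' \<in> Z \<inter> V" by blast
  qed
  have "z \<otimes> combine Ks' us = combine (map ((\<otimes>) z) Ks') us"
    using K' usc zc V_carrier by (intro combine_r_distr) auto
  also have "map ((\<otimes>) z) Ks' = Ks"
    unfolding Ks'_def using zc z Kc by (auto intro!: map_idI simp: o_def)
  finally have eq: "combine Ks us = z \<otimes> combine Ks' us" by simp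
  have cV: "combine Ks' us \<in> V" using K' us(1) by (intro V_combine) auto
  have "res (combine Ks' us) \<noteq> \<zero>\<^bsub>L\<^esub>"
  proof
    assume "res (combine Ks' us) = \<zero>\<^bsub>L\<^esub>"
    then have "L.combine (map res Ks') (map res us) = \<zero>\<^bsub>L\<^esub>"
      using res_combine[of Ks' us] K' us(1) by auto
    moreover have "set (map res Ks') \<subseteq> K" using K' by (auto simp: residue_center_def)
    ultimately have "set (take (length (map res us)) (map res Ks')) \<subseteq> {\<zero>\<^bsub>L\<^esub>}"
      using L.independent_imp_trivial_combine[OF K_subfield[OF L] us(2)] by blast
    then have "set (map res Ks') \<subseteq> {\<zero>\<^bsub>L\<^esub>}" using Ks(2) by (simp add: Ks'_def)
    moreover have "\<one> \<in> set Ks'" unfolding Ks'_def using z zc by force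
    ultimately have "res \<one> = \<zero>\<^bsub>L\<^esub>" by auto
    then show False using res_one by simp
  qed
  then have nz: "combine Ks' us \<noteq> \<zero>" "w (combine Ks' us) = 0"
    using res_nonzero_iff[OF cV] by auto
  show ?thesis unfolding eq using nz zc z zZ V_carrier[OF cV] min by auto
qed

text \<open>Coordinates are grouped by value class: \<open>ts\<close> lists representatives, and
  \<open>f t\<close> is the whole combination of lifted residues that multiplies
  \<open>t\<close>.\<close>

primrec block_sum :: "('a \<Rightarrow> 'a) \<Rightarrow> 'a list \<Rightarrow> 'a" where
  "block_sum f [] = \<zero>"
| "block_sum f (t # ts) = f t \<otimes> t \<oplus> block_sum f ts"

lemma block_sum_closed:
  "(\<And>t. t \<in> set ts \<Longrightarrow> f t \<in> carrier D) \<Longrightarrow> set ts \<subseteq> carrier D \<Longrightarrow> block_sum f ts \<in> carrier D"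
  by (induction ts) auto

lemma block_sum_diff:
  "(\<And>t. t \<in> set ts \<Longrightarrow> f t \<in> carrier D) \<Longrightarrow> (\<And>t. t \<in> set ts \<Longrightarrow> g t \<in> carrier D) \<Longrightarrow> set ts \<subseteq> carrier D
    \<Longrightarrow> block_sum (\<lambda>t. f t \<ominus> g t) ts = block_sum f ts \<ominus> block_sum g ts"
  by (induction ts) (auto simp: a_minus_def l_distr l_minus minus_add block_sum_closed a_ac)

lemma block_sum_cong: "(\<And>t. t \<in> set ts \<Longrightarrow> f t = g t) \<Longrightarrow> block_sum f ts = block_sum g ts"
  by (induction ts) auto

lemma block_sum_single:
  "distinct ts \<Longrightarrow> t0 \<in> set ts \<Longrightarrow> set ts \<subseteq> carrier D \<Longrightarrow> z \<in> carrier D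
    \<Longrightarrow> block_sum (\<lambda>t. if t = t0 then z else \<zero>) ts = z \<otimes> t0"
proof (induction ts)
  case (Cons t ts)
  show ?case
  proof (cases "t = t0")
    case True
    have "block_sum (\<lambda>_. \<zero>) us = \<zero>" if "set us \<subseteq> carrier D" for us
      using that by (induction us) auto
    moreover have "block_sum (\<lambda>t. if t = t0 then z else \<zero>) ts = block_sum (\<lambda>_. \<zero>) ts"
      using Cons.prems True by (intro block_sum_cong) auto
    ultimately show ?thesis using True Cons.prems by auto
  next
    case False
    then show ?thesis using Cons by auto
  qed
qed simp

text \<open>The classes of the values of the terms are distinct, so no cancellation can occur.\<close>

lemma block_sum_value:
  assumes "distinct ts" "set ts \<subseteq> nonzero"
    and "\<forall>s\<in>set ts. \<forall>t\<in>set ts. s \<asymp> t \<longrightarrow> s = t"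
    and "\<forall>t\<in>set ts. f t \<in> carrier D \<and> (f t \<noteq> \<zero> \<longrightarrow> (\<exists>z \<in> Z - {\<zero>}. w (f t) = w z))"
  shows "(\<forall>t \<in> set ts. f t = \<zero>) \<and> block_sum f ts = \<zero> \<or>
    block_sum f ts \<noteq> \<zero> \<and> (\<exists>t \<in> set ts. f t \<noteq> \<zero> \<and> w (block_sum f ts) = w (f t \<otimes> t)) \<and>
    (\<forall>t \<in> set ts. f t \<noteq> \<zero> \<longrightarrow> w (block_sum f ts) \<le> w (f t \<otimes> t))"
  using assms
proof (induction ts)
  case (Cons t ts)
  let ?a = "f t \<otimes> t" and ?s = "block_sum f ts"
  have IH: "(\<forall>t \<in> set ts. f t = \<zero>) \<and> ?s = \<zero> \<or>
    ?s \<noteq> \<zero> \<and> (\<exists>t \<in> set ts. f t \<noteq> \<zero> \<and> w ?s = w (f t \<otimes> t)) \<and>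
    (\<forall>t \<in> set ts. f t \<noteq> \<zero> \<longrightarrow> w ?s \<le> w (f t \<otimes> t))"
    using Cons.prems by (intro Cons.IH) auto
  have c: "t \<in> carrier D" "t \<noteq> \<zero>" "f t \<in> carrier D" using Cons.prems by auto
  have sc: "?s \<in> carrier D" using Cons.prems by (intro block_sum_closed) auto
  show ?case
  proof (cases "f t = \<zero>")
    case True
    then have "block_sum f (t # ts) = ?s" using c sc by simp
    then show ?thesis using IH True by simp
  next
    case ft: False
    then have a: "?a \<in> carrier D" "?a \<noteq> \<zero>" using c by auto
    show ?thesis
    proof (cases "?s = \<zero>")
      case True
      then have "\<forall>t \<in> set ts. f t = \<zero>" using IH by blast
      then show ?thesis using True a ft by simp
    next
      case s: False
      then obtain t0 where t0: "t0 \<in> set ts" "f t0 \<noteq> \<zero>" "w ?s = w (f t0 \<otimes> t0)" using IH by blast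
      have c0: "t0 \<in> carrier D" "t0 \<noteq> \<zero>" "f t0 \<in> carrier D" using Cons.prems t0 by auto
      \<comment> \<open>Both coefficients have values of central elements, so equal values of the
        two terms would put \<open>t\<close> and \<open>t0\<close> into the same class.\<close>
      have ne: "w ?a \<noteq> w ?s"
      proof
        assume e: "w ?a = w ?s"
        obtain z z0 where z: "z \<in> Z - {\<zero>}" "w (f t) = w z" "z0 \<in> Z - {\<zero>}" "w (f t0) = w z0"
          using bspec[OF Cons.prems(4), of t] bspec[OF Cons.prems(4), of t0] ft t0
            list.set_intros(1)[of t ts] list.set_intros(2)[of t0 ts t] by blast
        have "w z + w t = w z0 + w t0" using e t0(3) c c0 ft t0(2) z by simp
        then have "w t = w (inv z \<otimes> z0) + w t0"
          using z center_carrier by (simp add: algebra_simps)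
        moreover have "inv z \<otimes> z0 \<in> Z" "inv z \<otimes> z0 \<noteq> \<zero>"
          using z center_inv_mem Z_mult center_carrier by auto
        ultimately have "t \<asymp> t0" by (intro val_equivI[of "inv z \<otimes> z0"])
        then show False using Cons.prems t0 by auto
      qed
      consider "w ?a < w ?s" | "w ?s < w ?a" using ne by fastforce
      then show ?thesis
      proof cases
        case 1
        note v = val_add_less[OF a sc s 1]
        have "w ?a \<le> w (f u \<otimes> u)" if "u \<in> set ts" "f u \<noteq> \<zero>" for u
          using IH that s 1 by (meson less_le_not_le less_le_trans order.trans)
        then show ?thesis using v ft by simp
      next
        case 2
        note v = val_add_less[OF sc s a 2]
        then show ?thesis using IH s 2 t0 a_comm[OF a(1) sc] by auto
      qed
    qed
  qed
qed simp

lemma Span_value: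
  assumes L: "field L" and us: "set us \<subseteq> V" "ring.independent L K (map res us)"
    and e: "e \<in> Span Z us"
  shows "e \<in> carrier D \<and> (e \<noteq> \<zero> \<longrightarrow> (\<exists>z \<in> Z - {\<zero>}. w e = w z))"
proof -
  have usc: "set us \<subseteq> carrier D" using us V_carrier by blast
  obtain Ks where Ks: "set Ks \<subseteq> Z" "length Ks = length us" "e = combine Ks us"
    using e Span_mem_iff_length_version[OF center_subfield usc] by blast
  have "set Ks \<subseteq> carrier D" using Ks center_carrier by blast
  then have "e \<in> carrier D" using Ks usc by simp
  moreover have "\<exists>z \<in> Z - {\<zero>}. w e = w z" if "e \<noteq> \<zero>"
  proof -
    have "\<not> set Ks \<subseteq> {\<zero>}"
    proof
      assume "set Ks \<subseteq> {\<zero>}"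
      then have "Ks = replicate (length us) \<zero>"
        using Ks(2) by (metis replicate_length_same singletonD subset_iff)
      then show False using that Ks(3) combine_replicate[OF usc] by simp
    qed
    from combine_value[OF L Ks(1,2) this us] Ks(3) show ?thesis by blast
  qed
  ultimately show ?thesis by blast
qed

text \<open>Orthogonality makes the lifts independent over the center, and right multiplication by
  \<open>t\<close> is linear over it and injective.\<close>

lemma dimension_right_mult:
  assumes L: "field L" and us: "set us \<subseteq> V" "ring.independent L K (map res us)"
    and t: "t \<in> carrier D" "t \<noteq> \<zero>"
  shows "dimension (length us) Z {e \<otimes> t | e. e \<in> Span Z us}"
proof -
  have usc: "set us \<subseteq> carrier D" using us V_carrier by blast
  let ?us = "map (\<lambda>u. u \<otimes> t) us"
  have usc': "set ?us \<subseteq> carrier D" using usc t by auto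
  have comb: "combine Ks ?us = combine Ks us \<otimes> t" if "set Ks \<subseteq> Z" for Ks
    using that usc t center_carrier by (subst combine_l_distr) auto
  have "independent Z ?us"
  proof (rule trivial_combine_imp_independent[OF center_subfield usc'])
    fix Ks assume Ks: "set Ks \<subseteq> Z" "combine Ks ?us = \<zero>"
    \<comment> \<open>\<open>combine\<close> accepts lists of different lengths, while
      \<open>combine_value\<close> speaks of equal ones; cutting off and padding with zeros does not
      change the sum.\<close>
    let ?Ks = "take (length us) Ks @ replicate (length us - length Ks) \<zero>"
    have sub: "set (take (length us) Ks) \<subseteq> Z" using Ks(1) set_take_subset by fast
    then have K': "set ?Ks \<subseteq> Z" "length ?Ks = length us" by auto
    have c: "set Ks \<subseteq> carrier D" "set (take (length us) Ks) \<subseteq> carrier D"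
      using Ks sub center_carrier by blast+
    have "combine Ks us \<otimes> t = \<zero>" using Ks comb by simp
    then have "combine Ks us = \<zero>"
      using mult_eq_zero_iff[of "combine Ks us" t] c usc t by simp
    then have "combine ?Ks us = \<zero>"
      using combine_append_replicate[OF usc, of "take (length us) Ks"] combine_take[of us Ks] by simp
    then have "set ?Ks \<subseteq> {\<zero>}" using combine_value[OF L K' _ us] by blast
    then show "set (take (length ?us) Ks) \<subseteq> {\<zero>}" by auto
  qed
  from dimension_independent[OF this]
  have "dimension (length us) Z (Span Z ?us)" by simp
  moreover have "Span Z ?us = {e \<otimes> t | e. e \<in> Span Z us}"
    unfolding Span_eq_combine_set[OF center_subfield usc] Span_eq_combine_set[OF center_subfield usc']
    using comb by auto metis+
  ultimately show ?thesis by simp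
qed

text \<open>Each representative contributes a summand of dimension \<open>length us\<close>. The
  summands form a direct sum because distinct classes exclude cancellation.\<close>

lemma dimension_block_sums:
  assumes L: "field L" and us: "set us \<subseteq> V" "ring.independent L K (map res us)"
    and ts: "distinct ts" "set ts \<subseteq> nonzero"
    and "\<forall>s\<in>set ts. \<forall>t\<in>set ts. s \<asymp> t \<longrightarrow> s = t"
  shows "dimension (length ts * length us) Z {block_sum f ts | f. \<forall>t \<in> set ts. f t \<in> Span Z us}"
  using assms(4-)
proof (induction ts)
  case Nil
  show ?case by simp
next
  case (Cons t ts)
  let ?E = "Span Z us"
  let ?W = "\<lambda>ts. {block_sum f ts | f. \<forall>t \<in> set ts. f t \<in> ?E}"
  let ?Et = "{e \<otimes> t | e. e \<in> ?E}"
  have t: "t \<in> carrier D" "t \<noteq> \<zero>" using Cons.prems by auto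
  have IH: "dimension (length ts * length us) Z (?W ts)"
    using Cons.prems by (intro Cons.IH) auto
  note dt = dimension_right_mult[OF L us t]
  have E0: "\<zero> \<in> ?E" using us V_carrier Span_subgroup_props(2)[OF center_subfield, of us] by blast
  have Em: "\<ominus> e \<in> ?E" if "e \<in> ?E" for e
    using us V_carrier Span_subgroup_props(4)[OF center_subfield, of us] that by blast
  have "?Et \<inter> ?W ts = {\<zero>}"
  proof
    show "?Et \<inter> ?W ts \<subseteq> {\<zero>}"
    proof
      fix x assume "x \<in> ?Et \<inter> ?W ts"
      then obtain e f where x: "x = e \<otimes> t" "e \<in> ?E" "x = block_sum f ts" "\<forall>t \<in> set ts. f t \<in> ?E" by blast
      \<comment> \<open>An element common to both summands gives a vanishing block sum with
        coefficient \<open>\<ominus> e\<close> at \<open>t\<close>, so all coefficients are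
        zero.\<close>
      define g where "g s = (if s = t then \<ominus> e else f s)" for s
      have gE: "g s \<in> ?E" if "s \<in> set (t # ts)" for s
        using that x Em by (auto simp: g_def)
      have "block_sum g ts = x" unfolding x(3) using Cons.prems(1) by (intro block_sum_cong) (auto simp: g_def)
      moreover have ec: "e \<in> carrier D" using Span_value[OF L us x(2)] by blast
      ultimately have z: "block_sum g (t # ts) = \<zero>" using x(1) t by (simp add: g_def l_minus l_neg)
      have "\<forall>s\<in>set (t # ts). g s \<in> carrier D \<and> (g s \<noteq> \<zero> \<longrightarrow> (\<exists>z \<in> Z - {\<zero>}. w (g s) = w z))"
        using Span_value[OF L us gE] by blast
      from block_sum_value[OF Cons.prems this] z
      have "g t = \<zero>" using list.set_intros(1)[of t ts] by blast
      then have "e = \<zero>" using ec by (simp add: g_def)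
      then show "x \<in> {\<zero>}" using x t by simp
    qed
    have "block_sum (\<lambda>_. \<zero>) ts = \<zero>" using Cons.prems(2) by (induction ts) auto
    then show "{\<zero>} \<subseteq> ?Et \<inter> ?W ts" using E0 t by (auto intro!: exI[of _ "\<lambda>_. \<zero>"] exI[of _ \<zero>])
  qed
  from dimension_direct_sum_space[OF center_subfield dt IH this]
  have "dimension (length us + length ts * length us) Z (?Et <+>\<^bsub>D\<^esub> ?W ts)" .
  moreover have "?Et <+>\<^bsub>D\<^esub> ?W ts = ?W (t # ts)"
  proof
    show "?Et <+>\<^bsub>D\<^esub> ?W ts \<subseteq> ?W (t # ts)"
    proof
      fix x assume "x \<in> ?Et <+>\<^bsub>D\<^esub> ?W ts"
      then obtain e f where x: "e \<in> ?E" "\<forall>t \<in> set ts. f t \<in> ?E" "x = e \<otimes> t \<oplus> block_sum f ts"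
        unfolding set_add_def' by auto
      define g where "g s = (if s = t then e else f s)" for s
      have "block_sum g ts = block_sum f ts" using Cons.prems(1) by (intro block_sum_cong) (auto simp: g_def)
      then have "x = block_sum g (t # ts)" using x by (simp add: g_def)
      moreover have "\<forall>s \<in> set (t # ts). g s \<in> ?E" using x by (auto simp: g_def)
      ultimately show "x \<in> ?W (t # ts)" by blast
    qed
    show "?W (t # ts) \<subseteq> ?Et <+>\<^bsub>D\<^esub> ?W ts"
      unfolding set_add_def' by auto
  qed
  ultimately show ?case by simp
qed

text \<open>A basis of the subspace is an independent list of full length, so it already spans
  \<open>D\<close>.\<close>

lemma dimension_full:
  assumes "dimension n Z (carrier D)" "dimension n Z W" shows "W = carrier D"
proof -
  obtain us where us: "set us \<subseteq> carrier D" "independent Z us" "length us = n" "Span Z us = W"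
    using exists_base[OF center_subfield assms(2)] by blast
  then show ?thesis
    using independent_length_eq_dimension[OF center_subfield assms(1) us(2)] by auto
qed

end

section \<open>Semi-ramified algebras: degree, class representatives, residue bases\<close>

locale semi_ramified_division_algebra = valued_division_algebra D w
  for D (structure) and w :: "'a \<Rightarrow> 'g::linordered_ab_group_add" +
  assumes semi: "semi_ramified D w"
    and fin: "finite_dimension (center D) (carrier D)"
    and sep: "separable_extension (residue_ring D w) (residue_center D w)"
begin

lemma L_field: "field L"
  using semi by (simp add: semi_ramified_def)

text \<open>The common value of the residue degree, the index of the value groups and the square
  root of \<open>[D:F]\<close>. Taking the index gives a natural number, whereas
  \<open>algebra_degree\<close> is real.\<close>

definition deg :: nat where "deg = value_index D w"

lemma dimension_L: "ring.dimension L deg K (carrier L)"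
  and dimension_D: "dimension (deg * deg) Z (carrier D)"
  and algebra_degree_eq: "algebra_degree D = real deg"
proof -
  interpret L: field L by (rule L_field)
  note KL = K_subfield[OF L_field]
  have s: "real ((L.dim over K) (carrier L)) = algebra_degree D" "real deg = algebra_degree D"
    "L.finite_dimension K (carrier L)"
    using semi by (auto simp: semi_ramified_def deg_def)
  then have "(L.dim over K) (carrier L) = deg" by simp
  then show "L.dimension deg K (carrier L)" using L.finite_dimensionE[OF KL s(3)] by simp
  show "algebra_degree D = real deg" using s by simp
  then have "real ((dim over Z) (carrier D)) = (real deg)\<^sup>2"
    unfolding algebra_degree_def by (metis of_nat_0_le_iff real_sqrt_pow2)
  then have "(dim over Z) (carrier D) = deg * deg"
    by (simp add: power2_eq_square flip: of_nat_mult)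
  then show "dimension (deg * deg) Z (carrier D)"
    using finite_dimensionE[OF center_subfield fin] by simp
qed

lemma deg_pos: "deg > 0"
proof (rule ccontr)
  assume "\<not> deg > 0"
  then have "carrier D = {\<zero>}" using dimension_D dimension_zero[OF center_subfield] by simp
  then show False using one_neq_zero one_closed by blast
qed

definition value_coset :: "'a \<Rightarrow> 'g set" where
  "value_coset x = (w ` (Z - {\<zero>})) #>\<^bsub>value_group D w\<^esub> w x"

lemma value_coset_eq_iff:
  assumes "x \<in> nonzero" "y \<in> nonzero"
  shows "value_coset x = value_coset y \<longleftrightarrow> x \<asymp> y"
proof -
  have cl: "value_coset x = {w z + w x | z. z \<in> Z - {\<zero>}}" for x
    by (auto simp: value_coset_def r_coset_def value_group_def)
  have sub: "value_coset x \<subseteq> value_coset y" if xy: "x \<asymp> y" for x y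
  proof
    fix a assume "a \<in> value_coset x"
    then obtain z where z: "z \<in> Z - {\<zero>}" "a = w z + w x" unfolding cl by blast
    obtain z' where z': "z' \<in> Z - {\<zero>}" "w x = w z' + w y" using xy unfolding val_equiv_def by blast
    have "a = w (z \<otimes> z') + w y" using z z' center_carrier by (simp add: add.assoc)
    moreover have "z \<otimes> z' \<in> Z - {\<zero>}" using z z' center_carrier Z_mult by auto
    ultimately show "a \<in> value_coset y" unfolding cl by blast
  qed
  have "w x \<in> value_coset x" unfolding cl by (auto intro!: exI[of _ \<one>])
  moreover have "x \<asymp> y" if "w x \<in> value_coset y" using that unfolding cl val_equiv_def by blast
  ultimately show ?thesis using sub[of x y] sub[of y x] val_equiv_sym by blast
qed

lemma rcosets_value_group:
  "rcosets\<^bsub>value_group D w\<^esub> (w ` (Z - {\<zero>})) = value_coset ` nonzero"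
  by (auto simp: value_coset_def RCOSETS_def value_group_def)

lemma card_value_cosets: "card (value_coset ` nonzero) = deg" "finite (value_coset ` nonzero)"
proof -
  show "card (value_coset ` nonzero) = deg"
    unfolding deg_def value_index_def rcosets_value_group ..
  \<comment> \<open>Infinite sets have \<open>card\<close> equal to \<open>0\<close>, so finiteness
    of the index follows from the positivity of \<open>deg\<close>.\<close>
  then show "finite (value_coset ` nonzero)" using deg_pos card_ge_0_finite by metis
qed

text \<open>The set \<open>S\<close> contains preferred representatives, used wherever it meets a
  class. It will consist of the powers of one element, so that these become part of an orthogonal
  basis.\<close>

lemma exists_value_representatives:
  assumes S: "S \<subseteq> nonzero"
  obtains ts where "distinct ts" "length ts = deg" "set ts \<subseteq> nonzero"
    "\<forall>s\<in>set ts. \<forall>t\<in>set ts. s \<asymp> t \<longrightarrow> s = t"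
    "\<And>x. x \<in> nonzero \<Longrightarrow> \<exists>t \<in> set ts. x \<asymp> t \<and> ((\<exists>s \<in> S. x \<asymp> s) \<longrightarrow> t \<in> S)"
proof -
  define rep where "rep c = (if \<exists>s \<in> S. value_coset s = c then SOME s. s \<in> S \<and> value_coset s = c
    else SOME x. x \<in> nonzero \<and> value_coset x = c)" for c
  let ?C = "value_coset ` nonzero"
  have rep: "rep c \<in> nonzero" "value_coset (rep c) = c" "(\<exists>s \<in> S. value_coset s = c) \<longrightarrow> rep c \<in> S"
    if "c \<in> ?C" for c
  proof -
    have "rep c \<in> nonzero \<and> value_coset (rep c) = c \<and> ((\<exists>s \<in> S. value_coset s = c) \<longrightarrow> rep c \<in> S)"
    proof (cases "\<exists>s \<in> S. value_coset s = c")
      case True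
      then have "\<exists>s. s \<in> S \<and> value_coset s = c" by blast
      from someI_ex[OF this] show ?thesis using True S unfolding rep_def by auto
    next
      case False
      have "\<exists>x. x \<in> nonzero \<and> value_coset x = c" using that by blast
      from someI_ex[OF this] show ?thesis using False unfolding rep_def by auto
    qed
    then show "rep c \<in> nonzero" "value_coset (rep c) = c" "(\<exists>s \<in> S. value_coset s = c) \<longrightarrow> rep c \<in> S" by blast+
  qed
  have inj: "inj_on rep ?C" using rep(2) by (metis inj_on_inverseI)
  obtain ts where ts: "set ts = rep ` ?C" "distinct ts"
    using finite_distinct_list[of "rep ` ?C"] card_value_cosets(2) by blast
  show ?thesis
  proof
    show "distinct ts" by (rule ts)
    show "length ts = deg"
      using distinct_card[OF ts(2)] card_image[OF inj] card_value_cosets(1) ts(1) by simp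
    show "set ts \<subseteq> nonzero" using ts rep(1) by auto
    show "\<forall>s\<in>set ts. \<forall>t\<in>set ts. s \<asymp> t \<longrightarrow> s = t"
    proof (intro ballI impI)
      fix s t assume st: "s \<in> set ts" "t \<in> set ts" "s \<asymp> t"
      have "s \<in> rep ` ?C" "t \<in> rep ` ?C" using st ts(1) by simp_all
      then obtain c c' where c: "c \<in> ?C" "s = rep c" "c' \<in> ?C" "t = rep c'" by blast
      have "value_coset s = value_coset t"
        using value_coset_eq_iff[OF rep(1)[OF c(1)] rep(1)[OF c(3)]] st(3) unfolding c(2,4) by blast
      then show "s = t" using c rep(2) by simp
    qed
    show "\<exists>t \<in> set ts. x \<asymp> t \<and> ((\<exists>s \<in> S. x \<asymp> s) \<longrightarrow> t \<in> S)" if x: "x \<in> nonzero" for x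
    proof -
      have c: "value_coset x \<in> ?C" using x by blast
      have "x \<asymp> rep (value_coset x)" using value_coset_eq_iff[OF x rep(1)[OF c]] rep(2)[OF c] by simp
      moreover have "rep (value_coset x) \<in> S" if "\<exists>s \<in> S. x \<asymp> s"
        using rep(3)[OF c] that value_coset_eq_iff[OF x] S by blast
      ultimately show ?thesis using ts(1) c by blast
    qed
  qed
qed

text \<open>The basis is arranged to end with \<open>\<one>\<close>; its last coordinate is then the
  component along the center, which is split off later.\<close>

lemma exists_residue_basis:
  obtains vs where "set vs \<subseteq> V" "length (vs @ [\<one>]) = deg" "ring.independent L K (map res (vs @ [\<one>]))"
proof -
  interpret L: field L by (rule L_field)
  note KL = K_subfield[OF L_field]
  have "L.independent K [\<one>\<^bsub>L\<^esub>]" by (rule L.li_Cons) auto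
  from L.complete_base[OF KL dimension_L this] obtain Vs where
    Vs: "length (Vs @ [\<one>\<^bsub>L\<^esub>]) = deg" "L.independent K (Vs @ [\<one>\<^bsub>L\<^esub>])" by auto
  have "set Vs \<subseteq> res ` V" using L.independent_in_carrier[OF Vs(2)] L_carrier by auto
  then have "map (\<lambda>x. res (inv_into V res x)) Vs = Vs"
    by (intro map_idI f_inv_into_f) blast
  then have "map res (map (inv_into V res) Vs) = Vs" by (simp add: o_def)
  moreover have "set (map (inv_into V res) Vs) \<subseteq> V"
    using \<open>set Vs \<subseteq> res ` V\<close> inv_into_into[of _ res V] by auto
  ultimately show ?thesis using Vs by (intro that[of "map (inv_into V res) Vs"]) (simp_all add: res_one)
qed

end

section \<open>Conjugation on the residue field\<close>

context field
begin

text \<open>Gaussian elimination: an equation with a nonzero coefficient is used to remove one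
  unknown, which leaves a system with one equation and one unknown fewer.\<close>

lemma homogeneous_system:
  assumes "finite I" "finite J" "card I < card J" "\<forall>i\<in>I. \<forall>j\<in>J. a i j \<in> carrier R"
  shows "\<exists>y. (\<forall>j\<in>J. y j \<in> carrier R) \<and> (\<exists>j\<in>J. y j \<noteq> \<zero>) \<and> (\<forall>i\<in>I. (\<Oplus>j\<in>J. y j \<otimes> a i j) = \<zero>)"
  using assms
proof (induction I arbitrary: J a rule: finite_induct)
  case empty
  then have "J \<noteq> {}" by auto
  then show ?case by (intro exI[of _ "\<lambda>_. \<one>"]) auto
next
  case (insert i0 I)
  show ?case
  proof (cases "\<forall>j\<in>J. a i0 j = \<zero>")
    case True
    obtain y where y: "\<forall>j\<in>J. y j \<in> carrier R" "\<exists>j\<in>J. y j \<noteq> \<zero>" "\<forall>i\<in>I. (\<Oplus>j\<in>J. y j \<otimes> a i j) = \<zero>"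
      using insert.IH[of J a] insert.prems insert.hyps by auto
    have "(\<Oplus>j\<in>J. y j \<otimes> a i0 j) = (\<Oplus>j\<in>J. \<zero>)"
      using True y by (intro finsum_cong') auto
    then show ?thesis using y by (intro exI[of _ y]) simp
  next
    case False
    then obtain j0 where j0: "j0 \<in> J" "a i0 j0 \<noteq> \<zero>" by blast
    define p where "p = inv (a i0 j0)"
    have ac: "a i j \<in> carrier R" if "i \<in> insert i0 I" "j \<in> J" for i j using insert.prems that by blast
    have "a i0 j0 \<in> Units R" using j0 ac by (simp add: field_Units)
    then have p: "p \<in> carrier R" "p \<otimes> a i0 j0 = \<one>" by (auto simp: p_def)
    define J' where "J' = J - {j0}"
    \<comment> \<open>The coefficients after subtracting the multiple of equation \<open>i0\<close>
      that eliminates the unknown \<open>j0\<close>.\<close>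
    define b where "b i j = a i j \<oplus> \<ominus> (a i j0 \<otimes> p) \<otimes> a i0 j" for i j
    have J': "finite J'" "J = insert j0 J'" "j0 \<notin> J'" "card I < card J'"
      using insert.prems insert.hyps j0 by (auto simp: J'_def)
    have bc: "b i j \<in> carrier R" if "i \<in> I" "j \<in> J'" for i j
      using that ac j0 p J' by (simp add: b_def)
    have "\<forall>i\<in>I. \<forall>j\<in>J'. b i j \<in> carrier R" using bc by blast
    from insert.IH[OF J'(1,4) this] obtain y where
      y: "\<forall>j\<in>J'. y j \<in> carrier R" "\<exists>j\<in>J'. y j \<noteq> \<zero>" "\<forall>i\<in>I. (\<Oplus>j\<in>J'. y j \<otimes> b i j) = \<zero>" by blast
    define \<Sigma> where "\<Sigma> i = (\<Oplus>j\<in>J'. y j \<otimes> a i j)" for i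
    have \<Sigma>c: "\<Sigma> i \<in> carrier R" if "i \<in> insert i0 I" for i
      unfolding \<Sigma>_def using y that ac J' by (intro finsum_closed) auto
    \<comment> \<open>The value of the unknown \<open>j0\<close> that equation \<open>i0\<close>
      forces.\<close>
    define c where "c = \<ominus> (p \<otimes> \<Sigma> i0)"
    have cc: "c \<in> carrier R" using \<Sigma>c p by (simp add: c_def)
    define y' where "y' = y(j0 := c)"
    have sum: "(\<Oplus>j\<in>J. y' j \<otimes> a i j) = c \<otimes> a i j0 \<oplus> \<Sigma> i" if "i \<in> insert i0 I" for i
    proof -
      have "(\<Oplus>j\<in>J. y' j \<otimes> a i j) = y' j0 \<otimes> a i j0 \<oplus> (\<Oplus>j\<in>J'. y' j \<otimes> a i j)"
        unfolding J'(2) using J' y ac[OF that] cc by (intro finsum_insert) (auto simp: y'_def)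
      also have "(\<Oplus>j\<in>J'. y' j \<otimes> a i j) = \<Sigma> i"
        unfolding \<Sigma>_def using J' y ac[OF that] by (intro finsum_cong') (auto simp: y'_def)
      finally show ?thesis by (simp add: y'_def)
    qed
    have "(\<Oplus>j\<in>J. y' j \<otimes> a i j) = \<zero>" if i: "i \<in> insert i0 I" for i
    proof (cases "i = i0")
      case True
      have "c \<otimes> a i0 j0 = \<ominus> (p \<otimes> \<Sigma> i0 \<otimes> a i0 j0)"
        unfolding c_def using p(1) ac[of i0 j0] j0 \<Sigma>c[of i0] by (intro l_minus) auto
      also have "p \<otimes> \<Sigma> i0 \<otimes> a i0 j0 = \<Sigma> i0 \<otimes> (p \<otimes> a i0 j0)"
        using p(1) ac[of i0 j0] j0 \<Sigma>c[of i0] by (simp add: m_ac)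
      finally have "c \<otimes> a i0 j0 = \<ominus> \<Sigma> i0" using p(2) \<Sigma>c[of i0] by simp
      then show ?thesis using sum[OF i] True \<Sigma>c[of i0] by (simp add: l_neg)
    next
      case False
      then have iI: "i \<in> I" using i by blast
      let ?k = "\<ominus> (a i j0 \<otimes> p)"
      have k: "?k \<in> carrier R" using ac i j0 p by simp
      have "\<zero> = (\<Oplus>j\<in>J'. y j \<otimes> b i j)" using y iI by simp
      also have "\<dots> = (\<Oplus>j\<in>J'. y j \<otimes> a i j \<oplus> ?k \<otimes> (y j \<otimes> a i0 j))"
        using y ac i J' k bc iI by (intro finsum_cong') (auto simp: b_def r_distr m_lcomm)
      also have "\<dots> = \<Sigma> i \<oplus> (\<Oplus>j\<in>J'. ?k \<otimes> (y j \<otimes> a i0 j))"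
        unfolding \<Sigma>_def using y ac i J' k by (intro finsum_addf) auto
      also have "(\<Oplus>j\<in>J'. ?k \<otimes> (y j \<otimes> a i0 j)) = ?k \<otimes> \<Sigma> i0"
        unfolding \<Sigma>_def using y ac J' k by (intro finsum_rdistr[symmetric]) auto
      also have "?k \<otimes> \<Sigma> i0 = \<ominus> (a i j0 \<otimes> p \<otimes> \<Sigma> i0)"
        using ac i j0 p(1) \<Sigma>c[of i0] by (intro l_minus) auto
      also have "a i j0 \<otimes> p \<otimes> \<Sigma> i0 = p \<otimes> \<Sigma> i0 \<otimes> a i j0"
        using ac i j0 p(1) \<Sigma>c[of i0] by (simp add: m_ac)
      also have "\<ominus> (p \<otimes> \<Sigma> i0 \<otimes> a i j0) = c \<otimes> a i j0"
        unfolding c_def using ac i j0 p(1) \<Sigma>c[of i0] by (intro l_minus[symmetric]) auto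
      finally show ?thesis using sum[OF i] \<Sigma>c[OF i] cc ac[OF i] j0 by (simp add: a_comm)
    qed
    moreover have "\<forall>j\<in>J. y' j \<in> carrier R" "\<exists>j\<in>J. y' j \<noteq> \<zero>"
      using y cc J' by (auto simp: y'_def)
    ultimately show ?thesis by blast
  qed
qed

text \<open>Translates independence of lists into finite sums over sets, the form in which linear
  systems are solved here.\<close>

lemma independent_finsum_zero:
  assumes "subfield K R" "independent K us" "\<And>u. u \<in> set us \<Longrightarrow> y u \<in> K" "(\<Oplus>u\<in>set us. y u \<otimes> u) = \<zero>" "u \<in> set us"
  shows "y u = \<zero>"
proof -
  have usc: "set us \<subseteq> carrier R" using assms(2) independent_in_carrier by blast
  have yc: "y u \<in> carrier R" if "u \<in> set us" for u using assms(3)[OF that] subfieldE(3)[OF assms(1)] by blast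
  have "combine (map y vs) vs = (\<Oplus>u\<in>set vs. y u \<otimes> u)"
    if "distinct vs" "set vs \<subseteq> set us" for vs
    using that
  proof (induction vs)
    case (Cons v vs)
    then show ?case using usc yc by (auto intro!: finsum_insert[symmetric])
  qed simp
  then have "combine (map y us) us = \<zero>"
    using independent_distinct[OF assms(1,2)] assms(4) by simp
  moreover have "set (map y us) \<subseteq> K" using assms(3) by auto
  ultimately have "set (take (length us) (map y us)) \<subseteq> {\<zero>}"
    using independent_imp_trivial_combine[OF assms(1,2)] by blast
  then show ?thesis using assms(5) by auto
qed

text \<open>With more basis elements than maps, the system \<open>\<Sum> y\<^sub>j s(j) = 0\<close>
  over all \<open>s \<in> S\<close> has a nontrivial solution. Take one of least support and scale
  one entry to \<open>\<one>\<close>. Minimality forces its entries to be fixed by \<open>S\<close>,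
  hence to lie in \<open>K\<close>, and the equation of the identity becomes a linear relation among
  \<open>us\<close>.\<close>

lemma artin_bound:
  assumes K: "subfield K R" and S: "finite S" "S \<subseteq> ring_hom R R"
    and e: "\<exists>s\<in>S. \<forall>x\<in>carrier R. s x = x"
    and cl: "\<And>s t. s \<in> S \<Longrightarrow> t \<in> S \<Longrightarrow> \<exists>u\<in>S. \<forall>x\<in>carrier R. t x = s (u x)"
    and fixed: "\<And>x. x \<in> carrier R \<Longrightarrow> (\<And>s. s \<in> S \<Longrightarrow> s x = x) \<Longrightarrow> x \<in> K"
    and us: "independent K us"
  shows "length us \<le> card S"
proof (rule ccontr)
  assume neg: "\<not> length us \<le> card S"
  let ?J = "set us"
  have usc: "?J \<subseteq> carrier R" using us independent_in_carrier by blast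
  have card: "card S < card ?J" using neg distinct_card[OF independent_distinct[OF K us]] by simp
  have Sc: "s x \<in> carrier R" if "s \<in> S" "x \<in> carrier R" for s x
    using that(2) by (rule ring_hom_closed[OF subsetD[OF S(2) that(1)]])
  define P where "P y \<longleftrightarrow> (\<forall>j\<in>?J. y j \<in> carrier R) \<and> (\<exists>j\<in>?J. y j \<noteq> \<zero>) \<and> (\<forall>s\<in>S. (\<Oplus>j\<in>?J. y j \<otimes> s j) = \<zero>)" for y
  define supp where "supp y = card {j\<in>?J. y j \<noteq> \<zero>}" for y :: "'a \<Rightarrow> 'a"
  have "\<forall>s\<in>S. \<forall>j\<in>?J. s j \<in> carrier R"
  proof (intro ballI)
    fix s j assume "s \<in> S" "j \<in> ?J"
    then show "s j \<in> carrier R" using Sc[of s j] subsetD[OF usc, of j] by simp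
  qed
  from homogeneous_system[where a = "\<lambda>s j. s j", OF S(1) finite_set card this]
  obtain y0 where "(\<forall>j\<in>?J. y0 j \<in> carrier R) \<and> (\<exists>j\<in>?J. y0 j \<noteq> \<zero>) \<and> (\<forall>s\<in>S. (\<Oplus>j\<in>?J. y0 j \<otimes> s j) = \<zero>)"
    by (rule exE)
  then have ex: "\<exists>y. P y" unfolding P_def[symmetric] by (rule exI[of P y0])
  define m where "m = (LEAST k. \<exists>y. P y \<and> supp y = k)"
  obtain y1 where "P y1" using ex by (rule exE)
  then have "\<exists>y. P y \<and> supp y = supp y1" by (intro exI[of _ y1] conjI refl)
  then have "\<exists>y. P y \<and> supp y = m"
    unfolding m_def by (rule LeastI[of "\<lambda>k. \<exists>y. P y \<and> supp y = k"])
  then obtain y where y: "P y" "supp y = m" by blast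
  have min: "m \<le> supp z" if "P z" for z
    unfolding m_def by (rule Least_le, rule exI[of _ z]) (simp add: that)
  from y obtain j0 where j0: "j0 \<in> ?J" "y j0 \<noteq> \<zero>" unfolding P_def by blast
  have yc: "y j \<in> carrier R" if "j \<in> ?J" for j using y(1) that unfolding P_def by blast
  define p where "p = inv (y j0)"
  have "y j0 \<in> Units R" using j0 yc by (simp add: field_Units)
  then have p: "p \<in> carrier R" "p \<otimes> y j0 = \<one>" by (auto simp: p_def)
  define z where "z j = p \<otimes> y j" for j
  have zc: "z j \<in> carrier R" if "j \<in> ?J" for j using yc that p by (simp add: z_def)
  have z1: "z j0 = \<one>" using p by (simp add: z_def)
  have zS: "(\<Oplus>j\<in>?J. z j \<otimes> s j) = \<zero>" if s: "s \<in> S" for s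
  proof -
    have "(\<Oplus>j\<in>?J. z j \<otimes> s j) = (\<Oplus>j\<in>?J. p \<otimes> (y j \<otimes> s j))"
      unfolding z_def using p yc Sc[OF s] usc by (intro finsum_cong') (auto simp: m_assoc subset_iff)
    also have "\<dots> = p \<otimes> (\<Oplus>j\<in>?J. y j \<otimes> s j)"
      using p yc Sc[OF s] usc by (intro finsum_rdistr[symmetric]) auto
    finally show ?thesis using y(1) s p unfolding P_def by simp
  qed
  have z0: "z j = \<zero>" if "y j = \<zero>" for j using that p by (simp add: z_def)
  have all: "z j \<in> K" if j: "j \<in> ?J" for j
  proof (rule fixed[OF zc[OF j]])
    fix s assume s: "s \<in> S"
    show "s (z j) = z j"
    proof (rule ccontr)
      assume ne: "s (z j) \<noteq> z j"
      interpret h: ring_hom_cring R R s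
        by (intro ring_hom_cringI is_cring) (use S(2) s in blast)
      \<comment> \<open>As \<open>t\<close> is \<open>s\<close> after \<open>t'\<close>, applying
        \<open>s\<close> to the equation of \<open>t'\<close> yields that of \<open>t\<close>. So
        \<open>u\<close> is again a solution; it vanishes wherever \<open>y\<close> does and also at
        \<open>j0\<close>, where \<open>z\<close> is \<open>\<one>\<close>.\<close>
      define u where "u j = s (z j) \<ominus> z j" for j
      have uc: "u j \<in> carrier R" if "j \<in> ?J" for j using zc that by (simp add: u_def)
      have "(\<Oplus>j\<in>?J. u j \<otimes> t j) = \<zero>" if t: "t \<in> S" for t
      proof -
        obtain t' where t': "t' \<in> S" "\<forall>x\<in>carrier R. t x = s (t' x)" using cl[OF s t] by blast
        have 1: "(\<Oplus>j\<in>?J. s (z j) \<otimes> t j) = s (\<Oplus>j\<in>?J. z j \<otimes> t' j)"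
        proof -
          have "s (\<Oplus>j\<in>?J. z j \<otimes> t' j) = (\<Oplus>j\<in>?J. s (z j \<otimes> t' j))"
            using h.hom_finsum[of "\<lambda>j. z j \<otimes> t' j" ?J] zc Sc[OF t'(1)] usc by (auto simp: o_def subset_iff)
          also have "\<dots> = (\<Oplus>j\<in>?J. s (z j) \<otimes> t j)"
            using zc Sc[OF t'(1)] Sc[OF t] t'(2) usc by (intro finsum_cong') (auto simp: subset_iff)
          finally show ?thesis ..
        qed
        have "(\<Oplus>j\<in>?J. u j \<otimes> t j) = (\<Oplus>j\<in>?J. s (z j) \<otimes> t j \<oplus> \<ominus> \<one> \<otimes> (z j \<otimes> t j))"
          using zc Sc[OF t] usc by (intro finsum_cong') (auto simp: u_def a_minus_def l_distr l_minus subset_iff)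
        also have "\<dots> = (\<Oplus>j\<in>?J. s (z j) \<otimes> t j) \<oplus> (\<Oplus>j\<in>?J. \<ominus> \<one> \<otimes> (z j \<otimes> t j))"
          using zc Sc[OF t] usc by (intro finsum_addf) auto
        also have "(\<Oplus>j\<in>?J. \<ominus> \<one> \<otimes> (z j \<otimes> t j)) = \<ominus> \<one> \<otimes> (\<Oplus>j\<in>?J. z j \<otimes> t j)"
          using zc Sc[OF t] usc by (intro finsum_rdistr[symmetric]) auto
        finally show ?thesis unfolding 1 using zS[OF t] zS[OF t'(1)] by simp
      qed
      moreover have "u j \<noteq> \<zero>" using ne zc[OF j] by (simp add: u_def)
      ultimately have "P u" unfolding P_def using uc j by blast
      moreover have "supp u < supp y"
        unfolding supp_def
      proof (rule psubset_card_mono)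
        have "u j0 = \<zero>" by (simp add: u_def z1)
        moreover have "u i = \<zero>" if "y i = \<zero>" for i using z0[OF that] by (simp add: u_def)
        ultimately show "{j \<in> ?J. u j \<noteq> \<zero>} \<subset> {j \<in> ?J. y j \<noteq> \<zero>}" using j0 by blast
      qed simp
      ultimately show False using min[of u] y(2) by simp
    qed
  qed
  obtain s where s: "s \<in> S" "\<forall>x\<in>carrier R. s x = x" using e by blast
  have "(\<Oplus>j\<in>?J. z j \<otimes> j) = (\<Oplus>j\<in>?J. z j \<otimes> s j)"
    using s zc usc by (intro finsum_cong') (auto simp: subset_iff)
  then have "(\<Oplus>j\<in>?J. z j \<otimes> j) = \<zero>" using zS[OF s(1)] by simp
  from independent_finsum_zero[OF K us all this j0(1)] z1 show False by simp
qed

end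

section \<open>The map from value classes to automorphisms of the residue field\<close>

context semi_ramified_division_algebra
begin

text \<open>Wedderburn's factorization gives a power of \<open>X - res d\<close> over
  \<open>K\<close>; separability excludes everything but a root in \<open>K\<close>.\<close>

lemma residue_mem_center:
  assumes B: "central_division_subring D B" and d: "d \<in> B" "d \<in> V"
    and conj: "\<And>x. \<lbrakk>x \<in> B; x \<noteq> \<zero>\<rbrakk> \<Longrightarrow> res (x \<otimes> d \<otimes> inv x) = res d"
  shows "res d \<in> K"
proof -
  interpret L: field L by (rule L_field)
  have B': "valued_central_division_subring D w B"
    using B valued_division_algebra_axioms by (simp add: valued_central_division_subring_def)
  show ?thesis
  proof (rule valued_central_division_subring.residue_linear_power[OF B' L_field d fin conj])
    fix N :: nat
    assume N: "N > 0" "\<And>i. L.coeff ([\<one>\<^bsub>L\<^esub>, \<ominus>\<^bsub>L\<^esub> res d] [^]\<^bsub>poly_ring L\<^esub> N) i \<in> K"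
    have a: "res d \<in> carrier L" using d res_closed by blast
    have "[\<one>\<^bsub>L\<^esub>, \<ominus>\<^bsub>L\<^esub> res d] [^]\<^bsub>poly_ring L\<^esub> N \<in> carrier (poly_ring L)"
      using L.linear_poly_closed[OF a] monoid.nat_pow_closed[OF L.univ_poly_is_monoid[OF L.carrier_is_subring]]
      by blast
    then have P: "[\<one>\<^bsub>L\<^esub>, \<ominus>\<^bsub>L\<^esub> res d] [^]\<^bsub>poly_ring L\<^esub> N \<in> carrier (univ_poly L K)"
      using N(2) by (rule L.poly_mem_subfieldI)
    show "res d \<in> K"
      using L.separable_root_mem[OF K_subfield[OF L_field] a N(1) P] sep a
      unfolding separable_extension_def by blast
  qed
qed

text \<open>Applied to \<open>D\<close> itself, \<open>residue_mem_center\<close> says that the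
  common fixed field of all conjugations is \<open>K\<close>, as Artin's bound requires.\<close>

lemma central_division_subring_carrier: "central_division_subring D (carrier D)"
proof (intro central_division_subring.intro central_division_subring_axioms.intro)
  show "division_algebra D" by (rule division_algebra_axioms)
  show "subring (carrier D) D" by (rule carrier_is_subring)
  show "center D \<subseteq> carrier D" using center_carrier by blast
  show "c \<in> center D" if "c \<in> carrier D" "\<And>x. x \<in> carrier D \<Longrightarrow> c \<otimes> x = x \<otimes> c" for c
    unfolding center_def using that by blast
qed auto

text \<open>\<open>inv_into\<close> picks an arbitrary lift, whose choice does not matter by
  \<open>residue_conj_res\<close>. \<open>restrict\<close> makes the map extensional, as members of
  \<open>BijGroup\<close> are.\<close>

definition residue_conj :: "'a \<Rightarrow> 'a set \<Rightarrow> 'a set" where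
  "residue_conj x = restrict (\<lambda>l. res (x \<otimes> inv_into V res l \<otimes> inv x)) (carrier L)"

lemma residue_conj_res:
  assumes "x \<in> nonzero" "d \<in> V"
  shows "residue_conj x (res d) = res (x \<otimes> d \<otimes> inv x)"
proof -
  define d' where "d' = inv_into V res (res d)"
  have im: "res d \<in> res ` V" using assms(2) by (rule imageI)
  have d': "d' \<in> V" "res d' = res d"
    unfolding d'_def by (rule inv_into_into[OF im], rule f_inv_into_f[OF im])
  have "d' \<ominus> d \<in> M" using d' assms res_eq_iff by blast
  moreover have "x \<otimes> d' \<otimes> inv x \<ominus> x \<otimes> d \<otimes> inv x = x \<otimes> (d' \<ominus> d) \<otimes> inv x"
    using assms d' V_carrier by (simp add: a_minus_def l_distr r_distr l_minus r_minus)
  ultimately have "res (x \<otimes> d' \<otimes> inv x) = res (x \<otimes> d \<otimes> inv x)"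
    using res_eq_iff[of "x \<otimes> d' \<otimes> inv x" "x \<otimes> d \<otimes> inv x"] conj_V conj_M assms d' by auto
  then show ?thesis using assms res_closed by (simp add: residue_conj_def d'_def)
qed

lemma residue_conj_closed: "x \<in> nonzero \<Longrightarrow> l \<in> carrier L \<Longrightarrow> residue_conj x l \<in> carrier L"
  using residue_conj_res res_closed conj_V unfolding L_carrier by auto

lemma residue_conj_mult:
  assumes "x \<in> nonzero" "y \<in> nonzero" "l \<in> carrier L"
  shows "residue_conj (x \<otimes> y) l = residue_conj x (residue_conj y l)"
proof -
  obtain d where d: "d \<in> V" "l = res d" using assms L_carrier by auto
  have "x \<otimes> y \<otimes> d \<otimes> inv (x \<otimes> y) = x \<otimes> (y \<otimes> d \<otimes> inv y) \<otimes> inv x"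
    using assms V_carrier[OF d(1)] by (simp add: inv_mult m_assoc)
  then show ?thesis unfolding d(2) using assms d(1) conj_V by (simp add: residue_conj_res)
qed

lemma residue_conj_one: "l \<in> carrier L \<Longrightarrow> residue_conj \<one> l = l"
  unfolding L_carrier using residue_conj_res[of \<one>] V_carrier inv_one by auto

lemma residue_conj_hom:
  assumes "x \<in> nonzero" shows "residue_conj x \<in> ring_hom L L"
proof (rule ring_hom_memI)
  fix k l assume "k \<in> carrier L" "l \<in> carrier L"
  then obtain d e where d: "d \<in> V" "k = res d" and e: "e \<in> V" "l = res e" using L_carrier by auto
  have c: "d \<in> carrier D" "e \<in> carrier D" using d e V_carrier by auto
  have "x \<otimes> (d \<otimes> e) \<otimes> inv x = (x \<otimes> d \<otimes> inv x) \<otimes> (x \<otimes> e \<otimes> inv x)"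
    using assms c by (simp add: m_assoc)
  then show "residue_conj x (k \<otimes>\<^bsub>L\<^esub> l) = residue_conj x k \<otimes>\<^bsub>L\<^esub> residue_conj x l"
    unfolding d(2) e(2) using assms d(1) e(1) conj_V
    by (simp add: residue_conj_res V_mult flip: res_mult)
  have "x \<otimes> (d \<oplus> e) \<otimes> inv x = (x \<otimes> d \<otimes> inv x) \<oplus> (x \<otimes> e \<otimes> inv x)"
    using assms c by (simp add: l_distr r_distr)
  then show "residue_conj x (k \<oplus>\<^bsub>L\<^esub> l) = residue_conj x k \<oplus>\<^bsub>L\<^esub> residue_conj x l"
    unfolding d(2) e(2) using assms d(1) e(1) conj_V
    by (simp add: residue_conj_res V_add flip: res_add)
next
  show "residue_conj x \<one>\<^bsub>L\<^esub> = \<one>\<^bsub>L\<^esub>"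
    using residue_conj_res[OF assms, of \<one>] assms by (simp add: res_one)
qed (rule residue_conj_closed[OF assms])

lemma residue_conj_cong:
  assumes "x \<in> nonzero" "y \<in> nonzero" "x \<asymp> y"
  shows "residue_conj x = residue_conj y"
proof
  fix l show "residue_conj x l = residue_conj y l"
  proof (cases "l \<in> carrier L")
    case True
    then obtain d where "d \<in> V" "l = res d" using L_carrier by auto
    then show ?thesis using residue_conj_res assms res_conj_cong[OF L_field assms(3,1,2)] by simp
  qed (simp add: residue_conj_def)
qed

text \<open>\<open>residue_conj\<close> is \<open>\<theta>\<^sub>D\<close>; it is injective since its image has order at least \<open>[L : K]\<close> by Artin.\<close>

lemma residue_conj_inj:
  assumes "x \<in> nonzero" "y \<in> nonzero" "residue_conj x = residue_conj y"
  shows "x \<asymp> y"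
proof -
  interpret L: field L by (rule L_field)
  obtain ts where ts: "distinct ts" "length ts = deg" "set ts \<subseteq> nonzero"
    "\<forall>s\<in>set ts. \<forall>t\<in>set ts. s \<asymp> t \<longrightarrow> s = t"
    "\<And>x. x \<in> nonzero \<Longrightarrow> \<exists>t \<in> set ts. x \<asymp> t \<and> ((\<exists>s \<in> {}. x \<asymp> s) \<longrightarrow> t \<in> {})"
    using exists_value_representatives[of "{}"] by blast
  have rep: "\<exists>t \<in> set ts. x \<asymp> t \<and> residue_conj x = residue_conj t" if "x \<in> nonzero" for x
    using ts(5)[OF that] residue_conj_cong[OF that] ts(3) by blast
  obtain vs where vs: "length (vs @ [\<one>]) = deg" "L.independent K (map res (vs @ [\<one>]))"
    using exists_residue_basis by blast
  let ?S = "residue_conj ` set ts"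
  have "length (map res (vs @ [\<one>])) \<le> card ?S"
  proof (rule L.artin_bound[OF K_subfield[OF L_field]])
    show "?S \<subseteq> ring_hom L L" using residue_conj_hom ts(3) by blast
    have "\<one> \<in> nonzero" by simp
    then show "\<exists>s\<in>?S. \<forall>x\<in>carrier L. s x = x"
      using rep residue_conj_one by (metis image_eqI)
    show "\<exists>u\<in>?S. \<forall>x\<in>carrier L. t x = s (u x)" if st: "s \<in> ?S" "t \<in> ?S" for s t
    proof -
      obtain a b where ab: "a \<in> set ts" "s = residue_conj a" "b \<in> set ts" "t = residue_conj b"
        using st by blast
      have c: "a \<in> nonzero" "b \<in> nonzero" using ab ts(3) by blast+
      then have c3: "inv a \<otimes> b \<in> nonzero" by simp
      \<comment> \<open>Closure of \<open>?S\<close>: the map \<open>t\<close> is \<open>s\<close>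
        followed on the right by conjugation with the class of
        \<open>inv a \<otimes> b\<close>.\<close>
      obtain u where u: "u \<in> set ts" "residue_conj (inv a \<otimes> b) = residue_conj u" using rep[OF c3] by blast
      have "t x = s (residue_conj u x)" if "x \<in> carrier L" for x
        unfolding ab u(2)[symmetric] using residue_conj_mult[OF c(1) c3 that] c by simp
      then show ?thesis using u(1) by blast
    qed
    show "l \<in> K" if l: "l \<in> carrier L" "\<And>s. s \<in> ?S \<Longrightarrow> s l = l" for l
    proof -
      obtain d where d: "d \<in> V" "l = res d" using l L_carrier by auto
      have "res (x \<otimes> d \<otimes> inv x) = res d" if "x \<in> carrier D" "x \<noteq> \<zero>" for x
        using rep[of x] that l(2) residue_conj_res[of x d] d by auto
      then show ?thesis
        unfolding d(2) using residue_mem_center[OF central_division_subring_carrier V_carrier[OF d(1)] d(1)] by blast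
    qed
  qed (use vs in auto)
  \<comment> \<open>Artin's bound gives at least \<open>deg\<close> automorphisms, and
    \<open>?S\<close> is the image of \<open>deg\<close> representatives, so none of them are
    identified.\<close>
  then have "card ?S = card (set ts)"
    using vs(1) ts(2) distinct_card[OF ts(1)] card_image_le[of "set ts" residue_conj] by simp
  then have inj: "inj_on residue_conj (set ts)" by (intro eq_card_imp_inj_on) auto
  obtain s t where st: "s \<in> set ts" "x \<asymp> s" "residue_conj x = residue_conj s"
    "t \<in> set ts" "y \<asymp> t" "residue_conj y = residue_conj t"
    using rep[OF assms(1)] rep[OF assms(2)] by blast
  then have "s = t" using assms(3) inj by (auto dest: inj_onD)
  then show ?thesis using st val_equiv_trans val_equiv_sym by blast
qed

end

section \<open>Commuting subrings\<close>

lemma group_galois_group: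
  assumes R: "ring R" and K: "K \<subseteq> carrier R"
  shows "group (galois_group R K)"
proof -
  interpret R: ring R by (rule R)
  let ?B = "BijGroup (carrier R)"
  let ?H = "{s \<in> Bij (carrier R) \<inter> ring_hom R R. \<forall>x \<in> K. s x = x}"
  interpret B: group ?B by (rule group_BijGroup)
  have "subgroup ?H ?B"
  proof
    show "?H \<subseteq> carrier ?B" by (auto simp: BijGroup_def)
    show "\<one>\<^bsub>?B\<^esub> \<in> ?H"
      using K id_Bij[of "carrier R"] by (auto simp: BijGroup_def intro!: ring_hom_memI)
    fix s assume s: "s \<in> ?H"
    have sc: "s x \<in> carrier R" if "x \<in> carrier R" for x using s that ring_hom_closed[of s R R x] by blast
    show "s \<otimes>\<^bsub>?B\<^esub> t \<in> ?H" if t: "t \<in> ?H" for t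
    proof -
      have tc: "t x \<in> carrier R" if "x \<in> carrier R" for x using t that ring_hom_closed[of t R R x] by blast
      have "compose (carrier R) s t \<in> ring_hom R R"
        using s t sc tc by (intro ring_hom_memI) (auto simp: compose_def ring_hom_def)
      moreover have "compose (carrier R) s t \<in> Bij (carrier R)" using s t by (intro compose_Bij) auto
      moreover have "\<forall>x\<in>K. compose (carrier R) s t x = x" using s t K by (auto simp: compose_def)
      ultimately show ?thesis using s t by (simp add: BijGroup_def)
    qed
    have bij: "bij_betw s (carrier R) (carrier R)" using s by (auto simp: Bij_def)
    then have "s \<in> ring_iso R R" using s by (auto simp: ring_iso_def)
    from ring_iso_set_sym[OF R this] have inv: "inv_into (carrier R) s \<in> ring_hom R R" by (auto simp: ring_iso_def)
    let ?i = "restrict (inv_into (carrier R) s) (carrier R)"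
    have "?i \<in> ring_hom R R"
      using inv by (intro ring_hom_memI) (auto simp: ring_hom_def)
    moreover have "?i x = x" if "x \<in> K" for x
      using that s K bij bij_betw_inv_into_left[OF bij, of x] by auto
    moreover have "?i \<in> Bij (carrier R)" using s restrict_inv_into_Bij[of s "carrier R"] by blast
    ultimately have "?i \<in> ?H" by blast
    moreover have "inv\<^bsub>?B\<^esub> s = ?i" using s by (intro inv_BijGroup) blast
    ultimately show "inv\<^bsub>?B\<^esub> s \<in> ?H" by simp
  qed
  then show ?thesis unfolding galois_group_def by (rule subgroup.subgroup_is_group) (rule group_BijGroup)
qed

text \<open>The exponent is reduced modulo \<open>N\<close>. This mediates between the integer
  exponents of cyclic groups and the natural ones in \<open>degenerate\<close> and in the comparison
  of value classes.\<close>

lemma (in group) torsion_int_pow: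
  assumes "a \<in> carrier G" "a [^] (N::nat) = \<one>" "N > 0"
  shows "\<exists>n::nat. a [^] (k::int) = a [^] n"
proof -
  have "a [^] k = a [^] (k mod int N + int N * (k div int N))" by simp
  also have "\<dots> = a [^] (k mod int N) \<otimes> a [^] (int N * (k div int N))"
    using assms(1) by (rule int_pow_mult)
  also have "a [^] (int N * (k div int N)) = (a [^] int N) [^] (k div int N)"
    using assms(1) by (simp add: int_pow_pow)
  also have "\<dots> = \<one>" using assms(2) by (simp add: int_pow_int)
  finally have "a [^] k = a [^] nat (k mod int N)"
    using assms by (simp flip: int_pow_int)
  then show ?thesis by blast
qed

lemma group_basis_ordered_power:
  fixes G (structure)
  assumes G: "group G" and b: "group_basis G r s"
    and tor: "\<And>i. i < r \<Longrightarrow> s i [^]\<^bsub>G\<^esub> (N::nat) = \<one>\<^bsub>G\<^esub>" "N > 0" and g: "g \<in> carrier G"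
  shows "\<exists>m. g = ordered_power G s m r"
proof -
  interpret group G by (rule G)
  let ?P = "product_group {..<r} (\<lambda>i. subgroup_generated G {s i})"
  have s: "s i \<in> carrier G" if "i < r" for i using b that by (auto simp: group_basis_def)
  have iso: "(\<lambda>f. finprod G f {..<r}) \<in> iso ?P G" using b by (auto simp: group_basis_def)
  have surj: "\<exists>f \<in> carrier ?P. a = finprod G f {..<r}" if "a \<in> carrier G" for a
    using iso that by (auto simp: iso_def bij_betw_def image_iff)
  have int: "carrier (subgroup_generated G {s i}) = range (\<lambda>n::int. s i [^] n)" if "i < r" for i
    by (rule carrier_subgroup_generated_by_singleton[OF s[OF that]])
  \<comment> \<open>Commutativity is read off from the isomorphism with a product of cyclic groups.
    Only its homomorphism property is used, since \<open>finprod\<close> can be evaluated only once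
    commutativity is known.\<close>
  have comm: "a \<otimes> b = b \<otimes> a" if ab: "a \<in> carrier G" "b \<in> carrier G" for a b
  proof -
    obtain f h where f: "f \<in> carrier ?P" "a = finprod G f {..<r}" and h: "h \<in> carrier ?P" "b = finprod G h {..<r}"
      using surj[OF ab(1)] surj[OF ab(2)] by blast
    have eq: "f \<otimes>\<^bsub>?P\<^esub> h = h \<otimes>\<^bsub>?P\<^esub> f"
    proof -
      have "f i \<otimes> h i = h i \<otimes> f i" if i: "i < r" for i
      proof -
        have "f i \<in> carrier (subgroup_generated G {s i})" "h i \<in> carrier (subgroup_generated G {s i})"
          using f h i by (auto simp: PiE_def Pi_def)
        then obtain k l :: int where "f i = s i [^] k" "h i = s i [^] l" using int[OF i] by auto
        then show ?thesis using s[OF i] by (simp add: int_pow_mult[symmetric] add.commute)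
      qed
      then show ?thesis by (auto intro!: restrict_ext)
    qed
    have hom: "(\<lambda>f. finprod G f {..<r}) \<in> hom ?P G" using iso by (simp add: iso_def)
    have "a \<otimes> b = finprod G (f \<otimes>\<^bsub>?P\<^esub> h) {..<r}"
      unfolding f(2) h(2) by (rule hom_mult[OF hom f(1) h(1), symmetric])
    also have "\<dots> = b \<otimes> a"
      unfolding f(2) h(2) eq by (rule hom_mult[OF hom h(1) f(1)])
    finally show ?thesis .
  qed
  interpret G: comm_group G by (rule group_comm_groupI[OF comm])
  obtain f where f: "f \<in> carrier ?P" "g = finprod G f {..<r}" using surj[OF g] by blast
  have "\<exists>n::nat. f i = s i [^] n" if i: "i < r" for i
  proof -
    have "f i \<in> carrier (subgroup_generated G {s i})" using f i by (auto simp: PiE_def Pi_def)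
    then obtain k :: int where "f i = s i [^] k" using int[OF i] by auto
    then show ?thesis using torsion_int_pow[OF s[OF i] tor(1)[OF i] tor(2)] by simp
  qed
  then obtain m where m: "\<And>i. i < r \<Longrightarrow> f i = s i [^] (m i :: nat)" by metis
  have "finprod G f {..<k} = ordered_power G s m k" if "k \<le> r" for k
    using that
  proof (induction k)
    case (Suc k)
    have c: "f i \<in> carrier G" if "i < r" for i using m[OF that] s[OF that] by simp
    have "finprod G f {..<Suc k} = f k \<otimes> finprod G f {..<k}"
      unfolding lessThan_Suc using Suc.prems c by (intro G.finprod_insert) auto
    also have "\<dots> = finprod G f {..<k} \<otimes> f k"
      using Suc.prems c by (intro comm) (auto intro!: G.finprod_closed)
    finally show ?case using Suc m[of k] by simp
  qed simp
  then show ?thesis using f by auto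
qed

context semi_ramified_division_algebra
begin

text \<open>
  If \<open>d \<in> B\<close> were not in the \<open>Z\<close>-span of the powers of \<open>y\<close>, removing its components along them would leave an
  element of \<open>B\<close> whose leading term still lies along a power of \<open>y\<close>, against orthogonality.
\<close>

lemma commutative_if_cyclic_values:
  assumes B: "central_division_subring D B"
    and resK: "\<And>d. \<lbrakk>d \<in> B; d \<in> V\<rbrakk> \<Longrightarrow> res d \<in> K"
    and y: "y \<in> B" "y \<noteq> \<zero>" and cyc: "\<And>x. \<lbrakk>x \<in> B; x \<noteq> \<zero>\<rbrakk> \<Longrightarrow> \<exists>n::nat. x \<asymp> y [^] n"
    and x: "x \<in> B" "x' \<in> B"
  shows "x \<otimes> x' = x' \<otimes> x"
proof -
  interpret B: central_division_subring D B by (rule B)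
  interpret L: field L by (rule L_field)
  have yc: "y \<in> carrier D" using y B.B_carrier by blast
  define S where "S = range (\<lambda>n::nat. y [^] n)"
  have S: "S \<subseteq> nonzero" "S \<subseteq> B" using yc y B.B_pow by (auto simp: S_def)
  obtain ts where ts: "distinct ts" "length ts = deg" "set ts \<subseteq> nonzero"
    "\<forall>s\<in>set ts. \<forall>t\<in>set ts. s \<asymp> t \<longrightarrow> s = t"
    "\<And>x. x \<in> nonzero \<Longrightarrow> \<exists>t \<in> set ts. x \<asymp> t \<and> ((\<exists>s \<in> S. x \<asymp> s) \<longrightarrow> t \<in> S)"
    by (rule exists_value_representatives[OF S(1)]) metis
  have tsc: "set ts \<subseteq> carrier D" using ts(3) by blast
  obtain vs where vs: "set vs \<subseteq> V" "length (vs @ [\<one>]) = deg" "L.independent K (map res (vs @ [\<one>]))"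
    using exists_residue_basis by blast
  let ?us = "vs @ [\<one>]"
  let ?E = "Span Z ?us"
  have us: "set ?us \<subseteq> V" using vs(1) by simp
  have vsc: "set vs \<subseteq> carrier D" and usc: "set ?us \<subseteq> carrier D" using vs(1) V_carrier by auto
  have "{block_sum f ts | f. \<forall>t \<in> set ts. f t \<in> ?E} = carrier D"
  \<comment> \<open>There are \<open>deg\<close> representatives and \<open>deg\<close> residue
    basis elements, so the blocks have the dimension of \<open>D\<close>.\<close>
  proof (rule dimension_full[OF dimension_D])
    show "dimension (deg * deg) Z {block_sum f ts | f. \<forall>t \<in> set ts. f t \<in> ?E}"
      using dimension_block_sums[OF L_field us vs(3) ts(1,3,4)] unfolding ts(2) vs(2) .
  qed
  then have full: "\<exists>f. (\<forall>t \<in> set ts. f t \<in> ?E) \<and> d = block_sum f ts" if "d \<in> carrier D" for d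
    using that by blast
  \<comment> \<open>Here \<open>z\<close> is the coefficient of the basis element
    \<open>\<one>\<close> in \<open>e\<close>. In \<open>e \<ominus> z \<ominus> z'\<close> that
    coefficient is \<open>\<ominus> z'\<close>, so by orthogonality the value is at most
    \<open>w z'\<close>.\<close>
  have split: "\<exists>z \<in> Z. e \<ominus> z \<in> ?E \<and> (\<forall>z' \<in> Z. e \<ominus> z \<ominus> z' \<in> ?E \<and>
      (z' \<noteq> \<zero> \<longrightarrow> e \<ominus> z \<ominus> z' \<noteq> \<zero> \<and> w (e \<ominus> z \<ominus> z') \<le> w z'))" if e: "e \<in> ?E" for e
  proof -
    obtain Ks where Ks: "set Ks \<subseteq> Z" "length Ks = length ?us" "e = combine Ks ?us"
      using e Span_mem_iff_length_version[OF center_subfield usc] by blast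
    define Ks' where "Ks' = take (length vs) Ks"
    define z where "z = last Ks"
    have "Ks \<noteq> []" using Ks(2) by auto
    then have KsE: "Ks = Ks' @ [z]"
      using Ks(2) unfolding Ks'_def z_def by (metis append_butlast_last_id butlast_conv_take diff_Suc_1 length_append_singleton)
    have K': "set Ks' \<subseteq> Z" "length Ks' = length vs" and z: "z \<in> Z" using Ks KsE by auto
    have c: "set Ks' \<subseteq> carrier D" "z \<in> carrier D" using K' z center_carrier by blast+
    have comb: "combine (Ks' @ [a]) ?us = combine Ks' vs \<oplus> a" if "a \<in> carrier D" for a
      using combine_append[OF K'(2) c(1) vsc, of "[a]" "[\<one>]"] that by simp
    have ez: "e \<ominus> z = combine Ks' vs"
      unfolding Ks(3) KsE comb[OF c(2)] using c vsc by (simp add: a_minus_def a_assoc r_neg)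
    have main: "e \<ominus> z \<ominus> z' = combine (Ks' @ [\<ominus> z']) ?us" if "z' \<in> Z" for z'
      unfolding ez using comb[of "\<ominus> z'"] center_carrier[OF that] by (simp add: a_minus_def)
    have inE: "e \<ominus> z \<ominus> z' \<in> ?E" if z': "z' \<in> Z" for z'
      unfolding main[OF z'] Span_eq_combine_set[OF center_subfield usc] using K' Z_minus[OF z'] by fastforce
    moreover have "e \<ominus> z \<ominus> z' \<noteq> \<zero> \<and> w (e \<ominus> z \<ominus> z') \<le> w z'" if z': "z' \<in> Z" "z' \<noteq> \<zero>" for z'
    proof -
      have m0: "\<ominus> z' \<noteq> \<zero>" using z' center_carrier by (metis a_inv_closed minus_minus minus_zero)
      have "set (Ks' @ [\<ominus> z']) \<subseteq> Z" "length (Ks' @ [\<ominus> z']) = length ?us" "\<not> set (Ks' @ [\<ominus> z']) \<subseteq> {\<zero>}"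
        using K' Z_minus[OF z'(1)] m0 by auto
      from combine_value[OF L_field this us vs(3)] obtain k where
        "combine (Ks' @ [\<ominus> z']) ?us \<noteq> \<zero>" "w (combine (Ks' @ [\<ominus> z']) ?us) = w k" "w k \<le> w (\<ominus> z')"
        using m0 by auto
      then show ?thesis unfolding main[OF z'(1)] using center_carrier[OF z'(1)] by simp
    qed
    moreover have "e \<ominus> z \<in> ?E" using inE[of \<zero>] ez c vsc by (simp add: a_minus_def)
    ultimately show ?thesis using z by blast
  qed
  then obtain zc where zc: "\<And>e. e \<in> ?E \<Longrightarrow> zc e \<in> Z" "\<And>e. e \<in> ?E \<Longrightarrow> e \<ominus> zc e \<in> ?E"
    "\<And>e z'. e \<in> ?E \<Longrightarrow> z' \<in> Z \<Longrightarrow> e \<ominus> zc e \<ominus> z' \<in> ?E"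
    "\<And>e z'. e \<in> ?E \<Longrightarrow> z' \<in> Z \<Longrightarrow> z' \<noteq> \<zero> \<Longrightarrow> e \<ominus> zc e \<ominus> z' \<noteq> \<zero> \<and> w (e \<ominus> zc e \<ominus> z') \<le> w z'"
    by metis
  have EV: "e \<in> carrier D \<and> (e \<noteq> \<zero> \<longrightarrow> (\<exists>z \<in> Z - {\<zero>}. w e = w z))" if "e \<in> ?E" for e
    by (rule Span_value[OF L_field us vs(3) that])
  have span: "\<exists>g. (\<forall>t \<in> set ts. g t \<in> Z \<and> (t \<in> S \<or> g t = \<zero>)) \<and> d = block_sum g ts" if d: "d \<in> B" for d
  proof -
    have dc: "d \<in> carrier D" using d B.B_carrier by blast
    from full[OF this] obtain f where f: "\<And>t. t \<in> set ts \<Longrightarrow> f t \<in> ?E" "d = block_sum f ts" by blast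
    \<comment> \<open>The component of \<open>d\<close> along the powers of \<open>y\<close> chosen
      as representatives. It lies in \<open>B\<close>, so the remainder \<open>d'\<close> does
      too.\<close>
    define g where "g t = (if t \<in> S then zc (f t) else \<zero>)" for t
    have gZ: "g t \<in> Z" "t \<in> S \<or> g t = \<zero>" if "t \<in> set ts" for t
      using zc(1)[OF f(1)[OF that]] by (auto simp: g_def)
    have gc: "g t \<in> carrier D" and fc: "f t \<in> carrier D" if "t \<in> set ts" for t
      using gZ(1)[OF that] center_carrier EV[OF f(1)[OF that]] by blast+
    define h where "h t = f t \<ominus> g t" for t
    have hE: "h t \<in> ?E" if "t \<in> set ts" for t
      using zc(2)[OF f(1)[OF that]] f(1)[OF that] EV[OF f(1)[OF that]] by (simp add: h_def g_def a_minus_def)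
    have hc: "h t \<in> carrier D" if "t \<in> set ts" for t using hE[OF that] EV by blast
    have bg: "block_sum g us \<in> B" if "set us \<subseteq> set ts" for us
      using that
    proof (induction us)
      case (Cons u us)
      then have u: "u \<in> set ts" by simp
      have "g u \<otimes> u \<in> B"
      proof (cases "u \<in> S")
        case True
        then show ?thesis using gZ(1)[OF u] B.center_subset S(2) by (intro B.B_mult) auto
      next
        case False
        then show ?thesis using gZ(2)[OF u] u tsc by auto
      qed
      then show ?case using Cons by (simp add: B.B_add)
    qed simp
    define d' where "d' = d \<ominus> block_sum g ts"
    have d'B: "d' \<in> B" unfolding d'_def using d bg by (intro B.B_diff) auto
    then have d'c: "d' \<in> carrier D" using B.B_carrier by blast
    have d'h: "d' = block_sum h ts"
      unfolding d'_def f(2) h_def using fc gc tsc by (intro block_sum_diff[symmetric]) auto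
    have "d' = \<zero>"
    proof (rule ccontr)
      assume d'0: "d' \<noteq> \<zero>"
      then obtain t where t: "t \<in> set ts" "d' \<asymp> t" "(\<exists>s \<in> S. d' \<asymp> s) \<longrightarrow> t \<in> S"
        using ts(5)[of d'] d'c by blast
      have tS: "t \<in> S" using cyc[OF d'B d'0] t(3) unfolding S_def by blast
      then have tB: "t \<in> B" and t0: "t \<noteq> \<zero>" and tc: "t \<in> carrier D" using S by blast+
      obtain z where z: "z \<in> Z" "z \<noteq> \<zero>" "w d' = w z + w t" using t(2) unfolding val_equiv_def by blast
      have zc': "z \<in> carrier D" and zB: "z \<in> B" using z center_carrier B.center_subset by blast+
      have zt: "z \<otimes> t \<in> carrier D" "z \<otimes> t \<noteq> \<zero>" "z \<otimes> t \<in> B" using zc' z tc t0 zB tB B.B_mult by auto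
      \<comment> \<open>\<open>d'\<close> has the value of \<open>z \<otimes> t\<close>, so
        \<open>u\<close> is a unit in \<open>B\<close>. Residues of \<open>B\<close> lie in
        \<open>K\<close>, so \<open>u\<close> has the residue of a central \<open>z1\<close>, and
        \<open>u \<ominus> z1\<close> lies in \<open>M\<close>.\<close>
      define u where "u = d' \<otimes> inv (z \<otimes> t)"
      have uB: "u \<in> B" unfolding u_def by (rule B.B_mult[OF d'B B.B_inv[OF zt(3,2)]])
      have u0: "u \<in> carrier D" "u \<noteq> \<zero>" "w u = 0"
        unfolding u_def using d'c d'0 zt z tc t0 zc' by auto
      have uV: "u \<in> V" using u0 by (intro unit_V)
      have d'u: "d' = u \<otimes> (z \<otimes> t)" unfolding u_def using d'c zt by simp
      obtain z1 where z1: "z1 \<in> Z" "z1 \<in> V" "res u = res z1"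
        using resK[OF uB uV] by (auto simp: residue_center_def)
      have "res u \<noteq> \<zero>\<^bsub>L\<^esub>" using u0 res_nonzero_iff[OF uV] by blast
      then have z10: "z1 \<noteq> \<zero>" "w z1 = 0" using z1 res_nonzero_iff[OF z1(2)] by auto
      have z1c: "z1 \<in> carrier D" using z1 center_carrier by blast
      define z' where "z' = z1 \<otimes> z"
      have z': "z' \<in> Z" "z' \<noteq> \<zero>" "w z' = w z" "z' \<in> carrier D"
        using z z1 z10 z1c zc' Z_mult by (auto simp: z'_def)
      have diff: "d' \<ominus> z' \<otimes> t = (u \<ominus> z1) \<otimes> (z \<otimes> t)"
        unfolding z'_def d'u using u0 z1c zc' tc by (simp add: a_minus_def l_distr l_minus m_assoc)
      \<comment> \<open>Subtracting \<open>z' \<otimes> t\<close> changes only the block at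
        \<open>t\<close>, where \<open>h t\<close> has no component along \<open>\<one>\<close>. So
        the value of that block is at most \<open>w z'\<close>, against the gain in value just
        obtained from \<open>u \<ominus> z1\<close>.\<close>
      define f' where "f' s = h s \<ominus> (if s = t then z' else \<zero>)" for s
      have f'E: "f' s \<in> ?E" if "s \<in> set ts" for s
      proof (cases "s = t")
        case True
        then show ?thesis using zc(3)[OF f(1)[OF that] z'(1)] tS by (simp add: f'_def h_def g_def)
      next
        case False
        then show ?thesis using hE[OF that] hc[OF that] by (simp add: f'_def a_minus_def)
      qed
      have f't: "f' t \<noteq> \<zero>" "w (f' t) \<le> w z'"
        using zc(4)[OF f(1)[OF t(1)] z'(1,2)] tS by (auto simp: f'_def h_def g_def)
      have "block_sum f' ts = block_sum h ts \<ominus> block_sum (\<lambda>s. if s = t then z' else \<zero>) ts"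
        unfolding f'_def using hc z' tsc by (intro block_sum_diff) auto
      also have "block_sum (\<lambda>s. if s = t then z' else \<zero>) ts = z' \<otimes> t"
        using ts(1) t(1) tsc z' by (intro block_sum_single)
      finally have bs: "block_sum f' ts = (u \<ominus> z1) \<otimes> (z \<otimes> t)" unfolding d'h[symmetric] diff .
      have "\<forall>s\<in>set ts. f' s \<in> carrier D \<and> (f' s \<noteq> \<zero> \<longrightarrow> (\<exists>z \<in> Z - {\<zero>}. w (f' s) = w z))"
        using f'E EV by blast
      from block_sum_value[OF ts(1,3,4) this] t(1) f't(1)
      have b0: "block_sum f' ts \<noteq> \<zero>" and b1: "w (block_sum f' ts) \<le> w (f' t \<otimes> t)" by blast+
      have f'c: "f' t \<in> carrier D" using f'E[OF t(1)] EV by blast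
      have "w (block_sum f' ts) \<le> w z + w t"
        using b1 f't f'c tc t0 z'(3) by (simp add: order_trans[OF b1])
      moreover have "u \<ominus> z1 \<in> M" using res_eq_iff[OF uV z1(2)] z1(3) by blast
      moreover have "u \<ominus> z1 \<noteq> \<zero>" using b0 bs zt by auto
      ultimately have "w (u \<ominus> z1) + w (z \<otimes> t) \<le> w z + w t" "0 < w (u \<ominus> z1)"
        unfolding bs using zt u0 z1c by (auto simp: valuation_ideal_def)
      then show False using zc' z tc t0 by simp
    qed
    then have "d = block_sum g ts"
      unfolding d'_def using dc block_sum_closed[of ts g] gc tsc by simp
    then show ?thesis using gZ by blast
  qed
  have commute: "block_sum g us \<otimes> a = a \<otimes> block_sum g us"
    if "set us \<subseteq> set ts" "\<And>t. t \<in> set ts \<Longrightarrow> g t \<in> Z \<and> (t \<in> S \<or> g t = \<zero>)" "a \<in> carrier D"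
      "\<And>s. s \<in> S \<Longrightarrow> s \<otimes> a = a \<otimes> s" for us g a
    using that(1)
  proof (induction us)
    case (Cons u us)
    have u: "u \<in> set ts" using Cons.prems by simp
    have uc: "u \<in> carrier D" and gu: "g u \<in> carrier D" using u tsc that(2)[OF u] center_carrier by blast+
    have "block_sum g us \<in> carrier D"
      using Cons.prems that(2) center_carrier tsc by (intro block_sum_closed) auto
    moreover have "g u \<otimes> u \<otimes> a = a \<otimes> (g u \<otimes> u)"
    proof (cases "u \<in> S")
      case True
      have "g u \<otimes> u \<otimes> a = g u \<otimes> (a \<otimes> u)" using m_assoc[OF gu uc that(3)] that(4)[OF True] by simp
      also have "\<dots> = a \<otimes> (g u \<otimes> u)"
        using that(2)[OF u] that(3) uc by (intro center_mult_lcomm[symmetric]) auto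
      finally show ?thesis .
    next
      case False
      then show ?thesis using that(2)[OF u] that(3) uc by auto
    qed
    ultimately show ?case using Cons uc gu that(3) by (simp add: l_distr r_distr)
  qed (use that(3) in simp)
  have all: "b \<otimes> a = a \<otimes> b" if b: "b \<in> B" and a: "a \<in> carrier D" and c: "\<And>s. s \<in> S \<Longrightarrow> s \<otimes> a = a \<otimes> s" for a b
  proof -
    obtain g where g: "\<And>t. t \<in> set ts \<Longrightarrow> g t \<in> Z \<and> (t \<in> S \<or> g t = \<zero>)" "b = block_sum g ts"
      using span[OF b] by blast
    show ?thesis unfolding g(2) using g(1) a c by (intro commute) auto
  qed
  have "s \<otimes> s' = s' \<otimes> s" if "s \<in> S" "s' \<in> S" for s s'
    using that yc by (auto simp: S_def nat_pow_mult add.commute)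
  \<comment> \<open>The spanning argument is used twice: powers of \<open>y\<close> commute with
    each other, so \<open>x'\<close> commutes with them, and therefore \<open>x\<close> commutes
    with \<open>x'\<close>.\<close>
  then have "x' \<otimes> s = s \<otimes> x'" if "s \<in> S" for s
    using all[OF x(2), of s] that S(1) by blast
  then show ?thesis using all[OF x(1), of x'] x(2) B.B_carrier by metis
qed

end

section \<open>Powers in the group of value classes\<close>

context semi_ramified_division_algebra
begin

lemma nonzero_pow: "x \<in> nonzero \<Longrightarrow> x [^] (n::nat) \<in> nonzero"
  by simp

text \<open>Lagrange's theorem in the quotient \<open>\<Gamma>\<^sub>D/\<Gamma>\<^sub>F\<close>, a
  group of order \<open>deg\<close>.\<close>

lemma val_pow_deg:
  assumes x: "x \<in> nonzero" shows "x [^] deg \<asymp> \<one>"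
proof -
  let ?G = "value_group D w" and ?H = "w ` (Z - {\<zero>})"
  have G: "comm_group ?G"
  proof (rule comm_groupI)
    show "x \<otimes>\<^bsub>?G\<^esub> y \<in> carrier ?G" if xy: "x \<in> carrier ?G" "y \<in> carrier ?G" for x y
    proof -
      obtain a b where ab: "a \<in> nonzero" "b \<in> nonzero" "x = w a" "y = w b" using xy by (auto simp: value_group_def)
      then have "x + y = w (a \<otimes> b)" "a \<otimes> b \<in> nonzero" by auto
      then show ?thesis by (auto simp: value_group_def)
    qed
    show "\<one>\<^bsub>?G\<^esub> \<in> carrier ?G" by (auto simp: value_group_def intro!: image_eqI[of _ _ \<one>])
    show "\<exists>y\<in>carrier ?G. y \<otimes>\<^bsub>?G\<^esub> x = \<one>\<^bsub>?G\<^esub>" if x: "x \<in> carrier ?G" for x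
    proof -
      obtain a where a: "a \<in> nonzero" "x = w a" using x by (auto simp: value_group_def)
      then have "w (inv a) \<in> carrier ?G" "w (inv a) + x = 0" by (auto simp: value_group_def simp del: val_inv) simp
      then show ?thesis by (auto simp: value_group_def)
    qed
  qed (auto simp: value_group_def add_ac)
  interpret G: comm_group ?G by (rule G)
  have H: "subgroup ?H ?G"
  proof (rule G.subgroupI)
    show "?H \<subseteq> carrier ?G" using center_carrier by (auto simp: value_group_def)
    show "?H \<noteq> {}" using center_zero_one(2) one_neq_zero by blast
    show "inv\<^bsub>?G\<^esub> a \<in> ?H" if a: "a \<in> ?H" for a
    proof -
      obtain z where z: "z \<in> Z" "z \<noteq> \<zero>" "a = w z" using a by blast
      have zc: "z \<in> carrier D" using z center_carrier by blast
      have "inv\<^bsub>?G\<^esub> a = w (inv z)"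
        using z zc by (intro G.inv_equality) (auto simp: value_group_def intro: image_eqI[of _ _ "inv z"])
      moreover have "inv z \<in> Z - {\<zero>}" using z zc center_inv_mem by simp
      ultimately show ?thesis by blast
    qed
    show "a \<otimes>\<^bsub>?G\<^esub> b \<in> ?H" if ab: "a \<in> ?H" "b \<in> ?H" for a b
    proof -
      obtain y z where yz: "y \<in> Z" "y \<noteq> \<zero>" "a = w y" "z \<in> Z" "z \<noteq> \<zero>" "b = w z" using ab by blast
      have "a \<otimes>\<^bsub>?G\<^esub> b = w (y \<otimes> z)" using yz center_carrier by (simp add: value_group_def)
      moreover have "y \<otimes> z \<in> Z - {\<zero>}" using yz center_carrier Z_mult by simp
      ultimately show ?thesis by blast
    qed
  qed
  interpret N: normal ?H ?G by (rule G.subgroup_imp_normal[OF H])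
  interpret Q: group "?G Mod ?H" by (rule N.factorgroup_is_group)
  have wc: "w x \<in> carrier ?G" if "x \<in> nonzero" for x using that by (auto simp: value_group_def)
  have car: "carrier (?G Mod ?H) = value_coset ` nonzero"
    by (simp add: FactGroup_def rcosets_value_group)
  have pow: "value_coset x [^]\<^bsub>?G Mod ?H\<^esub> (n::nat) = value_coset (x [^] n)" for n
  proof (induction n)
    case 0
    have "?H #>\<^bsub>?G\<^esub> \<one>\<^bsub>?G\<^esub> = ?H" using G.coset_mult_one[OF N.subset] .
    then show ?case by (simp add: FactGroup_def value_coset_def) (simp add: value_group_def)
  next
    case (Suc n)
    have "value_coset (x [^] n) <#>\<^bsub>?G\<^esub> value_coset x = ?H #>\<^bsub>?G\<^esub> (w (x [^] n) \<otimes>\<^bsub>?G\<^esub> w x)"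
      unfolding value_coset_def using x by (intro N.rcos_sum wc) auto
    also have "w (x [^] n) \<otimes>\<^bsub>?G\<^esub> w x = w (x [^] Suc n)" using x by (simp add: value_group_def)
    finally show ?case using Suc by (simp add: FactGroup_def value_coset_def)
  qed
  have "value_coset x \<in> carrier (?G Mod ?H)" unfolding car using x by blast
  then have "value_coset x [^]\<^bsub>?G Mod ?H\<^esub> order (?G Mod ?H) = \<one>\<^bsub>?G Mod ?H\<^esub>" by (rule Q.pow_order_eq_1)
  moreover have "order (?G Mod ?H) = deg" by (simp add: order_def car card_value_cosets(1))
  moreover have "\<one>\<^bsub>?G Mod ?H\<^esub> = value_coset \<one>" using pow[of 0] by simp
  ultimately have "value_coset (x [^] deg) = value_coset \<one>" using pow[of deg] by simp
  then show ?thesis using value_coset_eq_iff[of "x [^] deg" \<one>] x by simp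
qed

text \<open>By Bezout the class of \<open>z\<close> raised to \<open>gcd i deg\<close> is a power of
  the class of \<open>z [^] i\<close>, because \<open>deg\<close> annihilates all classes. For
  \<open>i = 0\<close> the gcd is \<open>deg\<close> and the class is trivial.\<close>

lemma pow_comparable_aux:
  assumes z: "z \<in> nonzero" and dv: "gcd i deg dvd j"
  shows "\<exists>s::nat. z [^] j \<asymp> (z [^] i) [^] s"
proof -
  obtain t where t: "j = gcd i deg * t" using dv by (auto elim: dvdE)
  have "\<exists>x y. i * x = deg * y + gcd i deg \<or> i = 0"
    using bezout_nat[of i deg] by blast
  then obtain x y where "i = 0 \<or> i * x = deg * y + gcd i deg" by blast
  then show ?thesis
  proof
    assume "i = 0"
    then have "z [^] j = (z [^] deg) [^] t" using t z by (simp add: nat_pow_pow)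
    also have "\<dots> \<asymp> \<one> [^] t" using val_pow_deg[OF z] z by (intro val_equiv_pow) auto
    finally show ?thesis using \<open>i = 0\<close> by simp
  next
    assume eq: "i * x = deg * y + gcd i deg"
    have "z [^] (i * x) = (z [^] deg) [^] y \<otimes> z [^] gcd i deg"
      unfolding eq using z by (simp add: nat_pow_pow nat_pow_mult)
    moreover have "(z [^] deg) [^] y \<asymp> \<one> [^] y"
      using val_pow_deg[OF z] z by (intro val_equiv_pow) auto
    ultimately have "z [^] (i * x) \<asymp> \<one> \<otimes> z [^] gcd i deg"
      using z val_equiv_mult[of "(z [^] deg) [^] y" \<one> "z [^] gcd i deg" "z [^] gcd i deg"] by simp
    then have "z [^] gcd i deg \<asymp> z [^] (i * x)" using z val_equiv_sym by simp
    then have "(z [^] gcd i deg) [^] t \<asymp> (z [^] (i * x)) [^] t" using z by (intro val_equiv_pow) auto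
    then show ?thesis unfolding t using z by (auto simp: nat_pow_pow mult.assoc)
  qed
qed

text \<open>The divisors of a prime power are ordered by divisibility, so one of the two gcds with
  \<open>deg\<close> divides the other: the subgroups of a cyclic \<open>p\<close>-group form a
  chain.\<close>

lemma pow_comparable:
  assumes z: "z \<in> nonzero" and p: "Factorial_Ring.prime p" "deg = p ^ k"
  shows "(\<exists>s::nat. z [^] (i::nat) \<asymp> (z [^] (j::nat)) [^] s) \<or> (\<exists>s::nat. z [^] j \<asymp> (z [^] i) [^] s)"
proof -
  obtain a b where ab: "gcd i deg = p ^ a" "gcd j deg = p ^ b"
    using divides_primepow_nat[OF p(1)] p(2) by (metis gcd_dvd2)
  consider "a \<le> b" | "b \<le> a" by linarith
  then show ?thesis
  proof cases
    case 1
    then have "gcd i deg dvd gcd j deg" unfolding ab by (rule le_imp_power_dvd)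
    then have "gcd i deg dvd j" by (meson dvd_trans gcd_dvd1)
    then show ?thesis using pow_comparable_aux[OF z] by blast
  next
    case 2
    then have "gcd j deg dvd gcd i deg" unfolding ab by (rule le_imp_power_dvd)
    then have "gcd j deg dvd i" by (meson dvd_trans gcd_dvd1)
    then show ?thesis using pow_comparable_aux[OF z] by blast
  qed
qed

section \<open>The homomorphism to the Galois group\<close>

abbreviation G where "G \<equiv> residue_galois_group D w"

lemma group_G: "group G"
  using K_subfield[OF L_field] subfieldE(3) by (intro group_galois_group L_ring) blast

lemma G_mult:
  "s \<in> carrier G \<Longrightarrow> t \<in> carrier G \<Longrightarrow> s \<otimes>\<^bsub>G\<^esub> t = compose (carrier L) s t"
  by (simp add: galois_group_def BijGroup_def)

lemma residue_conj_G:
  assumes x: "x \<in> nonzero" shows "residue_conj x \<in> carrier G"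
proof -
  have ix: "inv x \<in> nonzero" using x by simp
  have "bij_betw (residue_conj x) (carrier L) (carrier L)"
  proof (rule bij_betw_byWitness[where f' = "residue_conj (inv x)"])
    show "\<forall>l\<in>carrier L. residue_conj (inv x) (residue_conj x l) = l"
      using residue_conj_mult[OF ix x] residue_conj_one x by simp
    show "\<forall>l\<in>carrier L. residue_conj x (residue_conj (inv x) l) = l"
      using residue_conj_mult[OF x ix] residue_conj_one x by simp
  qed (use residue_conj_closed x ix in blast)+
  then have "residue_conj x \<in> Bij (carrier L)"
    by (auto simp: Bij_def residue_conj_def)
  moreover have "residue_conj x l = l" if l: "l \<in> K" for l
  proof -
    obtain z where z: "z \<in> Z" "z \<in> V" "l = res z" using l by (auto simp: residue_center_def)
    have "x \<otimes> z \<otimes> inv x = z" using center_comm[OF z(1), of x, symmetric] center_carrier[OF z(1)] x by simp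
    then show ?thesis unfolding z(3) using residue_conj_res[OF x z(2)] by simp
  qed
  ultimately show ?thesis using residue_conj_hom[OF x] by (simp add: galois_group_def)
qed

lemma residue_conj_mult_G:
  assumes "x \<in> nonzero" "y \<in> nonzero"
  shows "residue_conj (x \<otimes> y) = residue_conj x \<otimes>\<^bsub>G\<^esub> residue_conj y"
proof
  fix l
  show "residue_conj (x \<otimes> y) l = (residue_conj x \<otimes>\<^bsub>G\<^esub> residue_conj y) l"
  proof (cases "l \<in> carrier L")
    case True
    then show ?thesis
      unfolding G_mult[OF residue_conj_G[OF assms(1)] residue_conj_G[OF assms(2)]]
      using residue_conj_mult[OF assms True] by (simp add: compose_def)
  next
    case False
    then show ?thesis
      unfolding G_mult[OF residue_conj_G[OF assms(1)] residue_conj_G[OF assms(2)]]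
      by (simp add: compose_def residue_conj_def)
  qed
qed

lemma residue_conj_one_G: "residue_conj \<one> = \<one>\<^bsub>G\<^esub>"
proof
  fix l show "residue_conj \<one> l = \<one>\<^bsub>G\<^esub> l"
    using residue_conj_one[of l]
    by (cases "l \<in> carrier L") (auto simp: galois_group_def BijGroup_def residue_conj_def)
qed

lemma residue_conj_pow_G:
  "x \<in> nonzero \<Longrightarrow> residue_conj (x [^] (n::nat)) = residue_conj x [^]\<^bsub>G\<^esub> n"
  by (induction n) (auto simp: residue_conj_one_G residue_conj_mult_G)

lemma residue_conj_torsion:
  assumes "x \<in> nonzero" shows "residue_conj x [^]\<^bsub>G\<^esub> deg = \<one>\<^bsub>G\<^esub>"
proof -
  have "residue_conj (x [^] deg) = residue_conj \<one>"
    using assms val_pow_deg by (intro residue_conj_cong) auto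
  then show ?thesis using residue_conj_pow_G[OF assms] residue_conj_one_G by simp
qed

section \<open>Lifts of a basis of the Galois group, and commuting elements\<close>

context
  fixes r \<sigma> \<pi>
  assumes lift: "galois_lift D w r \<sigma> \<pi>"
begin

lemma pi_nonzero: "i < r \<Longrightarrow> \<pi> i \<in> nonzero"
  using lift by (auto simp: galois_lift_def)

lemma sigma_eq:
  assumes i: "i < r" shows "\<sigma> i = residue_conj (\<pi> i)"
proof
  fix l
  have "\<sigma> i \<in> carrier G" using lift i by (auto simp: galois_lift_def group_basis_def)
  then have ext: "\<sigma> i \<in> extensional (carrier L)" by (auto simp: galois_group_def Bij_def)
  show "\<sigma> i l = residue_conj (\<pi> i) l"
  proof (cases "l \<in> carrier L")
    case True
    then obtain d where d: "d \<in> V" "l = res d" using L_carrier by auto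
    then have "\<sigma> i l = res (\<pi> i \<otimes> d \<otimes> inv \<pi> i)" using lift i by (auto simp: galois_lift_def)
    then show ?thesis using residue_conj_res[OF pi_nonzero[OF i] d(1)] d(2) by simp
  qed (use ext in \<open>simp add: extensional_def residue_conj_def\<close>)
qed

lemma ordered_power_sigma:
  "k \<le> r \<Longrightarrow> ordered_power D \<pi> m k \<in> nonzero \<and>
    ordered_power G \<sigma> m k = residue_conj (ordered_power D \<pi> m k)"
proof (induction k)
  case (Suc k)
  then have k: "k < r" by simp
  have "\<pi> k [^] m k \<in> nonzero" using pi_nonzero[OF k] by simp
  then show ?case
    using Suc pi_nonzero[OF k] sigma_eq[OF k] residue_conj_pow_G[OF pi_nonzero[OF k]]
    by (simp add: residue_conj_mult_G)
qed (simp add: residue_conj_one_G)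

text \<open>The basis generates the group, and torsion makes natural exponents sufficient, so every
  automorphism is conjugation by a monomial in the \<open>\<pi> i\<close>, the form that
  \<open>degenerate\<close> refers to.\<close>

lemma galois_surj:
  assumes "s \<in> carrier G"
  shows "\<exists>m. s = residue_conj (ordered_power D \<pi> m r)"
proof -
  have "\<exists>m. s = ordered_power G \<sigma> m r"
  proof (rule group_basis_ordered_power[OF group_G _ _ deg_pos assms])
    show "group_basis G r \<sigma>" using lift by (simp add: galois_lift_def)
    show "\<sigma> i [^]\<^bsub>G\<^esub> deg = \<one>\<^bsub>G\<^esub>" if "i < r" for i
      unfolding sigma_eq[OF that] by (rule residue_conj_torsion[OF pi_nonzero[OF that]])
  qed
  then show ?thesis using ordered_power_sigma[OF order_refl] by auto
qed

lemma res_inv: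
  assumes "u \<in> nonzero" "w u = 0" shows "inv\<^bsub>L\<^esub> (res u) = res (inv u)"
proof -
  interpret L: field L by (rule L_field)
  have V: "u \<in> V" "inv u \<in> V" using assms by (auto intro: unit_V)
  have "res u \<otimes>\<^bsub>L\<^esub> res (inv u) = \<one>\<^bsub>L\<^esub>" using res_mult[OF V] assms res_one by simp
  then show ?thesis using V res_closed by (intro L.comm_inv_char) auto
qed

text \<open>
  If \<open>x = z u \<pi>\<^sup>m\<close> and \<open>y = z' u' \<pi>\<^sup>n\<close> commute, with \<open>z\<close>, \<open>z'\<close> central and \<open>u\<close>, \<open>u'\<close> units, then the
  commutator of \<open>\<pi>\<^sup>m\<close> and \<open>\<pi>\<^sup>n\<close> is a coboundary in the sense of degeneracy.
\<close>

lemma commuting_cyclic: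
  assumes nd: "\<not> degenerate D w r \<sigma> \<pi>"
    and x: "x \<in> nonzero" and y: "y \<in> nonzero" and comm: "x \<otimes> y = y \<otimes> x"
  shows "cyclic_group (subgroup_generated G {residue_conj x, residue_conj y})"
proof (rule ccontr)
  assume nc: "\<not> cyclic_group (subgroup_generated G {residue_conj x, residue_conj y})"
  interpret L: field L by (rule L_field)
  obtain m n where mn: "residue_conj x = residue_conj (ordered_power D \<pi> m r)"
      "residue_conj y = residue_conj (ordered_power D \<pi> n r)"
    using galois_surj residue_conj_G x y by metis
  define P where "P = ordered_power D \<pi> m r"
  define Q where "Q = ordered_power D \<pi> n r"
  have P: "P \<in> nonzero" "ordered_power G \<sigma> m r = residue_conj P" "x \<asymp> P"
    and Q: "Q \<in> nonzero" "ordered_power G \<sigma> n r = residue_conj Q" "y \<asymp> Q"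
    using ordered_power_sigma[OF order_refl] mn x y residue_conj_inj unfolding P_def Q_def by blast+
  obtain z u where zu: "z \<in> Z" "z \<noteq> \<zero>" "u \<in> nonzero" "w u = 0" "x = z \<otimes> u \<otimes> P"
    using val_equiv_unit_factor[OF P(3) x P(1)] by blast
  obtain z' u' where zu': "z' \<in> Z" "z' \<noteq> \<zero>" "u' \<in> nonzero" "w u' = 0" "y = z' \<otimes> u' \<otimes> Q"
    using val_equiv_unit_factor[OF Q(3) y Q(1)] by blast
  have c: "P \<in> carrier D" "P \<noteq> \<zero>" "Q \<in> carrier D" "Q \<noteq> \<zero>" "u \<in> carrier D" "u \<noteq> \<zero>"
      "u' \<in> carrier D" "u' \<noteq> \<zero>" "z \<in> carrier D" "z' \<in> carrier D"
    using P Q zu zu' center_carrier by auto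
  define a where "a = u \<otimes> P"
  define b where "b = u' \<otimes> Q"
  have ab: "a \<in> carrier D" "a \<noteq> \<zero>" "b \<in> carrier D" "b \<noteq> \<zero>" using c by (auto simp: a_def b_def)
  have xy: "x = z \<otimes> a" "y = z' \<otimes> b" using zu(5) zu'(5) c by (simp_all add: a_def b_def m_assoc)
  have "z \<otimes> z' \<otimes> (a \<otimes> b) = x \<otimes> y"
    unfolding xy using center_mult_lcomm[OF zu'(1), of a b] ab c by (simp add: m_assoc)
  also have "\<dots> = z \<otimes> z' \<otimes> (b \<otimes> a)"
    unfolding comm unfolding xy
    using center_mult_lcomm[OF zu(1), of b a] center_comm[OF zu(1), of z'] ab c by (simp flip: m_assoc) (simp add: m_assoc)
  finally have "inv (z \<otimes> z') \<otimes> (z \<otimes> z' \<otimes> (a \<otimes> b)) = inv (z \<otimes> z') \<otimes> (z \<otimes> z' \<otimes> (b \<otimes> a))" by simp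
  then have abc: "a \<otimes> b = b \<otimes> a" using c zu(2) zu'(2) ab by (simp del: m_assoc)
  \<comment> \<open>\<open>up\<close> and \<open>uq\<close> are \<open>u'\<close> and
    \<open>u\<close> after passing across \<open>P\<close> and \<open>Q\<close>. With them
    \<open>a \<otimes> b = b \<otimes> a\<close> expresses the commutator of \<open>P\<close> and
    \<open>Q\<close> by units of the valuation ring alone.\<close>
  define up where "up = P \<otimes> u' \<otimes> inv P"
  define uq where "uq = Q \<otimes> u \<otimes> inv Q"
  have up: "up \<in> carrier D" "up \<noteq> \<zero>" and uq: "uq \<in> carrier D" "uq \<noteq> \<zero>"
    using c by (auto simp: up_def uq_def)
  have 1: "a \<otimes> b = u \<otimes> up \<otimes> (P \<otimes> Q)" using c by (simp add: a_def b_def up_def m_assoc)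
  have 2: "b \<otimes> a = u' \<otimes> uq \<otimes> (Q \<otimes> P)" using c by (simp add: a_def b_def uq_def m_assoc)
  have "P \<otimes> Q = inv (u \<otimes> up) \<otimes> (u \<otimes> up \<otimes> (P \<otimes> Q))" using c up by simp
  also have "\<dots> = inv up \<otimes> inv u \<otimes> (u' \<otimes> uq \<otimes> (Q \<otimes> P))"
    unfolding 1[symmetric] abc 2 using c up by (simp add: inv_mult)
  finally have PQ: "P \<otimes> Q = inv up \<otimes> inv u \<otimes> (u' \<otimes> uq \<otimes> (Q \<otimes> P))" .
  have "P \<otimes> Q \<otimes> inv P \<otimes> inv Q = P \<otimes> Q \<otimes> inv (Q \<otimes> P)" using c by (simp add: inv_mult m_assoc)
  also have "\<dots> = inv up \<otimes> inv u \<otimes> (u' \<otimes> uq)"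
    unfolding PQ using c up uq by (simp add: m_assoc inv_mult)
  finally have C: "P \<otimes> Q \<otimes> inv P \<otimes> inv Q = inv up \<otimes> inv u \<otimes> (u' \<otimes> uq)" .
  have iup: "inv up = P \<otimes> inv u' \<otimes> inv P" unfolding up_def using c by (simp add: inv_mult m_assoc)
  have units: "u \<in> V" "inv u \<in> V" "u' \<in> V" "inv u' \<in> V" "uq \<in> V" "inv up \<in> V"
    using c zu(4) zu'(4) unfolding uq_def iup by (auto intro!: unit_V)
  \<comment> \<open>In the commutator
    \<open>inv up \<otimes> inv u \<otimes> (u' \<otimes> uq)\<close> the residues of
    \<open>inv up\<close> and \<open>u'\<close> are \<open>\<sigma>\<^sup>m(\<alpha>)\<close> and
    \<open>\<alpha>\<^sup>-\<^sup>1\<close>, and those of \<open>uq\<close> and \<open>inv u\<close>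
    are \<open>\<sigma>\<^sup>n(\<beta>)\<close> and \<open>\<beta>\<^sup>-\<^sup>1\<close>.\<close>
  define \<alpha> where "\<alpha> = res (inv u')"
  define \<beta> where "\<beta> = res u"
  have \<alpha>: "\<alpha> \<in> carrier L" "\<alpha> \<noteq> \<zero>\<^bsub>L\<^esub>" "inv\<^bsub>L\<^esub> \<alpha> = res u'" "residue_conj P \<alpha> = res (inv up)"
    using units c zu'(4) res_closed res_nonzero_iff[of "inv u'"] res_inv[of "inv u'"] residue_conj_res[OF P(1), of "inv u'"]
    by (auto simp: \<alpha>_def iup)
  have \<beta>: "\<beta> \<in> carrier L" "\<beta> \<noteq> \<zero>\<^bsub>L\<^esub>" "inv\<^bsub>L\<^esub> \<beta> = res (inv u)" "residue_conj Q \<beta> = res uq"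
    using units c zu(4) res_closed res_nonzero_iff[of u] res_inv[of u] residue_conj_res[OF Q(1), of u]
    by (auto simp: \<beta>_def uq_def)
  have "res (P \<otimes> Q \<otimes> inv P \<otimes> inv Q)
      = res (inv up) \<otimes>\<^bsub>L\<^esub> res (inv u) \<otimes>\<^bsub>L\<^esub> (res u' \<otimes>\<^bsub>L\<^esub> res uq)"
    unfolding C using units by (simp add: res_mult V_mult)
  also have "\<dots> = residue_conj P \<alpha> \<otimes>\<^bsub>L\<^esub> inv\<^bsub>L\<^esub> \<alpha> \<otimes>\<^bsub>L\<^esub> (residue_conj Q \<beta> \<otimes>\<^bsub>L\<^esub> inv\<^bsub>L\<^esub> \<beta>)"
    unfolding \<alpha>(3,4) \<beta>(3,4) using units res_closed by (simp add: L.m_ac)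
  finally have "degenerate D w r \<sigma> \<pi>"
    using nc \<alpha>(1,2) \<beta>(1,2) unfolding degenerate_def Let_def mn P(2)[symmetric] Q(2)[symmetric]
    unfolding P_def[symmetric] Q_def[symmetric] P(2)[symmetric] Q(2)[symmetric]
    unfolding P_def Q_def by blast
  then show False using nd by blast
qed

text \<open>A generator of the cyclic group is conjugation by some \<open>z\<close>. Injectivity of
  \<open>residue_conj\<close> transports this back to values: both classes are multiples of that of
  \<open>z\<close>, and such multiples are comparable.\<close>

lemma commuting_comparable:
  assumes nd: "\<not> degenerate D w r \<sigma> \<pi>" and p: "Factorial_Ring.prime p" "deg = p ^ k"
    and x: "x \<in> nonzero" and y: "y \<in> nonzero" and comm: "x \<otimes> y = y \<otimes> x"
  shows "(\<exists>s::nat. x \<asymp> y [^] s) \<or> (\<exists>s::nat. y \<asymp> x [^] s)"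
proof -
  interpret G: group G by (rule group_G)
  let ?S = "{residue_conj x, residue_conj y}"
  let ?H = "subgroup_generated G ?S"
  have S: "?S \<subseteq> carrier G" using residue_conj_G x y by blast
  interpret H: group ?H by (rule G.group_subgroup_generated)
  from commuting_cyclic[OF nd x y comm] obtain c where
    c: "c \<in> carrier ?H" "carrier ?H = range (\<lambda>n::int. c [^]\<^bsub>?H\<^esub> n)"
    unfolding H.cyclic_group by blast
  have cG: "c \<in> carrier G" using c(1) G.carrier_subgroup_generated_subset by blast
  then obtain z where z: "z \<in> nonzero" "c = residue_conj z"
    using galois_surj ordered_power_sigma[OF order_refl] by blast
  have exps: "\<exists>n::nat. u \<asymp> z [^] n" if u: "u \<in> nonzero" "residue_conj u \<in> ?S" for u
  proof -
    have "residue_conj u \<in> carrier ?H"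
      using G.subgroup_generated_subset_carrier_subset[OF S] u(2) by blast
    then obtain n :: int where "residue_conj u = c [^]\<^bsub>?H\<^esub> n" using c(2) by blast
    also have "c [^]\<^bsub>?H\<^esub> n = c [^]\<^bsub>G\<^esub> n"
      by (rule G.int_pow_subgroup_generated[OF c(1)])
    finally have "\<exists>n::nat. residue_conj u = c [^]\<^bsub>G\<^esub> n"
      using G.torsion_int_pow[OF cG _ deg_pos, of n] residue_conj_torsion[OF z(1)] z(2) by auto
    then obtain n :: nat where "residue_conj u = residue_conj (z [^] n)"
      using residue_conj_pow_G[OF z(1)] z(2) by auto
    then show ?thesis using residue_conj_inj[OF u(1) nonzero_pow[OF z(1)]] by blast
  qed
  obtain i j :: nat where ij: "x \<asymp> z [^] i" "y \<asymp> z [^] j" using exps[OF x] exps[OF y] by blast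
  have xi: "x [^] s \<asymp> (z [^] i) [^] s" and yj: "y [^] s \<asymp> (z [^] j) [^] s" for s :: nat
    using ij x y z nonzero_pow by (auto intro!: val_equiv_pow)
  from pow_comparable[OF z(1) p, of i j] show ?thesis
    using ij xi yj val_equiv_trans val_equiv_sym by meson
qed

end

text \<open>
  Conjugation by \<open>x \<in> A\<close> acts on the residue field of \<open>A\<close> like conjugation by some \<open>y \<in> B\<close>, hence trivially.
\<close>

lemma commutative_if_dominated:
  assumes A: "central_division_subring D A" and B: "central_division_subring D B"
    and comm: "\<And>x y. x \<in> A \<Longrightarrow> y \<in> B \<Longrightarrow> x \<otimes> y = y \<otimes> x"
    and dom: "\<And>x. \<lbrakk>x \<in> A; x \<noteq> \<zero>\<rbrakk> \<Longrightarrow> \<exists>y \<in> B - {\<zero>}. x \<asymp> y"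
    and cmp: "\<And>x x'. \<lbrakk>x \<in> A; x \<noteq> \<zero>; x' \<in> A; x' \<noteq> \<zero>\<rbrakk> \<Longrightarrow>
      (\<exists>s::nat. x \<asymp> x' [^] s) \<or> (\<exists>s::nat. x' \<asymp> x [^] s)"
    and x: "x \<in> A" "x' \<in> A"
  shows "x \<otimes> x' = x' \<otimes> x"
proof -
  interpret A: central_division_subring D A by (rule A)
  interpret B: central_division_subring D B by (rule B)
  \<comment> \<open>\<open>C y\<close> is the cyclic subgroup generated by the class of
    \<open>y\<close>; in a finite group natural exponents give all of it.\<close>
  define C where "C y = (\<lambda>n::nat. value_coset (y [^] n)) ` UNIV" for y
  have Cfin: "C y \<subseteq> value_coset ` nonzero" if "y \<in> nonzero" for y
    unfolding C_def using nonzero_pow[OF that] by blast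
  define N where "N = (\<lambda>y. card (C y)) ` (A - {\<zero>})"
  have "N \<subseteq> {..deg}"
  proof
    fix k assume "k \<in> N"
    then obtain y where y: "y \<in> A - {\<zero>}" "k = card (C y)" by (auto simp: N_def)
    then have "y \<in> nonzero" using A.B_carrier by blast
    then show "k \<in> {..deg}" using card_mono[OF card_value_cosets(2) Cfin] card_value_cosets(1) y(2) by simp
  qed
  then have fin: "finite N" using finite_subset by blast
  have ne: "N \<noteq> {}" using A.B_one one_neq_zero unfolding N_def by blast
  have "\<exists>y\<in>A - {\<zero>}. k = card (C y)" if "k \<in> N" for k using that unfolding N_def by blast
  \<comment> \<open>An element of \<open>A\<close> whose class generates a largest cyclic subgroup.
    Pairwise comparability then makes every class of \<open>A\<close> a multiple of it.\<close>
  from this[OF Max_in[OF fin ne]]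
  obtain y where "y \<in> A - {\<zero>}" "Max N = card (C y)" by (rule bexE)
  then have y: "y \<in> A" "y \<noteq> \<zero>" "card (C y) = Max N" by simp_all
  have ync: "y \<in> nonzero" using y A.B_carrier by blast
  show ?thesis
  proof (rule commutative_if_cyclic_values[OF A _ y(1,2) _ x])
    show "\<exists>n::nat. u \<asymp> y [^] n" if u: "u \<in> A" "u \<noteq> \<zero>" for u
    proof -
      have unc: "u \<in> nonzero" using u A.B_carrier by blast
      from cmp[OF u y(1,2)] show ?thesis
      proof
        assume "\<exists>s::nat. y \<asymp> u [^] s"
        then obtain s :: nat where s: "y \<asymp> u [^] s" by blast
        have "C y \<subseteq> C u"
        proof
          fix c assume "c \<in> C y"
          then obtain n :: nat where n: "c = value_coset (y [^] n)" by (auto simp: C_def)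
          have "y [^] n \<asymp> (u [^] s) [^] n" using s ync nonzero_pow[OF unc] by (intro val_equiv_pow)
          then have "c = value_coset (u [^] (s * n))"
            unfolding n using value_coset_eq_iff[OF nonzero_pow[OF ync] nonzero_pow[OF unc]] unc by (simp add: nat_pow_pow)
          then show "c \<in> C u" by (auto simp: C_def)
        qed
        moreover have "finite (C u)" using Cfin[OF unc] card_value_cosets(2) finite_subset by blast
        moreover have "card (C u) \<le> card (C y)"
          unfolding y(3) using u by (intro Max_ge[OF fin]) (auto simp: N_def)
        ultimately have "C y = C u" by (intro card_seteq)
        moreover have "value_coset (u [^] (1::nat)) \<in> C u" unfolding C_def by (rule rangeI)
        ultimately have "value_coset u \<in> C y" using unc by simp
        then obtain n :: nat where "value_coset u = value_coset (y [^] n)" by (auto simp: C_def)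
        then show ?thesis using value_coset_eq_iff[OF unc nonzero_pow[OF ync]] by blast
      qed
    qed
    show "res d \<in> K" if d: "d \<in> A" "d \<in> V" for d
    proof (rule residue_mem_center[OF A d])
      fix u assume u: "u \<in> A" "u \<noteq> \<zero>"
      then obtain b where b: "b \<in> B" "b \<noteq> \<zero>" "u \<asymp> b" using dom by blast
      have c: "u \<in> nonzero" "b \<in> nonzero" "d \<in> carrier D" using u b d A.B_carrier B.B_carrier by auto
      have "res (u \<otimes> d \<otimes> inv u) = res (b \<otimes> d \<otimes> inv b)"
        by (rule res_conj_cong[OF L_field b(3) c(1,2) d(2)])
      also have "b \<otimes> d \<otimes> inv b = d" using comm[OF d(1) b(1), symmetric] c by simp
      finally show "res (u \<otimes> d \<otimes> inv u) = res d" .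
    qed
  qed
qed

text \<open>If some class of \<open>B\<close> is missed by \<open>A\<close>, comparability makes
  every class of \<open>A\<close> a multiple of it, so the classes of \<open>A\<close> lie in a
  cyclic group and are attained on \<open>B\<close>; the mirrored case is the same. Otherwise both
  attain the same classes, and two elements of \<open>A\<close> are compared by replacing one with
  an element of \<open>B\<close> of the same class.\<close>

lemma commuting_subrings_commutative:
  fixes \<sigma> :: "nat \<Rightarrow> 'a set \<Rightarrow> 'a set"
  assumes lift: "galois_lift D w r \<sigma> \<pi>" and nd: "\<not> degenerate D w r \<sigma> \<pi>"
    and p: "Factorial_Ring.prime p" "deg = p ^ k"
    and A: "central_division_subring D A" and B: "central_division_subring D B"
    and comm: "\<And>x y. x \<in> A \<Longrightarrow> y \<in> B \<Longrightarrow> x \<otimes> y = y \<otimes> x"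
  shows "(\<forall>x\<in>A. \<forall>y\<in>A. x \<otimes> y = y \<otimes> x) \<or> (\<forall>x\<in>B. \<forall>y\<in>B. x \<otimes> y = y \<otimes> x)"
proof -
  have one: "x \<otimes> x' = x' \<otimes> x"
    if A: "central_division_subring D A" and B: "central_division_subring D B"
      and comm: "\<And>x y. x \<in> A \<Longrightarrow> y \<in> B \<Longrightarrow> x \<otimes> y = y \<otimes> x"
      and b: "b \<in> B" "b \<noteq> \<zero>" "\<And>x. x \<in> A \<Longrightarrow> x \<noteq> \<zero> \<Longrightarrow> \<not> b \<asymp> x" and x: "x \<in> A" "x' \<in> A"
    for A B b x x'
  proof -
    interpret A: central_division_subring D A by (rule A)
    interpret B: central_division_subring D B by (rule B)
    have bn: "b \<in> nonzero" using b B.B_carrier by blast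
    have dom: "\<exists>s::nat. a \<asymp> b [^] s" if a: "a \<in> A" "a \<noteq> \<zero>" for a
    proof -
      have an: "a \<in> nonzero" using a A.B_carrier by blast
      have "\<not> b \<asymp> a [^] s" for s :: nat using b(3)[OF A.B_pow[OF a(1)]] an by simp
      then show ?thesis using commuting_comparable[OF lift nd p an bn comm[OF a(1) b(1)]] by blast
    qed
    show ?thesis
    proof (rule commutative_if_dominated[OF A B comm _ _ x])
      show "\<exists>y \<in> B - {\<zero>}. a \<asymp> y" if "a \<in> A" "a \<noteq> \<zero>" for a
        using dom[OF that] B.B_pow[OF b(1)] nonzero_pow[OF bn] by blast
      show "(\<exists>s::nat. a \<asymp> a' [^] s) \<or> (\<exists>s::nat. a' \<asymp> a [^] s)"
        if a: "a \<in> A" "a \<noteq> \<zero>" "a' \<in> A" "a' \<noteq> \<zero>" for a a'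
      proof -
        obtain i j :: nat where ij: "a \<asymp> b [^] i" "a' \<asymp> b [^] j" using dom a by meson
        have an: "a \<in> nonzero" "a' \<in> nonzero" using a A.B_carrier by auto
        have "a [^] s \<asymp> (b [^] i) [^] s" "a' [^] s \<asymp> (b [^] j) [^] s" for s :: nat
          using ij an nonzero_pow[OF bn] by (auto intro!: val_equiv_pow)
        then show ?thesis
          using pow_comparable[OF bn p, of i j] ij val_equiv_trans val_equiv_sym by meson
      qed
    qed
  qed
  interpret A: central_division_subring D A by (rule A)
  interpret B: central_division_subring D B by (rule B)
  consider (b) b where "b \<in> B" "b \<noteq> \<zero>" "\<And>x. x \<in> A \<Longrightarrow> x \<noteq> \<zero> \<Longrightarrow> \<not> b \<asymp> x"
    | (a) a where "a \<in> A" "a \<noteq> \<zero>" "\<And>x. x \<in> B \<Longrightarrow> x \<noteq> \<zero> \<Longrightarrow> \<not> a \<asymp> x"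
    | (c) "\<forall>b\<in>B - {\<zero>}. \<exists>x\<in>A - {\<zero>}. b \<asymp> x" "\<forall>a\<in>A - {\<zero>}. \<exists>x\<in>B - {\<zero>}. a \<asymp> x"
    by blast
  then show ?thesis
  proof cases
    case b
    then show ?thesis using one[OF A B comm b] by blast
  next
    case a
    then show ?thesis using one[OF B A comm[symmetric] a] by blast
  next
    case c
    have "x \<otimes> x' = x' \<otimes> x" if x: "x \<in> A" "x' \<in> A" for x x'
    proof (rule commutative_if_dominated[OF A B comm _ _ x])
      show "\<exists>y \<in> B - {\<zero>}. a \<asymp> y" if "a \<in> A" "a \<noteq> \<zero>" for a using c(2) that by blast
      show "(\<exists>s::nat. a \<asymp> a' [^] s) \<or> (\<exists>s::nat. a' \<asymp> a [^] s)"
        if a: "a \<in> A" "a \<noteq> \<zero>" "a' \<in> A" "a' \<noteq> \<zero>" for a a'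
      proof -
        obtain b where b: "b \<in> B" "b \<noteq> \<zero>" "a' \<asymp> b" using c(2) a by blast
        have n: "a \<in> nonzero" "a' \<in> nonzero" "b \<in> nonzero" using a b A.B_carrier B.B_carrier by auto
        have "a' [^] s \<asymp> b [^] s" for s :: nat using b(3) n by (intro val_equiv_pow)
        then show ?thesis
          using commuting_comparable[OF lift nd p n(1,3) comm[OF a(1) b(1)]] b(3)
            val_equiv_trans val_equiv_sym by meson
      qed
    qed
    then show ?thesis by blast
  qed
qed

end

section \<open>Tensor factors\<close>

context cring
begin

lemma finsum_swap:
  assumes "finite S" "finite T" "\<And>x y. x \<in> S \<Longrightarrow> y \<in> T \<Longrightarrow> a x y \<in> carrier R"
  shows "(\<Oplus>x\<in>S. \<Oplus>y\<in>T. a x y) = (\<Oplus>y\<in>T. \<Oplus>x\<in>S. a x y)"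
  using assms(1,3)
proof (induction S rule: finite_induct)
  case empty
  show ?case by simp
next
  case (insert s S)
  have c: "a x y \<in> carrier R" if "x \<in> insert s S" "y \<in> T" for x y using insert.prems that by blast
  have "(\<Oplus>x\<in>insert s S. \<Oplus>y\<in>T. a x y) = (\<Oplus>y\<in>T. a s y) \<oplus> (\<Oplus>x\<in>S. \<Oplus>y\<in>T. a x y)"
    using insert.hyps c by (intro finsum_insert) (auto intro!: finsum_closed)
  also have "(\<Oplus>x\<in>S. \<Oplus>y\<in>T. a x y) = (\<Oplus>y\<in>T. \<Oplus>x\<in>S. a x y)"
    using c by (intro insert.IH) auto
  also have "(\<Oplus>y\<in>T. a s y) \<oplus> (\<Oplus>y\<in>T. \<Oplus>x\<in>S. a x y) = (\<Oplus>y\<in>T. a s y \<oplus> (\<Oplus>x\<in>S. a x y))"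
    using c by (intro finsum_addf[symmetric]) (auto intro!: finsum_closed)
  also have "\<dots> = (\<Oplus>y\<in>T. \<Oplus>x\<in>insert s S. a x y)"
    using insert.hyps c by (intro finsum_cong' finsum_insert[symmetric]) (auto intro!: finsum_closed)
  finally show ?case .
qed

lemma finsum_cartesian:
  assumes "finite S" "finite T" "\<And>x y. x \<in> S \<Longrightarrow> y \<in> T \<Longrightarrow> a x y \<in> carrier R"
  shows "finsum R (\<lambda>(x, y). a x y) (S \<times> T) = (\<Oplus>x\<in>S. \<Oplus>y\<in>T. a x y)"
  using assms(1,3)
proof (induction S rule: finite_induct)
  case empty
  show ?case by simp
next
  case (insert s S)
  have c: "a x y \<in> carrier R" if "x \<in> insert s S" "y \<in> T" for x y using insert.prems that by blast
  have "insert s S \<times> T = Pair s ` T \<union> S \<times> T" by auto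
  then have "finsum R (\<lambda>(x, y). a x y) (insert s S \<times> T) = finsum R (\<lambda>(x, y). a x y) (Pair s ` T) \<oplus> finsum R (\<lambda>(x, y). a x y) (S \<times> T)"
    using insert.hyps assms(2) c by (simp only:) (rule finsum_Un_disjoint, auto)
  also have "finsum R (\<lambda>(x, y). a x y) (Pair s ` T) = (\<Oplus>y\<in>T. a s y)"
    using c by (subst finsum_reindex) (auto simp: inj_on_def)
  also have "finsum R (\<lambda>(x, y). a x y) (S \<times> T) = (\<Oplus>x\<in>S. \<Oplus>y\<in>T. a x y)"
    using c by (intro insert.IH) auto
  also have "(\<Oplus>y\<in>T. a s y) \<oplus> (\<Oplus>x\<in>S. \<Oplus>y\<in>T. a x y) = (\<Oplus>x\<in>insert s S. \<Oplus>y\<in>T. a x y)"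
    using insert.hyps c by (intro finsum_insert[symmetric]) (auto intro!: finsum_closed)
  finally show ?case .
qed

end

section \<open>The monoid algebra is a ring\<close>

locale monoid_algebra_ring = R?: cring R + Mon?: monoid M for R (structure) and M (structure)
begin

abbreviation P where "P \<equiv> monoid_algebra R M"

abbreviation supp where "supp f \<equiv> {x. f x \<noteq> \<zero>}"

lemma P_iff: "f \<in> carrier P \<longleftrightarrow> (\<forall>x. f x \<in> carrier R) \<and> supp f \<subseteq> carrier M \<and> finite (supp f)"
proof -
  have "f x \<in> carrier R" if "\<forall>x\<in>carrier M. f x \<in> carrier R" "\<forall>x. x \<notin> carrier M \<longrightarrow> f x = \<zero>" for x
    using that by (cases "x \<in> carrier M") auto
  moreover have "f \<in> carrier P \<longleftrightarrow> (\<forall>x\<in>carrier M. f x \<in> carrier R) \<and>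
      (\<forall>x. x \<notin> carrier M \<longrightarrow> f x = \<zero>) \<and> finite (supp f)"
    by (simp add: monoid_algebra_def)
  ultimately show ?thesis by blast
qed

lemma P_val: "f \<in> carrier P \<Longrightarrow> f x \<in> carrier R"
  and P_supp: "f \<in> carrier P \<Longrightarrow> supp f \<subseteq> carrier M"
  and P_fin: "f \<in> carrier P \<Longrightarrow> finite (supp f)"
  by (auto simp: P_iff)

text \<open>Expressing products through pairings reduces the ring axioms to those of the monoid \<open>M\<close>.\<close>

definition pairing :: "('c \<Rightarrow> 'a) \<Rightarrow> ('c \<Rightarrow> 'a) \<Rightarrow> 'a" where
  "pairing f \<phi> = (\<Oplus>x\<in>supp f. f x \<otimes> \<phi> x)"

abbreviation \<delta> :: "'c \<Rightarrow> 'c \<Rightarrow> 'a" where "\<delta> z x \<equiv> if x = z then \<one> else \<zero>"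

lemma pairing_superset:
  assumes f: "f \<in> carrier P" and S: "finite S" "supp f \<subseteq> S" and \<phi>: "\<And>x. x \<in> S \<Longrightarrow> \<phi> x \<in> carrier R"
  shows "pairing f \<phi> = (\<Oplus>x\<in>S. f x \<otimes> \<phi> x)"
  unfolding pairing_def
  by (rule R.add.finprod_mono_neutral_cong_left) (use S \<phi> P_val[OF f] in auto)

lemma pairing_closed:
  assumes "f \<in> carrier P" "\<And>x. x \<in> carrier M \<Longrightarrow> \<phi> x \<in> carrier R"
  shows "pairing f \<phi> \<in> carrier R"
  unfolding pairing_def using P_val[OF assms(1)] P_supp[OF assms(1)] assms(2)
  by (intro R.finsum_closed) auto

lemma pairing_cong:
  assumes "f \<in> carrier P" "\<And>x. x \<in> carrier M \<Longrightarrow> \<psi> x \<in> carrier R" "\<And>x. x \<in> supp f \<Longrightarrow> \<phi> x = \<psi> x"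
  shows "pairing f \<phi> = pairing f \<psi>"
  unfolding pairing_def using P_val[OF assms(1)] P_supp[OF assms(1)] assms(2,3)
  by (intro R.finsum_cong') auto

lemma pairing_smult:
  assumes "f \<in> carrier P" "\<And>x. x \<in> carrier M \<Longrightarrow> \<phi> x \<in> carrier R" "c \<in> carrier R"
  shows "pairing f (\<lambda>x. c \<otimes> \<phi> x) = c \<otimes> pairing f \<phi>"
proof -
  have "\<phi> x \<in> carrier R" if "x \<in> supp f" for x using that P_supp[OF assms(1)] assms(2) by blast
  then have "pairing f (\<lambda>x. c \<otimes> \<phi> x) = (\<Oplus>x\<in>supp f. c \<otimes> (f x \<otimes> \<phi> x))"
    unfolding pairing_def using P_val[OF assms(1)] assms(3)
    by (intro R.finsum_cong') (auto simp: R.m_lcomm)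
  also have "\<dots> = c \<otimes> pairing f \<phi>"
    unfolding pairing_def using P_val[OF assms(1)] P_fin[OF assms(1)] assms P_supp[OF assms(1)]
    by (intro R.finsum_rdistr[symmetric]) auto
  finally show ?thesis .
qed

lemma pairing_sum:
  assumes f: "f \<in> carrier P" and W: "finite W" and \<phi>: "\<And>t x. t \<in> W \<Longrightarrow> x \<in> carrier M \<Longrightarrow> \<phi> t x \<in> carrier R"
  shows "pairing f (\<lambda>x. \<Oplus>t\<in>W. \<phi> t x) = (\<Oplus>t\<in>W. pairing f (\<phi> t))"
proof -
  have c: "\<phi> t x \<in> carrier R" if "t \<in> W" "x \<in> supp f" for t x using that P_supp[OF f] \<phi> by blast
  have "pairing f (\<lambda>x. \<Oplus>t\<in>W. \<phi> t x) = (\<Oplus>x\<in>supp f. \<Oplus>t\<in>W. f x \<otimes> \<phi> t x)"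
    unfolding pairing_def using P_val[OF f] W c
    by (intro R.finsum_cong' R.finsum_rdistr) (auto intro!: R.finsum_closed)
  also have "\<dots> = (\<Oplus>t\<in>W. pairing f (\<phi> t))"
    unfolding pairing_def using P_val[OF f] P_fin[OF f] W c by (intro R.finsum_swap) auto
  finally show ?thesis .
qed

lemma pairing_add_right:
  assumes f: "f \<in> carrier P" and "\<And>x. x \<in> carrier M \<Longrightarrow> \<phi> x \<in> carrier R" "\<And>x. x \<in> carrier M \<Longrightarrow> \<psi> x \<in> carrier R"
  shows "pairing f (\<lambda>x. \<phi> x \<oplus> \<psi> x) = pairing f \<phi> \<oplus> pairing f \<psi>"
proof -
  have c: "\<phi> x \<in> carrier R" "\<psi> x \<in> carrier R" if "x \<in> supp f" for x using that P_supp[OF f] assms(2,3) by blast+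
  have "pairing f (\<lambda>x. \<phi> x \<oplus> \<psi> x) = (\<Oplus>x\<in>supp f. f x \<otimes> \<phi> x \<oplus> f x \<otimes> \<psi> x)"
    unfolding pairing_def using P_val[OF f] c by (intro R.finsum_cong') (auto simp: R.r_distr)
  also have "\<dots> = pairing f \<phi> \<oplus> pairing f \<psi>"
    unfolding pairing_def using P_val[OF f] c by (intro R.finsum_addf) auto
  finally show ?thesis .
qed

lemma P_add: "f \<oplus>\<^bsub>P\<^esub> g = (\<lambda>x. f x \<oplus> g x)"
  and P_zero: "\<zero>\<^bsub>P\<^esub> = (\<lambda>_. \<zero>)"
  and P_one: "\<one>\<^bsub>P\<^esub> = basis_vector R \<one>\<^bsub>M\<^esub>"
  and P_smult: "c \<odot>\<^bsub>P\<^esub> f = (\<lambda>x. c \<otimes> f x)"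
  by (simp_all add: monoid_algebra_def)

lemma P_add_closed:
  assumes "f \<in> carrier P" "g \<in> carrier P" shows "f \<oplus>\<^bsub>P\<^esub> g \<in> carrier P"
proof -
  have "supp (\<lambda>x. f x \<oplus> g x) \<subseteq> supp f \<union> supp g" by auto
  then show ?thesis using assms unfolding P_add P_iff by (auto dest: finite_subset)
qed

lemma pairing_add_left:
  assumes f: "f \<in> carrier P" and g: "g \<in> carrier P" and \<phi>: "\<And>x. x \<in> carrier M \<Longrightarrow> \<phi> x \<in> carrier R"
  shows "pairing (f \<oplus>\<^bsub>P\<^esub> g) \<phi> = pairing f \<phi> \<oplus> pairing g \<phi>"
proof -
  let ?S = "supp f \<union> supp g"
  have S: "finite ?S" "?S \<subseteq> carrier M" using P_fin[OF f] P_fin[OF g] P_supp[OF f] P_supp[OF g] by auto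
  have c: "\<phi> x \<in> carrier R" if "x \<in> ?S" for x using S that \<phi> by blast
  have sub: "supp (f \<oplus>\<^bsub>P\<^esub> g) \<subseteq> ?S" by (auto simp: P_add)
  have "pairing (f \<oplus>\<^bsub>P\<^esub> g) \<phi> = (\<Oplus>x\<in>?S. (f \<oplus>\<^bsub>P\<^esub> g) x \<otimes> \<phi> x)"
    by (rule pairing_superset[OF P_add_closed[OF f g] S(1) sub c])
  also have "\<dots> = (\<Oplus>x\<in>?S. f x \<otimes> \<phi> x \<oplus> g x \<otimes> \<phi> x)"
    using P_val[OF f] P_val[OF g] c by (intro R.finsum_cong') (auto simp: P_add R.l_distr)
  also have "\<dots> = (\<Oplus>x\<in>?S. f x \<otimes> \<phi> x) \<oplus> (\<Oplus>x\<in>?S. g x \<otimes> \<phi> x)"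
    using P_val[OF f] P_val[OF g] c by (intro R.finsum_addf) auto
  also have "(\<Oplus>x\<in>?S. f x \<otimes> \<phi> x) = pairing f \<phi>"
    using pairing_superset[OF f S(1) _ c] by auto
  also have "(\<Oplus>x\<in>?S. g x \<otimes> \<phi> x) = pairing g \<phi>"
    using pairing_superset[OF g S(1) _ c] by auto
  finally show ?thesis .
qed

lemma basis_vector_closed:
  assumes "x \<in> carrier M" shows "basis_vector R x \<in> carrier P"
proof -
  have "supp (basis_vector R x) \<subseteq> {x}" by (auto simp: basis_vector_def)
  then show ?thesis using assms unfolding P_iff by (auto simp: basis_vector_def dest: finite_subset)
qed

lemma pairing_basis_vector:
  assumes "x \<in> carrier M" "\<phi> x \<in> carrier R"
  shows "pairing (basis_vector R x) \<phi> = \<phi> x"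
proof -
  have "pairing (basis_vector R x) \<phi> = (\<Oplus>y\<in>{x}. basis_vector R x y \<otimes> \<phi> y)"
    using assms by (intro pairing_superset basis_vector_closed) (auto simp: basis_vector_def)
  then show ?thesis using assms by (simp add: basis_vector_def)
qed

lemma pairing_delta:
  assumes f: "f \<in> carrier P" shows "pairing f (\<delta> z) = f z"
proof -
  have "pairing f (\<delta> z) = (\<Oplus>x\<in>insert z (supp f). f x \<otimes> \<delta> z x)"
    using P_fin[OF f] by (intro pairing_superset[OF f]) auto
  also have "\<dots> = (\<Oplus>x\<in>insert z (supp f). if z = x then f x else \<zero>)"
    using P_val[OF f] by (intro R.finsum_cong') auto
  also have "\<dots> = f z"
    using P_fin[OF f] P_val[OF f] by (intro R.finsum_singleton) auto
  finally show ?thesis .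
qed

text \<open>Pairing with the indicator \<open>\<delta> z\<close> of the product replaces the sum
  over a fiber of the multiplication by a sum over the rectangle of supports.\<close>

lemma P_mult:
  assumes f: "f \<in> carrier P" and g: "g \<in> carrier P"
  shows "(f \<otimes>\<^bsub>P\<^esub> g) z = pairing f (\<lambda>x. pairing g (\<lambda>y. \<delta> z (x \<otimes>\<^bsub>M\<^esub> y)))"
proof -
  let ?Q = "{(x, y). f x \<noteq> \<zero> \<and> g y \<noteq> \<zero> \<and> x \<otimes>\<^bsub>M\<^esub> y = z}"
  have "(f \<otimes>\<^bsub>P\<^esub> g) z = finsum R (\<lambda>(x, y). f x \<otimes> g y) ?Q"
    by (simp add: monoid_algebra_def)
  also have "\<dots> = finsum R (\<lambda>(x, y). f x \<otimes> (g y \<otimes> \<delta> z (x \<otimes>\<^bsub>M\<^esub> y))) (supp f \<times> supp g)"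
    by (rule R.add.finprod_mono_neutral_cong_left)
      (use P_fin[OF f] P_fin[OF g] P_val[OF f] P_val[OF g] in \<open>auto split: if_splits\<close>)
  also have "\<dots> = (\<Oplus>x\<in>supp f. \<Oplus>y\<in>supp g. f x \<otimes> (g y \<otimes> \<delta> z (x \<otimes>\<^bsub>M\<^esub> y)))"
    using P_fin[OF f] P_fin[OF g] P_val[OF f] P_val[OF g] by (intro R.finsum_cartesian) auto
  also have "\<dots> = pairing f (\<lambda>x. pairing g (\<lambda>y. \<delta> z (x \<otimes>\<^bsub>M\<^esub> y)))"
    unfolding pairing_def using P_fin[OF g] P_val[OF f] P_val[OF g]
    by (intro R.finsum_cong' R.finsum_rdistr[symmetric]) (auto intro!: R.finsum_closed)
  finally show ?thesis .
qed

lemma P_mult_closed: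
  assumes f: "f \<in> carrier P" and g: "g \<in> carrier P" shows "f \<otimes>\<^bsub>P\<^esub> g \<in> carrier P"
proof -
  let ?W = "(\<lambda>(x, y). x \<otimes>\<^bsub>M\<^esub> y) ` (supp f \<times> supp g)"
  have "finite ?W" using P_fin[OF f] P_fin[OF g] by simp
  moreover have "?W \<subseteq> carrier M" using P_supp[OF f] P_supp[OF g] by auto
  moreover have "supp (f \<otimes>\<^bsub>P\<^esub> g) \<subseteq> ?W"
  proof
    fix z assume z: "z \<in> supp (f \<otimes>\<^bsub>P\<^esub> g)"
    show "z \<in> ?W"
    proof (rule ccontr)
      assume nz: "z \<notin> ?W"
      let ?Q = "{(x, y). f x \<noteq> \<zero> \<and> g y \<noteq> \<zero> \<and> x \<otimes>\<^bsub>M\<^esub> y = z}"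
      have empty: "?Q = {}" using nz by force
      have "(f \<otimes>\<^bsub>P\<^esub> g) z = finsum R (\<lambda>(x, y). f x \<otimes> g y) ?Q"
        by (simp add: monoid_algebra_def)
      then have "(f \<otimes>\<^bsub>P\<^esub> g) z = \<zero>" unfolding empty by simp
      then show False using z by simp
    qed
  qed
  moreover have "(f \<otimes>\<^bsub>P\<^esub> g) z \<in> carrier R" for z
    unfolding P_mult[OF f g] by (intro pairing_closed f g) auto
  ultimately show ?thesis unfolding P_iff by (auto dest: finite_subset)
qed

text \<open>Pairing with \<open>\<phi>\<close> is the linear extension of \<open>\<phi>\<close> to
  the algebra. Expanding \<open>\<phi>\<close> into multiples of indicators reduces the claim to the
  coefficients of the product.\<close>

lemma pairing_mult:
  assumes f: "f \<in> carrier P" and g: "g \<in> carrier P" and \<phi>: "\<And>x. x \<in> carrier M \<Longrightarrow> \<phi> x \<in> carrier R"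
  shows "pairing (f \<otimes>\<^bsub>P\<^esub> g) \<phi> = pairing f (\<lambda>x. pairing g (\<lambda>y. \<phi> (x \<otimes>\<^bsub>M\<^esub> y)))"
proof -
  \<comment> \<open>A finite set containing all products of support elements as well as the support
    of the product, so that both sides are sums over it.\<close>
  let ?W = "(\<lambda>(x, y). x \<otimes>\<^bsub>M\<^esub> y) ` (supp f \<times> supp g) \<union> supp (f \<otimes>\<^bsub>P\<^esub> g)"
  note fg = P_mult_closed[OF f g]
  have W: "finite ?W" "?W \<subseteq> carrier M" using P_fin[OF f] P_fin[OF g] P_fin[OF fg] P_supp[OF f] P_supp[OF g] P_supp[OF fg] by auto
  have \<phi>W: "\<phi> t \<in> carrier R" if "t \<in> ?W" for t using that W \<phi> by blast
  have \<phi>': "\<phi> t \<otimes> \<delta> t s \<in> carrier R" if "t \<in> ?W" for t s using \<phi>W[OF that] by simp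
  have pc: "pairing g (\<lambda>y. \<phi> t \<otimes> \<delta> t (x \<otimes>\<^bsub>M\<^esub> y)) \<in> carrier R" if "t \<in> ?W" for t x
    using \<phi>'[OF that] by (intro pairing_closed[OF g]) auto
  have "pairing f (\<lambda>x. pairing g (\<lambda>y. \<phi> (x \<otimes>\<^bsub>M\<^esub> y)))
      = pairing f (\<lambda>x. pairing g (\<lambda>y. \<Oplus>t\<in>?W. \<phi> t \<otimes> \<delta> t (x \<otimes>\<^bsub>M\<^esub> y)))"
  proof (intro pairing_cong[OF f] pairing_cong[OF g])
    fix x y assume xy: "x \<in> supp f" "y \<in> supp g"
    then have W': "x \<otimes>\<^bsub>M\<^esub> y \<in> ?W" by force
    have "(\<Oplus>t\<in>?W. \<phi> t \<otimes> \<delta> t (x \<otimes>\<^bsub>M\<^esub> y)) = (\<Oplus>t\<in>?W. if x \<otimes>\<^bsub>M\<^esub> y = t then \<phi> t else \<zero>)"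
      using \<phi>W by (intro R.finsum_cong') auto
    also have "\<dots> = \<phi> (x \<otimes>\<^bsub>M\<^esub> y)" using W(1) W' \<phi>W by (intro R.finsum_singleton) auto
    finally show "\<phi> (x \<otimes>\<^bsub>M\<^esub> y) = (\<Oplus>t\<in>?W. \<phi> t \<otimes> \<delta> t (x \<otimes>\<^bsub>M\<^esub> y))" ..
  qed (use \<phi>' in \<open>auto intro!: R.finsum_closed pairing_closed[OF g]\<close>)
  also have "\<dots> = pairing f (\<lambda>x. \<Oplus>t\<in>?W. pairing g (\<lambda>y. \<phi> t \<otimes> \<delta> t (x \<otimes>\<^bsub>M\<^esub> y)))"
    using \<phi>' W(1) pc
    by (intro pairing_cong[OF f] pairing_sum[OF g]) (auto intro!: R.finsum_closed)
  also have "\<dots> = (\<Oplus>t\<in>?W. pairing f (\<lambda>x. pairing g (\<lambda>y. \<phi> t \<otimes> \<delta> t (x \<otimes>\<^bsub>M\<^esub> y))))"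
    using pc by (intro pairing_sum[OF f W(1)])
  also have "\<dots> = (\<Oplus>t\<in>?W. (f \<otimes>\<^bsub>P\<^esub> g) t \<otimes> \<phi> t)"
  proof (intro R.finsum_cong')
    show "pairing f (\<lambda>x. pairing g (\<lambda>y. \<phi> t \<otimes> \<delta> t (x \<otimes>\<^bsub>M\<^esub> y))) = (f \<otimes>\<^bsub>P\<^esub> g) t \<otimes> \<phi> t"
      if t: "t \<in> ?W" for t
    proof -
      have "pairing f (\<lambda>x. pairing g (\<lambda>y. \<phi> t \<otimes> \<delta> t (x \<otimes>\<^bsub>M\<^esub> y)))
          = pairing f (\<lambda>x. \<phi> t \<otimes> pairing g (\<lambda>y. \<delta> t (x \<otimes>\<^bsub>M\<^esub> y)))"
        using \<phi>W[OF t] by (intro pairing_cong[OF f] pairing_smult[OF g]) (auto intro!: pairing_closed[OF g])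
      also have "\<dots> = \<phi> t \<otimes> (f \<otimes>\<^bsub>P\<^esub> g) t"
        unfolding P_mult[OF f g] using \<phi>W[OF t] by (intro pairing_smult[OF f]) (auto intro!: pairing_closed[OF g])
      finally show ?thesis using \<phi>W[OF t] P_val[OF fg] by (simp add: R.m_comm)
    qed
  qed (use \<phi>W P_val[OF fg] in auto)
  also have "\<dots> = pairing (f \<otimes>\<^bsub>P\<^esub> g) \<phi>"
    using W(1) \<phi>W by (intro pairing_superset[OF fg, symmetric]) auto
  finally show ?thesis ..
qed

text \<open>Both bracketings of a triple product become iterated pairings that differ only by
  associativity in \<open>M\<close>; the distributive laws are additivity of the pairing in either
  argument.\<close>

lemma monoid_algebra_ring: "ring P"
proof (rule ringI)
  show "abelian_group P"
  proof (rule abelian_groupI)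
    show "\<zero>\<^bsub>P\<^esub> \<in> carrier P" by (simp add: P_iff P_zero)
    show "\<exists>g\<in>carrier P. g \<oplus>\<^bsub>P\<^esub> f = \<zero>\<^bsub>P\<^esub>" if f: "f \<in> carrier P" for f
    proof (rule bexI[of _ "\<lambda>x. \<ominus> f x"])
      show "(\<lambda>x. \<ominus> f x) \<oplus>\<^bsub>P\<^esub> f = \<zero>\<^bsub>P\<^esub>"
        using P_val[OF f] by (auto simp: P_add P_zero R.l_neg)
      have "supp (\<lambda>x. \<ominus> f x) \<subseteq> supp f" by auto
      then show "(\<lambda>x. \<ominus> f x) \<in> carrier P"
        using f unfolding P_iff by (auto dest: finite_subset)
    qed
  qed (auto simp: P_add_closed, auto simp: P_add P_zero P_val R.a_ac)
  show "monoid P"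
  proof (rule monoidI)
    show "\<one>\<^bsub>P\<^esub> \<in> carrier P" unfolding P_one by (intro basis_vector_closed) simp
    show "f \<otimes>\<^bsub>P\<^esub> g \<otimes>\<^bsub>P\<^esub> h = f \<otimes>\<^bsub>P\<^esub> (g \<otimes>\<^bsub>P\<^esub> h)"
      if f: "f \<in> carrier P" and g: "g \<in> carrier P" and h: "h \<in> carrier P" for f g h
    proof
      fix z
      have "(f \<otimes>\<^bsub>P\<^esub> g \<otimes>\<^bsub>P\<^esub> h) z = pairing f (\<lambda>x. pairing g (\<lambda>y. pairing h (\<lambda>u. \<delta> z (x \<otimes>\<^bsub>M\<^esub> y \<otimes>\<^bsub>M\<^esub> u))))"
        unfolding P_mult[OF P_mult_closed[OF f g] h] by (intro pairing_mult[OF f g] pairing_closed[OF h]) auto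
      also have "\<dots> = pairing f (\<lambda>x. pairing g (\<lambda>y. pairing h (\<lambda>u. \<delta> z (x \<otimes>\<^bsub>M\<^esub> (y \<otimes>\<^bsub>M\<^esub> u)))))"
      proof (intro pairing_cong[OF f] pairing_cong[OF g] pairing_cong[OF h])
        fix x y u assume "x \<in> supp f" "y \<in> supp g" "u \<in> supp h"
        then have "x \<in> carrier M" "y \<in> carrier M" "u \<in> carrier M"
          using P_supp[OF f] P_supp[OF g] P_supp[OF h] by blast+
        then show "\<delta> z (x \<otimes>\<^bsub>M\<^esub> y \<otimes>\<^bsub>M\<^esub> u) = \<delta> z (x \<otimes>\<^bsub>M\<^esub> (y \<otimes>\<^bsub>M\<^esub> u))" by (simp add: Mon.m_assoc)
      qed (auto intro!: pairing_closed[OF g] pairing_closed[OF h])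
      also have "\<dots> = pairing f (\<lambda>x. pairing (g \<otimes>\<^bsub>P\<^esub> h) (\<lambda>s. \<delta> z (x \<otimes>\<^bsub>M\<^esub> s)))"
        by (intro pairing_cong[OF f] pairing_mult[OF g h, symmetric]) (auto intro!: pairing_closed[OF P_mult_closed[OF g h]])
      also have "\<dots> = (f \<otimes>\<^bsub>P\<^esub> (g \<otimes>\<^bsub>P\<^esub> h)) z" by (rule P_mult[OF f P_mult_closed[OF g h], symmetric])
      finally show "(f \<otimes>\<^bsub>P\<^esub> g \<otimes>\<^bsub>P\<^esub> h) z = (f \<otimes>\<^bsub>P\<^esub> (g \<otimes>\<^bsub>P\<^esub> h)) z" .
    qed
    fix f assume f: "f \<in> carrier P"
    have one: "\<one>\<^bsub>M\<^esub> \<in> carrier M" by simp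
    note e = basis_vector_closed[OF one]
    show "\<one>\<^bsub>P\<^esub> \<otimes>\<^bsub>P\<^esub> f = f"
    proof
      fix z
      have "(\<one>\<^bsub>P\<^esub> \<otimes>\<^bsub>P\<^esub> f) z = pairing f (\<lambda>y. \<delta> z (\<one>\<^bsub>M\<^esub> \<otimes>\<^bsub>M\<^esub> y))"
        unfolding P_one P_mult[OF e f] by (intro pairing_basis_vector[OF one] pairing_closed[OF f]) auto
      also have "\<dots> = pairing f (\<delta> z)" using P_supp[OF f] by (intro pairing_cong[OF f]) (auto simp: subset_iff)
      finally show "(\<one>\<^bsub>P\<^esub> \<otimes>\<^bsub>P\<^esub> f) z = f z" by (simp only: pairing_delta[OF f])
    qed
    show "f \<otimes>\<^bsub>P\<^esub> \<one>\<^bsub>P\<^esub> = f"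
    proof
      fix z
      have "(f \<otimes>\<^bsub>P\<^esub> \<one>\<^bsub>P\<^esub>) z = pairing f (\<lambda>x. \<delta> z (x \<otimes>\<^bsub>M\<^esub> \<one>\<^bsub>M\<^esub>))"
        unfolding P_one P_mult[OF f e] by (intro pairing_cong[OF f] pairing_basis_vector[OF one]) auto
      also have "\<dots> = pairing f (\<delta> z)" using P_supp[OF f] by (intro pairing_cong[OF f]) (auto simp: subset_iff)
      finally show "(f \<otimes>\<^bsub>P\<^esub> \<one>\<^bsub>P\<^esub>) z = f z" by (simp only: pairing_delta[OF f])
    qed
  qed (rule P_mult_closed)
  show "(f \<oplus>\<^bsub>P\<^esub> g) \<otimes>\<^bsub>P\<^esub> h = f \<otimes>\<^bsub>P\<^esub> h \<oplus>\<^bsub>P\<^esub> g \<otimes>\<^bsub>P\<^esub> h"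
    if f: "f \<in> carrier P" and g: "g \<in> carrier P" and h: "h \<in> carrier P" for f g h
  proof
    fix z
    show "((f \<oplus>\<^bsub>P\<^esub> g) \<otimes>\<^bsub>P\<^esub> h) z = (f \<otimes>\<^bsub>P\<^esub> h \<oplus>\<^bsub>P\<^esub> g \<otimes>\<^bsub>P\<^esub> h) z"
      unfolding P_mult[OF P_add_closed[OF f g] h]
      by (subst pairing_add_left[OF f g]) (auto simp: P_add P_mult[OF f h] P_mult[OF g h] intro!: pairing_closed[OF h])
  qed
  show "h \<otimes>\<^bsub>P\<^esub> (f \<oplus>\<^bsub>P\<^esub> g) = h \<otimes>\<^bsub>P\<^esub> f \<oplus>\<^bsub>P\<^esub> h \<otimes>\<^bsub>P\<^esub> g"
    if f: "f \<in> carrier P" and g: "g \<in> carrier P" and h: "h \<in> carrier P" for f g h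
  proof
    fix z
    have "(h \<otimes>\<^bsub>P\<^esub> (f \<oplus>\<^bsub>P\<^esub> g)) z
        = pairing h (\<lambda>x. pairing f (\<lambda>y. \<delta> z (x \<otimes>\<^bsub>M\<^esub> y)) \<oplus> pairing g (\<lambda>y. \<delta> z (x \<otimes>\<^bsub>M\<^esub> y)))"
      unfolding P_mult[OF h P_add_closed[OF f g]]
      by (intro pairing_cong[OF h] pairing_add_left[OF f g]) (auto intro!: pairing_closed[OF f] pairing_closed[OF g])
    also have "\<dots> = (h \<otimes>\<^bsub>P\<^esub> f) z \<oplus> (h \<otimes>\<^bsub>P\<^esub> g) z"
      unfolding P_mult[OF h f] P_mult[OF h g]
      by (intro pairing_add_right[OF h]) (auto intro!: pairing_closed[OF f] pairing_closed[OF g])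
    finally show "(h \<otimes>\<^bsub>P\<^esub> (f \<oplus>\<^bsub>P\<^esub> g)) z = (h \<otimes>\<^bsub>P\<^esub> f \<oplus>\<^bsub>P\<^esub> h \<otimes>\<^bsub>P\<^esub> g) z" by (simp add: P_add)
  qed
qed

lemma basis_vector_mult:
  assumes x: "x \<in> carrier M" and y: "y \<in> carrier M"
  shows "basis_vector R x \<otimes>\<^bsub>P\<^esub> basis_vector R y = basis_vector R (x \<otimes>\<^bsub>M\<^esub> y)"
proof
  fix z
  note e = basis_vector_closed[OF x] basis_vector_closed[OF y]
  have "(basis_vector R x \<otimes>\<^bsub>P\<^esub> basis_vector R y) z = pairing (basis_vector R y) (\<lambda>y. \<delta> z (x \<otimes>\<^bsub>M\<^esub> y))"
    unfolding P_mult[OF e] by (intro pairing_basis_vector[OF x] pairing_closed[OF e(2)]) auto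
  also have "\<dots> = \<delta> z (x \<otimes>\<^bsub>M\<^esub> y)" by (intro pairing_basis_vector[OF y]) auto
  finally show "(basis_vector R x \<otimes>\<^bsub>P\<^esub> basis_vector R y) z = basis_vector R (x \<otimes>\<^bsub>M\<^esub> y) z"
    by (simp add: basis_vector_def)
qed

lemma P_smult_closed:
  assumes "c \<in> carrier R" "f \<in> carrier P" shows "c \<odot>\<^bsub>P\<^esub> f \<in> carrier P"
proof -
  have "supp (\<lambda>x. c \<otimes> f x) \<subseteq> supp f" using assms(1) by auto
  then show ?thesis using assms unfolding P_smult P_iff by (auto dest: finite_subset)
qed

lemma P_smult_mult:
  assumes c: "c \<in> carrier R" and f: "f \<in> carrier P" and g: "g \<in> carrier P"
  shows "(c \<odot>\<^bsub>P\<^esub> f) \<otimes>\<^bsub>P\<^esub> g = c \<odot>\<^bsub>P\<^esub> (f \<otimes>\<^bsub>P\<^esub> g)"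
proof
  fix z
  note cf = P_smult_closed[OF c f]
  let ?\<phi> = "\<lambda>x. pairing g (\<lambda>y. \<delta> z (x \<otimes>\<^bsub>M\<^esub> y))"
  have \<phi>: "?\<phi> x \<in> carrier R" for x by (intro pairing_closed[OF g]) auto
  have sub: "supp (c \<odot>\<^bsub>P\<^esub> f) \<subseteq> supp f" using c by (auto simp: P_smult)
  have "((c \<odot>\<^bsub>P\<^esub> f) \<otimes>\<^bsub>P\<^esub> g) z = (\<Oplus>x\<in>supp f. (c \<odot>\<^bsub>P\<^esub> f) x \<otimes> ?\<phi> x)"
    unfolding P_mult[OF cf g] by (rule pairing_superset[OF cf P_fin[OF f] sub \<phi>])
  also have "\<dots> = (\<Oplus>x\<in>supp f. c \<otimes> (f x \<otimes> ?\<phi> x))"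
    using c P_val[OF f] \<phi> by (intro R.finsum_cong') (auto simp: P_smult R.m_assoc)
  also have "\<dots> = c \<otimes> (f \<otimes>\<^bsub>P\<^esub> g) z"
    unfolding P_mult[OF f g] pairing_def[of f] using c P_val[OF f] P_fin[OF f] \<phi>
    by (intro R.finsum_rdistr[symmetric]) auto
  finally show "((c \<odot>\<^bsub>P\<^esub> f) \<otimes>\<^bsub>P\<^esub> g) z = (c \<odot>\<^bsub>P\<^esub> (f \<otimes>\<^bsub>P\<^esub> g)) z" by (simp add: P_smult)
qed

end

section \<open>The tensor algebra and its two commuting embeddings\<close>

locale tensor_factors =
  A: central_division_algebra F A + B: central_division_algebra F B
  for F :: "('f, 'm) ring_scheme" and A :: "('f, 'b) module" and B :: "('f, 'c) module"
begin

sublocale MA: monoid_algebra_ring F "A \<times>\<times> B"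
  by (intro monoid_algebra_ring.intro DirProd_monoid A.F.is_cring A.D.is_monoid B.D.is_monoid)

abbreviation P where "P \<equiv> monoid_algebra F (A \<times>\<times> B)"
abbreviation I where "I \<equiv> Idl\<^bsub>P\<^esub> (tensor_relations F A B)"
abbreviation e where "e a b \<equiv> basis_vector F (a, b)"
abbreviation T where "T \<equiv> tensor_algebra F A B"
abbreviation proj where "proj f \<equiv> I +>\<^bsub>P\<^esub> f"

lemma e_closed: "a \<in> carrier A \<Longrightarrow> b \<in> carrier B \<Longrightarrow> e a b \<in> carrier P"
  by (intro MA.basis_vector_closed) simp

lemma ring_P: "ring P"
  by (rule MA.monoid_algebra_ring)

lemma relations_closed: "tensor_relations F A B \<subseteq> carrier P"
proof -
  interpret P: ring P by (rule ring_P)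
  show ?thesis unfolding tensor_relations_def Let_def
    by (auto simp: a_minus_def[of P] intro!: P.a_closed P.a_inv_closed e_closed MA.P_smult_closed)
qed

lemma ideal_I: "ideal I P"
  by (rule ring.genideal_ideal[OF ring_P relations_closed])

lemma relations_I: "x \<in> tensor_relations F A B \<Longrightarrow> x \<in> I"
  using ring.genideal_self[OF ring_P relations_closed] by blast

lemma proj_eqI: "x \<in> carrier P \<Longrightarrow> y \<in> carrier P \<Longrightarrow> x \<ominus>\<^bsub>P\<^esub> y \<in> I \<Longrightarrow> proj x = proj y"
  using ring.quotient_eq_iff_same_a_r_cos[OF ring_P ideal_I] by blast

lemma T_mult: "f \<in> carrier P \<Longrightarrow> g \<in> carrier P \<Longrightarrow> proj f \<otimes>\<^bsub>T\<^esub> proj g = proj (f \<otimes>\<^bsub>P\<^esub> g)"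
  and T_add: "f \<in> carrier P \<Longrightarrow> g \<in> carrier P \<Longrightarrow> proj f \<oplus>\<^bsub>T\<^esub> proj g = proj (f \<oplus>\<^bsub>P\<^esub> g)"
  and T_one: "\<one>\<^bsub>T\<^esub> = proj (e \<one>\<^bsub>A\<^esub> \<one>\<^bsub>B\<^esub>)"
  and proj_closed: "f \<in> carrier P \<Longrightarrow> proj f \<in> carrier T"
proof -
  have T: "carrier T = carrier (P Quot I)" "x \<otimes>\<^bsub>T\<^esub> y = x \<otimes>\<^bsub>P Quot I\<^esub> y" "x \<oplus>\<^bsub>T\<^esub> y = x \<oplus>\<^bsub>P Quot I\<^esub> y"
    "\<one>\<^bsub>T\<^esub> = \<one>\<^bsub>P Quot I\<^esub>" for x y
    by (simp_all add: tensor_algebra_def Let_def ring.defs)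
  have hom: "proj \<in> ring_hom P (P Quot I)" by (rule ideal.rcos_ring_hom[OF ideal_I])
  show "f \<in> carrier P \<Longrightarrow> g \<in> carrier P \<Longrightarrow> proj f \<otimes>\<^bsub>T\<^esub> proj g = proj (f \<otimes>\<^bsub>P\<^esub> g)"
    unfolding T by (rule ring_hom_mult[OF hom, symmetric])
  show "f \<in> carrier P \<Longrightarrow> g \<in> carrier P \<Longrightarrow> proj f \<oplus>\<^bsub>T\<^esub> proj g = proj (f \<oplus>\<^bsub>P\<^esub> g)"
    unfolding T by (rule ring_hom_add[OF hom, symmetric])
  show "\<one>\<^bsub>T\<^esub> = proj (e \<one>\<^bsub>A\<^esub> \<one>\<^bsub>B\<^esub>)"
    unfolding T using ring_hom_one[OF hom] MA.P_one by simp
  show "f \<in> carrier P \<Longrightarrow> proj f \<in> carrier T"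
    unfolding T by (rule ring_hom_closed[OF hom])
qed

text \<open>Scalar multiplication on the quotient is a union over all representatives of a coset. It
  collapses to one coset because \<open>I\<close> is stable under scalars: \<open>c\<close> times
  \<open>i\<close> is the product of the element \<open>c\<close> times \<open>\<one>\<close> with
  \<open>i\<close>.\<close>

lemma T_smult:
  assumes c: "c \<in> carrier F" and f: "f \<in> carrier P"
  shows "c \<odot>\<^bsub>T\<^esub> proj f = proj (c \<odot>\<^bsub>P\<^esub> f)"
proof -
  interpret P: ring P by (rule ring_P)
  interpret I: ideal I P by (rule ideal_I)
  have eq: "proj (c \<odot>\<^bsub>P\<^esub> g) = proj (c \<odot>\<^bsub>P\<^esub> f)" if g: "g \<in> proj f" for g
  proof -
    obtain i where i: "i \<in> I" "g = i \<oplus>\<^bsub>P\<^esub> f" using g by (auto simp: a_r_coset_def')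
    have ic: "i \<in> carrier P" using i(1) I.Icarr by blast
    have ci: "c \<odot>\<^bsub>P\<^esub> i \<in> I"
    proof -
      have "(c \<odot>\<^bsub>P\<^esub> \<one>\<^bsub>P\<^esub>) \<otimes>\<^bsub>P\<^esub> i \<in> I"
        by (rule I.I_l_closed[OF i(1) MA.P_smult_closed[OF c P.one_closed]])
      then show ?thesis using MA.P_smult_mult[OF c P.one_closed ic] ic by simp
    qed
    have "c \<odot>\<^bsub>P\<^esub> g = c \<odot>\<^bsub>P\<^esub> i \<oplus>\<^bsub>P\<^esub> c \<odot>\<^bsub>P\<^esub> f"
      unfolding i(2) using c MA.P_val[OF ic] MA.P_val[OF f] by (simp add: MA.P_smult MA.P_add A.F.r_distr)
    moreover have "c \<odot>\<^bsub>P\<^esub> i \<in> carrier P" "c \<odot>\<^bsub>P\<^esub> f \<in> carrier P" using MA.P_smult_closed[OF c] ic f by auto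
    ultimately have "c \<odot>\<^bsub>P\<^esub> g \<ominus>\<^bsub>P\<^esub> c \<odot>\<^bsub>P\<^esub> f = c \<odot>\<^bsub>P\<^esub> i" "c \<odot>\<^bsub>P\<^esub> g \<in> carrier P" "c \<odot>\<^bsub>P\<^esub> f \<in> carrier P"
      by (simp_all add: a_minus_def P.a_assoc P.r_neg)
    then show ?thesis using ci by (intro proj_eqI) auto
  qed
  have ne: "proj f \<noteq> {}" using I.a_rcos_self[OF f] by blast
  have "c \<odot>\<^bsub>T\<^esub> proj f = (\<Union>g\<in>proj f. proj (c \<odot>\<^bsub>P\<^esub> g))"
    by (simp add: tensor_algebra_def Let_def ring.defs)
  also have "\<dots> = (\<Union>g\<in>proj f. proj (c \<odot>\<^bsub>P\<^esub> f))"
    by (rule SUP_cong[OF refl eq])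
  also have "\<dots> = proj (c \<odot>\<^bsub>P\<^esub> f)"
    unfolding UN_constant using ne by (rule if_not_P)
  finally show ?thesis .
qed

lemma e_mult:
  "\<lbrakk>a \<in> carrier A; a' \<in> carrier A; b \<in> carrier B; b' \<in> carrier B\<rbrakk>
    \<Longrightarrow> proj (e a b) \<otimes>\<^bsub>T\<^esub> proj (e a' b') = proj (e (a \<otimes>\<^bsub>A\<^esub> a') (b \<otimes>\<^bsub>B\<^esub> b'))"
  using T_mult[OF e_closed e_closed] MA.basis_vector_mult[of "(a, b)" "(a', b')"] by simp

lemma e_add_left:
  assumes "a \<in> carrier A" "a' \<in> carrier A" "b \<in> carrier B"
  shows "proj (e (a \<oplus>\<^bsub>A\<^esub> a') b) = proj (e a b) \<oplus>\<^bsub>T\<^esub> proj (e a' b)"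
proof -
  interpret P: ring P by (rule ring_P)
  have "e (a \<oplus>\<^bsub>A\<^esub> a') b \<ominus>\<^bsub>P\<^esub> (e a b \<oplus>\<^bsub>P\<^esub> e a' b) \<in> tensor_relations F A B"
    unfolding tensor_relations_def Let_def using assms by blast
  then show ?thesis
    unfolding T_add[OF e_closed[OF assms(1,3)] e_closed[OF assms(2,3)]]
    using assms by (intro proj_eqI relations_I P.a_closed e_closed A.D.a_closed)
qed

lemma e_add_right:
  assumes "a \<in> carrier A" "b \<in> carrier B" "b' \<in> carrier B"
  shows "proj (e a (b \<oplus>\<^bsub>B\<^esub> b')) = proj (e a b) \<oplus>\<^bsub>T\<^esub> proj (e a b')"
proof -
  interpret P: ring P by (rule ring_P)
  have "e a (b \<oplus>\<^bsub>B\<^esub> b') \<ominus>\<^bsub>P\<^esub> (e a b \<oplus>\<^bsub>P\<^esub> e a b') \<in> tensor_relations F A B"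
    unfolding tensor_relations_def Let_def using assms by blast
  then show ?thesis
    unfolding T_add[OF e_closed[OF assms(1,2)] e_closed[OF assms(1,3)]]
    using assms by (intro proj_eqI relations_I P.a_closed e_closed B.D.a_closed)
qed

lemma e_smult:
  assumes "c \<in> carrier F" "a \<in> carrier A" "b \<in> carrier B"
  shows "proj (e (c \<odot>\<^bsub>A\<^esub> a) b) = c \<odot>\<^bsub>T\<^esub> proj (e a b)"
    and "proj (e a (c \<odot>\<^bsub>B\<^esub> b)) = c \<odot>\<^bsub>T\<^esub> proj (e a b)"
proof -
  have "e (c \<odot>\<^bsub>A\<^esub> a) b \<ominus>\<^bsub>P\<^esub> c \<odot>\<^bsub>P\<^esub> e a b \<in> tensor_relations F A B"
    and "e a (c \<odot>\<^bsub>B\<^esub> b) \<ominus>\<^bsub>P\<^esub> c \<odot>\<^bsub>P\<^esub> e a b \<in> tensor_relations F A B"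
    unfolding tensor_relations_def Let_def using assms by blast+
  note rel = this
  have "e (c \<odot>\<^bsub>A\<^esub> a) b \<in> carrier P" "e a (c \<odot>\<^bsub>B\<^esub> b) \<in> carrier P"
    using assms by (auto intro!: e_closed A.smult_closed B.smult_closed)
  moreover have "c \<odot>\<^bsub>P\<^esub> e a b \<in> carrier P"
    using assms by (intro MA.P_smult_closed e_closed)
  ultimately show "proj (e (c \<odot>\<^bsub>A\<^esub> a) b) = c \<odot>\<^bsub>T\<^esub> proj (e a b)"
    and "proj (e a (c \<odot>\<^bsub>B\<^esub> b)) = c \<odot>\<^bsub>T\<^esub> proj (e a b)"
    unfolding T_smult[OF assms(1) e_closed[OF assms(2,3)]]
    using relations_I[OF rel(1)] relations_I[OF rel(2)] proj_eqI by metis+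
qed

text \<open>The maps are \<open>a \<mapsto> a \<otimes> 1\<close> and
  \<open>b \<mapsto> 1 \<otimes> b\<close>, followed by the inverse of the isomorphism. Multiplied
  in either order they give the image of \<open>a \<otimes> b\<close>.\<close>

lemma commuting_homs:
  fixes D :: "('f, 'd) module"
  assumes D: "central_division_algebra F D" and iso: "algebra_isomorphic F D T"
  shows "\<exists>\<phi>\<in>ring_hom A D. \<exists>\<psi>\<in>ring_hom B D.
    (\<forall>c\<in>carrier F. \<phi> (c \<odot>\<^bsub>A\<^esub> \<one>\<^bsub>A\<^esub>) = c \<odot>\<^bsub>D\<^esub> \<one>\<^bsub>D\<^esub>) \<and>
    (\<forall>c\<in>carrier F. \<psi> (c \<odot>\<^bsub>B\<^esub> \<one>\<^bsub>B\<^esub>) = c \<odot>\<^bsub>D\<^esub> \<one>\<^bsub>D\<^esub>) \<and>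
    (\<forall>a\<in>carrier A. \<forall>b\<in>carrier B. \<phi> a \<otimes>\<^bsub>D\<^esub> \<psi> b = \<psi> b \<otimes>\<^bsub>D\<^esub> \<phi> a)"
proof -
  interpret D: central_division_algebra F D by (rule D)
  obtain h where h: "h \<in> ring_iso D T"
      "\<And>c x. c \<in> carrier F \<Longrightarrow> x \<in> carrier D \<Longrightarrow> h (c \<odot>\<^bsub>D\<^esub> x) = c \<odot>\<^bsub>T\<^esub> h x"
    using iso unfolding algebra_isomorphic_def by blast
  define k where "k = inv_into (carrier D) h"
  have k: "k \<in> ring_hom T D"
    using ring_iso_set_sym[OF D.D.ring_axioms h(1)] unfolding k_def ring_iso_def by blast
  have kh: "k (h x) = x" if "x \<in> carrier D" for x
    using h(1) that unfolding k_def ring_iso_def bij_betw_def by (intro inv_into_f_f) auto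
  note kc = ring_hom_closed[OF k] and km = ring_hom_mult[OF k] and ka = ring_hom_add[OF k] and k1 = ring_hom_one[OF k]
  define \<phi> where "\<phi> a = k (proj (e a \<one>\<^bsub>B\<^esub>))" for a
  define \<psi> where "\<psi> b = k (proj (e \<one>\<^bsub>A\<^esub> b))" for b
  note cl = proj_closed[OF e_closed]
  have oneA: "\<one>\<^bsub>A\<^esub> \<in> carrier A" and oneB: "\<one>\<^bsub>B\<^esub> \<in> carrier B" by simp_all
  have scalar: "k (c \<odot>\<^bsub>T\<^esub> proj (e \<one>\<^bsub>A\<^esub> \<one>\<^bsub>B\<^esub>)) = c \<odot>\<^bsub>D\<^esub> \<one>\<^bsub>D\<^esub>" if c: "c \<in> carrier F" for c
  proof -
    have hh: "h \<in> ring_hom D T" using h(1) unfolding ring_iso_def by blast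
    have h1: "h \<one>\<^bsub>D\<^esub> = proj (e \<one>\<^bsub>A\<^esub> \<one>\<^bsub>B\<^esub>)"
      unfolding T_one[symmetric] by (rule ring_hom_one[OF hh])
    have "k (c \<odot>\<^bsub>T\<^esub> proj (e \<one>\<^bsub>A\<^esub> \<one>\<^bsub>B\<^esub>)) = k (h (c \<odot>\<^bsub>D\<^esub> \<one>\<^bsub>D\<^esub>))"
      unfolding h(2)[OF c D.D.one_closed] h1 ..
    also have "\<dots> = c \<odot>\<^bsub>D\<^esub> \<one>\<^bsub>D\<^esub>"
      by (rule kh[OF D.smult_closed[OF c D.D.one_closed]])
    finally show ?thesis .
  qed
  have kmul: "k (proj (e (a \<otimes>\<^bsub>A\<^esub> a') (b \<otimes>\<^bsub>B\<^esub> b'))) = k (proj (e a b)) \<otimes>\<^bsub>D\<^esub> k (proj (e a' b'))"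
    if "a \<in> carrier A" "a' \<in> carrier A" "b \<in> carrier B" "b' \<in> carrier B" for a a' b b'
    unfolding e_mult[OF that, symmetric] by (rule km[OF cl[OF that(1,3)] cl[OF that(2,4)]])
  show ?thesis
  proof (intro bexI[of _ \<phi>] bexI[of _ \<psi>] conjI ballI)
    show "\<phi> \<in> ring_hom A D"
    proof (rule ring_hom_memI)
      show "\<phi> (a \<otimes>\<^bsub>A\<^esub> a') = \<phi> a \<otimes>\<^bsub>D\<^esub> \<phi> a'" if "a \<in> carrier A" "a' \<in> carrier A" for a a'
        unfolding \<phi>_def using kmul[OF that oneB oneB] by simp
      show "\<phi> (a \<oplus>\<^bsub>A\<^esub> a') = \<phi> a \<oplus>\<^bsub>D\<^esub> \<phi> a'" if "a \<in> carrier A" "a' \<in> carrier A" for a a'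
        unfolding \<phi>_def e_add_left[OF that oneB] by (rule ka[OF cl[OF that(1) oneB] cl[OF that(2) oneB]])
      show "\<phi> \<one>\<^bsub>A\<^esub> = \<one>\<^bsub>D\<^esub>" unfolding \<phi>_def using k1 T_one by simp
    qed (simp add: \<phi>_def kc cl)
    show "\<psi> \<in> ring_hom B D"
    proof (rule ring_hom_memI)
      show "\<psi> (b \<otimes>\<^bsub>B\<^esub> b') = \<psi> b \<otimes>\<^bsub>D\<^esub> \<psi> b'" if "b \<in> carrier B" "b' \<in> carrier B" for b b'
        unfolding \<psi>_def using kmul[OF oneA oneA that] by simp
      show "\<psi> (b \<oplus>\<^bsub>B\<^esub> b') = \<psi> b \<oplus>\<^bsub>D\<^esub> \<psi> b'" if "b \<in> carrier B" "b' \<in> carrier B" for b b'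
        unfolding \<psi>_def e_add_right[OF oneA that] by (rule ka[OF cl[OF oneA that(1)] cl[OF oneA that(2)]])
      show "\<psi> \<one>\<^bsub>B\<^esub> = \<one>\<^bsub>D\<^esub>" unfolding \<psi>_def using k1 T_one by simp
    qed (simp add: \<psi>_def kc cl)
    show "\<phi> (c \<odot>\<^bsub>A\<^esub> \<one>\<^bsub>A\<^esub>) = c \<odot>\<^bsub>D\<^esub> \<one>\<^bsub>D\<^esub>" if "c \<in> carrier F" for c
      unfolding \<phi>_def e_smult(1)[OF that oneA oneB] by (rule scalar[OF that])
    show "\<psi> (c \<odot>\<^bsub>B\<^esub> \<one>\<^bsub>B\<^esub>) = c \<odot>\<^bsub>D\<^esub> \<one>\<^bsub>D\<^esub>" if "c \<in> carrier F" for c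
      unfolding \<psi>_def e_smult(2)[OF that oneA oneB] by (rule scalar[OF that])
    show "\<phi> a \<otimes>\<^bsub>D\<^esub> \<psi> b = \<psi> b \<otimes>\<^bsub>D\<^esub> \<phi> a" if ab: "a \<in> carrier A" "b \<in> carrier B" for a b
    proof -
      have "\<phi> a \<otimes>\<^bsub>D\<^esub> \<psi> b = k (proj (e a b))"
        unfolding \<phi>_def \<psi>_def using kmul[OF ab(1) oneA oneB ab(2)] ab by simp
      moreover have "\<psi> b \<otimes>\<^bsub>D\<^esub> \<phi> a = k (proj (e a b))"
        unfolding \<phi>_def \<psi>_def using kmul[OF oneA ab(1) ab(2) oneB] ab by simp
      ultimately show ?thesis by simp
    qed
  qed
qed

end

text \<open>A homomorphism between division rings is injective, so inverses and the center pass to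
  the image; compatibility with scalars identifies this center with that of
  \<open>D\<close>.\<close>

lemma hom_image_central_division_subring:
  fixes A :: "('f, 'b, 'k) module_scheme" and D :: "('f, 'd, 'l) module_scheme"
  assumes A: "central_division_algebra F A" and D: "central_division_algebra F D"
    and hom: "\<phi> \<in> ring_hom A D"
    and scalar: "\<forall>c\<in>carrier F. \<phi> (c \<odot>\<^bsub>A\<^esub> \<one>\<^bsub>A\<^esub>) = c \<odot>\<^bsub>D\<^esub> \<one>\<^bsub>D\<^esub>"
  shows "inj_on \<phi> (carrier A)" and "central_division_subring D (\<phi> ` carrier A)"
proof -
  interpret A: central_division_algebra F A by (rule A)
  interpret D: central_division_algebra F D by (rule D)
  interpret h: ring_hom_ring A D \<phi> by (rule ring_hom_ringI2[OF A.D.ring_axioms D.D.ring_axioms hom])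
  have inv: "\<phi> a \<otimes>\<^bsub>D\<^esub> \<phi> (inv\<^bsub>A\<^esub> a) = \<one>\<^bsub>D\<^esub>" if "a \<in> carrier A" "a \<noteq> \<zero>\<^bsub>A\<^esub>" for a
    using h.hom_mult[of a "inv\<^bsub>A\<^esub> a"] that by simp
  have ker: "a = \<zero>\<^bsub>A\<^esub>" if "a \<in> carrier A" "\<phi> a = \<zero>\<^bsub>D\<^esub>" for a
    using inv[OF that(1)] that D.D.one_neq_zero by force
  show inj: "inj_on \<phi> (carrier A)"
  proof (rule inj_onI)
    fix a b assume ab: "a \<in> carrier A" "b \<in> carrier A" "\<phi> a = \<phi> b"
    then have "\<phi> (a \<ominus>\<^bsub>A\<^esub> b) = \<zero>\<^bsub>D\<^esub>" by (simp add: a_minus_def D.D.r_neg)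
    then have "a \<ominus>\<^bsub>A\<^esub> b = \<zero>\<^bsub>A\<^esub>" using ab by (intro ker) auto
    then show "a = b" using ab by simp
  qed
  show "central_division_subring D (\<phi> ` carrier A)"
  proof (intro central_division_subring.intro central_division_subring_axioms.intro)
    show "division_algebra D" by (rule D.division_algebra_axioms)
    show "subring (\<phi> ` carrier A) D" by (rule h.img_is_subring[OF A.D.carrier_is_subring])
    show "inv\<^bsub>D\<^esub> x \<in> \<phi> ` carrier A" if x: "x \<in> \<phi> ` carrier A" "x \<noteq> \<zero>\<^bsub>D\<^esub>" for x
    proof -
      obtain a where a: "a \<in> carrier A" "x = \<phi> a" using x(1) by blast
      have a0: "a \<noteq> \<zero>\<^bsub>A\<^esub>" using a x(2) by auto
      have ia: "inv\<^bsub>A\<^esub> a \<in> carrier A" using a a0 by simp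
      have "\<phi> (inv\<^bsub>A\<^esub> a) \<otimes>\<^bsub>D\<^esub> \<phi> a = \<one>\<^bsub>D\<^esub>" using h.hom_mult[OF ia a(1)] a a0 by simp
      then have "inv\<^bsub>D\<^esub> x = \<phi> (inv\<^bsub>A\<^esub> a)"
        unfolding a(2) using inv[OF a(1) a0] a(1) ia by (intro D.D.inv_unique'[symmetric]) auto
      then show ?thesis using ia by blast
    qed
    show "center D \<subseteq> \<phi> ` carrier A"
    proof
      fix z assume "z \<in> center D"
      then obtain c where c: "c \<in> carrier F" "z = c \<odot>\<^bsub>D\<^esub> \<one>\<^bsub>D\<^esub>" using D.center_eq by blast
      then show "z \<in> \<phi> ` carrier A" using bspec[OF scalar c(1)] A.smult_closed[OF c(1) A.D.one_closed] by (metis imageI)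
    qed
    show "x \<in> center D" if x: "x \<in> \<phi> ` carrier A" "\<And>y. y \<in> \<phi> ` carrier A \<Longrightarrow> x \<otimes>\<^bsub>D\<^esub> y = y \<otimes>\<^bsub>D\<^esub> x" for x
    proof -
      obtain a where a: "a \<in> carrier A" "x = \<phi> a" using x(1) by blast
      have "a \<otimes>\<^bsub>A\<^esub> b = b \<otimes>\<^bsub>A\<^esub> a" if b: "b \<in> carrier A" for b
        using x(2)[of "\<phi> b"] a b h.hom_mult[OF a(1) b] h.hom_mult[OF b a(1)]
        by (intro inj_onD[OF inj]) auto
      then have "a \<in> center A" using a(1) unfolding center_def by blast
      then obtain c where "c \<in> carrier F" "a = c \<odot>\<^bsub>A\<^esub> \<one>\<^bsub>A\<^esub>" using A.center_eq by blast
      then show ?thesis unfolding a(2) D.center_eq using scalar by blast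
    qed
  qed
qed

text \<open>The center is then the whole algebra, which has dimension one over itself.\<close>

lemma algebra_degree_commutative:
  assumes A: "division_algebra A" and comm: "\<And>a b. a \<in> carrier A \<Longrightarrow> b \<in> carrier A \<Longrightarrow> a \<otimes>\<^bsub>A\<^esub> b = b \<otimes>\<^bsub>A\<^esub> a"
  shows "algebra_degree A = 1"
proof -
  interpret A: division_algebra A by (rule A)
  have "center A = carrier A" using comm unfolding center_def by blast
  then have "A.dimension 1 (center A) (carrier A)"
    using A.dimension_one[OF A.center_subfield] by simp
  then have "(A.dim over center A) (carrier A) = 1" by (rule A.dimI[OF A.center_subfield])
  then show ?thesis by (simp add: algebra_degree_def)
qed

text \<open>The product of the multiples \<open>a\<close> and \<open>b\<close> of the unit is its
  multiple \<open>a * b\<close>, so a field without zero divisors makes \<open>p\<close> a prime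
  element.\<close>

lemma prime_characteristic:
  fixes F :: "('f, 'm) ring_scheme"
  assumes F: "field F" and p: "p > 0" "has_characteristic F p"
  shows "Factorial_Ring.prime p"
proof -
  interpret F: field F by (rule F)
  have ch: "add_pow F (n::nat) \<one>\<^bsub>F\<^esub> = \<zero>\<^bsub>F\<^esub> \<longleftrightarrow> p dvd n" for n
    using p(2) unfolding has_characteristic_def by blast
  have "p \<noteq> 1" using ch[of 1] by auto
  moreover have "p dvd a \<or> p dvd b" if "p dvd a * b" for a b
  proof -
    have "add_pow F a \<one>\<^bsub>F\<^esub> \<otimes>\<^bsub>F\<^esub> add_pow F b \<one>\<^bsub>F\<^esub> = add_pow F (a * b) \<one>\<^bsub>F\<^esub>"
      by (simp add: F.add_pow_ldistr F.add.nat_pow_pow mult.commute)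
    then have "add_pow F a \<one>\<^bsub>F\<^esub> \<otimes>\<^bsub>F\<^esub> add_pow F b \<one>\<^bsub>F\<^esub> = \<zero>\<^bsub>F\<^esub>"
      using ch[of "a * b"] that by simp
    then have "add_pow F a \<one>\<^bsub>F\<^esub> = \<zero>\<^bsub>F\<^esub> \<or> add_pow F b \<one>\<^bsub>F\<^esub> = \<zero>\<^bsub>F\<^esub>"
      by (intro F.integral) auto
    then show ?thesis using ch by blast
  qed
  ultimately show ?thesis using p(1) unfolding normalization_semidom_class.prime_def Factorial_Ring.prime_elem_def by auto
qed

theorem theorem2p3p1:
  fixes F :: "('f, 'm) ring_scheme"
    and D :: "('f, 'd) module"
    and v :: "'f \<Rightarrow> 'g::linordered_ab_group_add"
    and w :: "'d \<Rightarrow> 'g"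
    and p r :: nat
    and \<sigma> :: "nat \<Rightarrow> 'd set \<Rightarrow> 'd set"
    and \<pi> :: "nat \<Rightarrow> 'd"
  assumes "field F" and "valuation F v" and "henselian F v"
    and "p > 0" and "has_characteristic F p"
    and "central_division_algebra F D"
    and "\<exists>k::nat. algebra_degree D = real p ^ k"
    and "valuation D w"
    and "\<forall>c \<in> carrier F - {\<zero>\<^bsub>F\<^esub>}. w (c \<odot>\<^bsub>D\<^esub> \<one>\<^bsub>D\<^esub>) = v c"
    and "semi_ramified D w"
    and "separable_extension (residue_ring D w) (residue_center D w)"
    and "galois_lift D w r \<sigma> \<pi>"
    and "\<not> degenerate D w r \<sigma> \<pi>"
  shows "indecomposable TYPE('b) TYPE('c) F D"
proof -
  interpret D: central_division_algebra F D by (rule assms(6))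
  interpret sr: semi_ramified_division_algebra D w
  proof (intro semi_ramified_division_algebra.intro semi_ramified_division_algebra_axioms.intro
      valued_division_algebra.intro valued_division_algebra_axioms.intro)
    show "division_algebra D" by (rule D.division_algebra_axioms)
    show "D.D.finite_dimension (center D) (carrier D)" by (rule D.finite_dim)
  qed (use assms in auto)
  have prime: "Factorial_Ring.prime p" by (rule prime_characteristic[OF assms(1,4,5)])
  obtain k :: nat where "algebra_degree D = real p ^ k" using assms(7) by blast
  \<comment> \<open>The hypothesis equates real numbers; both sides come from natural numbers, so it
    descends to \<open>deg\<close>.\<close>
  then have deg: "sr.deg = p ^ k" using sr.algebra_degree_eq by (metis of_nat_eq_iff of_nat_power)
  show ?thesis
    unfolding indecomposable_def
  proof
    assume "\<exists>(A :: ('f, 'b) module) (B :: ('f, 'c) module).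
         central_division_algebra F A \<and> central_division_algebra F B \<and>
         algebra_degree A > 1 \<and> algebra_degree B > 1 \<and>
         algebra_isomorphic F D (tensor_algebra F A B)"
    then obtain A :: "('f, 'b) module" and B :: "('f, 'c) module" where
      AB: "central_division_algebra F A \<and> central_division_algebra F B \<and>
         algebra_degree A > 1 \<and> algebra_degree B > 1 \<and>
         algebra_isomorphic F D (tensor_algebra F A B)"
      by (elim exE)
    have A: "central_division_algebra F A" "algebra_degree A > 1"
      and B: "central_division_algebra F B" "algebra_degree B > 1"
      and iso: "algebra_isomorphic F D (tensor_algebra F A B)"
      using AB by blast+
    interpret tensor_factors F A B using A(1) B(1) by (rule tensor_factors.intro)
    from commuting_homs[OF assms(6) iso] obtain \<phi> \<psi> where
      \<phi>: "\<phi> \<in> ring_hom A D" "\<forall>c\<in>carrier F. \<phi> (c \<odot>\<^bsub>A\<^esub> \<one>\<^bsub>A\<^esub>) = c \<odot>\<^bsub>D\<^esub> \<one>\<^bsub>D\<^esub>" and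
      \<psi>: "\<psi> \<in> ring_hom B D" "\<forall>c\<in>carrier F. \<psi> (c \<odot>\<^bsub>B\<^esub> \<one>\<^bsub>B\<^esub>) = c \<odot>\<^bsub>D\<^esub> \<one>\<^bsub>D\<^esub>" and
      comm: "\<forall>a\<in>carrier A. \<forall>b\<in>carrier B. \<phi> a \<otimes>\<^bsub>D\<^esub> \<psi> b = \<psi> b \<otimes>\<^bsub>D\<^esub> \<phi> a"
      by blast
    note imA = hom_image_central_division_subring[OF A(1) assms(6) \<phi>]
    note imB = hom_image_central_division_subring[OF B(1) assms(6) \<psi>]
    have "(\<forall>x\<in>\<phi> ` carrier A. \<forall>y\<in>\<phi> ` carrier A. x \<otimes>\<^bsub>D\<^esub> y = y \<otimes>\<^bsub>D\<^esub> x) \<or>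
        (\<forall>x\<in>\<psi> ` carrier B. \<forall>y\<in>\<psi> ` carrier B. x \<otimes>\<^bsub>D\<^esub> y = y \<otimes>\<^bsub>D\<^esub> x)"
      by (rule sr.commuting_subrings_commutative[OF assms(12,13) prime deg imA(2) imB(2)]) (use comm in blast)
    then show False
    proof
      \<comment> \<open>Injectivity pulls commutativity back to the factor, which then has degree
        \<open>1\<close>, against the assumption on the decomposition.\<close>
      assume c: "\<forall>x\<in>\<phi> ` carrier A. \<forall>y\<in>\<phi> ` carrier A. x \<otimes>\<^bsub>D\<^esub> y = y \<otimes>\<^bsub>D\<^esub> x"
      have "a \<otimes>\<^bsub>A\<^esub> b = b \<otimes>\<^bsub>A\<^esub> a" if ab: "a \<in> carrier A" "b \<in> carrier A" for a b
        using c ab ring_hom_mult[OF \<phi>(1) ab] ring_hom_mult[OF \<phi>(1) ab(2,1)]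
        by (intro inj_onD[OF imA(1)]) auto
      then have "algebra_degree A = 1"
        by (intro algebra_degree_commutative A.division_algebra_axioms) auto
      then show False using A(2) by simp
    next
      assume c: "\<forall>x\<in>\<psi> ` carrier B. \<forall>y\<in>\<psi> ` carrier B. x \<otimes>\<^bsub>D\<^esub> y = y \<otimes>\<^bsub>D\<^esub> x"
      have "a \<otimes>\<^bsub>B\<^esub> b = b \<otimes>\<^bsub>B\<^esub> a" if ab: "a \<in> carrier B" "b \<in> carrier B" for a b
        using c ab ring_hom_mult[OF \<psi>(1) ab] ring_hom_mult[OF \<psi>(1) ab(2,1)]
        by (intro inj_onD[OF imB(1)]) auto
      then have "algebra_degree B = 1"
        by (intro algebra_degree_commutative B.division_algebra_axioms) auto
      then show False using B(2) by simp
    qed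
  qed
qed

end
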